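(* Let $\Delta:[0,\infty)\to[0,\infty)$ and $\theta:[0,\infty)\to(-\infty,0]$ be continuous functions, $x\ge0$, and let $\hat X$ be the generalized squared Bessel process II, i.e. the unique nonnegative solution of $$\hat X_t=x+2\int_0^t\sqrt{\hat X_u}\,dB_u+\int_0^t\big(\Delta(u)+2\theta(u)\hat X_u\big)du .$$ Fix $\gamma>0$. For $x_0\in\mathbb R$ let $y_{x_0}$ be the solution of the Riccati equation $$y'(t)=2y^2(t)-2y(t)\theta(t)-\gamma,\qquad y(0)=x_0 .$$ Let $(t,\lambda)\mapsto x_0(t,\lambda)$ be a $\mathcal C^1$ function such that $y_{x_0}(t)\big|_{x_0=x_0(t,\lambda)}=\lambda$ and $\big|\frac{\partial x_0(t,\lambda)}{\partial\lambda}\big|>0$. If the function $x_0\mapsto y_{x_0}(t)$ is in $\mathcal C^1$, then the unique solution of $$\frac{\partial p}{\partial t}=\big(\gamma-2\lambda^2+2\lambda\theta(t)\big)\frac{\partial p}{\partial\lambda}-\Delta(t)\lambda p,\qquad p(0,\lambda)=e^{-x\lambda},$$ i.e. the joint Laplace transform $p(t,\lambda)=\mathbb E e^{-\lambda\hat X_t-\gamma\int_0^t\hat X_udu}$ ($t,\lambda\ge0$), is given by $$p(t,\lambda)=e^{-x\phi(t,\lambda)-\psi(t,\lambda)},\qquad \phi(t,\lambda)=x_0(t,\lambda),\qquad \psi(t,\lambda)=\int_0^t\Delta(u)y_{x_0}(u)\,du\Big|_{x_0=x_0(t,\lambda)} .$$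
   Context: $B$ is a standard Brownian motion. The PDE and the function $x_0(t,\lambda)$ are considered for $t\ge0$, $\lambda\ge0$. The requirement $y_{x_0}(t)|_{x_0=x_0(t,\lambda)}=\lambda$ includes that the solution $y_{x_0}$ started from $x_0=x_0(t,\lambda)$ exists on $[0,t]$; the $\mathcal C^1$ dependence of $y_{x_0}(t)$ on $x_0$ is understood where this solution exists. *)

theory Defs
  imports "HOL-Probability.Probability"
begin

section \<open>Brownian motion and the Ito integral\<close>

text \<open>
  Time is real-valued; only nonnegative times matter. The values of a filtration
  at negative times are harmless (take them equal to the value at 0).
\<close>

definition filtered_prob_space :: "'a measure \<Rightarrow> (real \<Rightarrow> 'a measure) \<Rightarrow> bool" where
  "filtered_prob_space M F \<longleftrightarrow>
     prob_space M \<and> filtration (space M) F \<and> (\<forall>t. subalgebra M (F t))"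

definition brownian_motion ::
    "'a measure \<Rightarrow> (real \<Rightarrow> 'a measure) \<Rightarrow> (real \<Rightarrow> 'a \<Rightarrow> real) \<Rightarrow> bool" where
  "brownian_motion M F B \<longleftrightarrow>
     (\<forall>t\<ge>0. B t \<in> borel_measurable (F t)) \<and>
     (\<forall>\<omega>\<in>space M. continuous_on {0..} (\<lambda>t. B t \<omega>)) \<and>
     (AE \<omega> in M. B 0 \<omega> = 0) \<and>
     (\<forall>s t. 0 \<le> s \<longrightarrow> s < t \<longrightarrow>
        distributed M lborel (\<lambda>\<omega>. B t \<omega> - B s \<omega>) (normal_density 0 (sqrt (t - s))) \<and>
        prob_space.indep_set M (sets (F s))
          {(\<lambda>\<omega>. B t \<omega> - B s \<omega>) -` C \<inter> space M | C. C \<in> sets borel})"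

text \<open>
  The data \<open>n\<close>, \<open>\<tau>\<close>, \<open>\<xi>\<close> encode the simple process that equals \<open>\<xi> i\<close> on the interval
  \<open>{\<tau> i<..\<tau> (Suc i)}\<close> for \<open>i < n\<close> and vanishes elsewhere.
\<close>

definition simple_integrand ::
    "'a measure \<Rightarrow> (real \<Rightarrow> 'a measure) \<Rightarrow> nat \<Rightarrow> (nat \<Rightarrow> real) \<Rightarrow> (nat \<Rightarrow> 'a \<Rightarrow> real) \<Rightarrow> bool" where
  "simple_integrand M F n \<tau> \<xi> \<longleftrightarrow>
     0 \<le> \<tau> 0 \<and> (\<forall>i<n. \<tau> i \<le> \<tau> (Suc i)) \<and>
     (\<forall>i<n. \<xi> i \<in> borel_measurable (F (\<tau> i)) \<and> (\<exists>C. \<forall>\<omega>\<in>space M. \<bar>\<xi> i \<omega>\<bar> \<le> C))"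

definition simple_value ::
    "nat \<Rightarrow> (nat \<Rightarrow> real) \<Rightarrow> (nat \<Rightarrow> 'a \<Rightarrow> real) \<Rightarrow> real \<Rightarrow> 'a \<Rightarrow> real" where
  "simple_value n \<tau> \<xi> s \<omega> = (\<Sum>i<n. \<xi> i \<omega> * indicator {\<tau> i<..\<tau> (Suc i)} s)"

definition simple_integral ::
    "(real \<Rightarrow> 'a \<Rightarrow> real) \<Rightarrow> nat \<Rightarrow> (nat \<Rightarrow> real) \<Rightarrow> (nat \<Rightarrow> 'a \<Rightarrow> real) \<Rightarrow> real \<Rightarrow> 'a \<Rightarrow> real" where
  "simple_integral B n \<tau> \<xi> t \<omega> =
     (\<Sum>i<n. \<xi> i \<omega> * (B (min (\<tau> (Suc i)) t) \<omega> - B (min (\<tau> i) t) \<omega>))"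

definition progressively_measurable ::
    "(real \<Rightarrow> 'a measure) \<Rightarrow> (real \<Rightarrow> 'a \<Rightarrow> real) \<Rightarrow> bool" where
  "progressively_measurable F H \<longleftrightarrow>
     (\<forall>t\<ge>0. (\<lambda>(s, \<omega>). H s \<omega>) \<in> borel_measurable (restrict_space borel {0..t} \<Otimes>\<^sub>M F t))"

text \<open>
  \<open>is_ito_integral M F B H I\<close> says that \<open>I\<close> is a continuous version of the Ito integral of
  \<open>H\<close> with respect to \<open>B\<close>, for a progressively measurable \<open>H\<close> with locally square integrable
  paths: it is the limit in probability of the integrals of simple processes that approximate
  \<open>H\<close> in the sense that the pathwise squared \<open>L\<^sup>2\<close>-distance on every \<open>{0..T}\<close> tends to 0 in
  probability. This determines \<open>I\<close> up to indistinguishability. The nonnegative integral is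
  used so that no integrability is silently presupposed.
\<close>

definition is_ito_integral ::
    "'a measure \<Rightarrow> (real \<Rightarrow> 'a measure) \<Rightarrow> (real \<Rightarrow> 'a \<Rightarrow> real) \<Rightarrow>
     (real \<Rightarrow> 'a \<Rightarrow> real) \<Rightarrow> (real \<Rightarrow> 'a \<Rightarrow> real) \<Rightarrow> bool" where
  "is_ito_integral M F B H I \<longleftrightarrow>
     progressively_measurable F H \<and>
     (\<forall>T\<ge>0. AE \<omega> in M. (\<integral>\<^sup>+s\<in>{0..T}. ennreal ((H s \<omega>)\<^sup>2) \<partial>lborel) < \<infinity>) \<and>
     (\<forall>t\<ge>0. I t \<in> borel_measurable M) \<and>
     (\<forall>\<omega>\<in>space M. continuous_on {0..} (\<lambda>t. I t \<omega>)) \<and>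
     (\<exists>N \<tau> \<xi>.
        (\<forall>k. simple_integrand M F (N k) (\<tau> k) (\<xi> k)) \<and>
        (\<forall>T\<ge>0. \<forall>\<epsilon>>0.
           (\<lambda>k. measure M {\<omega>\<in>space M.
               ennreal \<epsilon> < (\<integral>\<^sup>+s\<in>{0..T}. ennreal ((simple_value (N k) (\<tau> k) (\<xi> k) s \<omega> - H s \<omega>)\<^sup>2) \<partial>lborel)})
             \<longlonglongrightarrow> 0) \<and>
        (\<forall>t\<ge>0. \<forall>\<epsilon>>0.
           (\<lambda>k. measure M {\<omega>\<in>space M. \<epsilon> < \<bar>simple_integral B (N k) (\<tau> k) (\<xi> k) t \<omega> - I t \<omega>\<bar>})
             \<longlonglongrightarrow> 0))"

section \<open>The generalized squared Bessel process II\<close>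

definition gen_sq_bessel2 ::
    "'a measure \<Rightarrow> (real \<Rightarrow> 'a measure) \<Rightarrow> (real \<Rightarrow> 'a \<Rightarrow> real) \<Rightarrow>
     (real \<Rightarrow> real) \<Rightarrow> (real \<Rightarrow> real) \<Rightarrow> real \<Rightarrow> (real \<Rightarrow> 'a \<Rightarrow> real) \<Rightarrow> bool" where
  "gen_sq_bessel2 M F B \<Delta> \<theta> x X \<longleftrightarrow>
     (\<forall>t\<ge>0. X t \<in> borel_measurable (F t)) \<and>
     (\<forall>\<omega>\<in>space M. continuous_on {0..} (\<lambda>t. X t \<omega>)) \<and>
     (\<forall>\<omega>\<in>space M. \<forall>t\<ge>0. 0 \<le> X t \<omega>) \<and>
     (\<exists>I. is_ito_integral M F B (\<lambda>u \<omega>. sqrt (X u \<omega>)) I \<and>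
        (AE \<omega> in M. \<forall>t\<ge>0.
           X t \<omega> = x + 2 * I t \<omega> + integral {0..t} (\<lambda>u. \<Delta> u + 2 * \<theta> u * X u \<omega>)))"

definition joint_laplace ::
    "'a measure \<Rightarrow> (real \<Rightarrow> 'a \<Rightarrow> real) \<Rightarrow> real \<Rightarrow> real \<Rightarrow> real \<Rightarrow> real" where
  "joint_laplace M X \<gamma> t l =
     (\<integral>\<omega>. exp (- l * X t \<omega> - \<gamma> * integral {0..t} (\<lambda>u. X u \<omega>)) \<partial>M)"

section \<open>The Riccati equation and the partial differential equation\<close>

definition riccati_solution ::
    "(real \<Rightarrow> real) \<Rightarrow> real \<Rightarrow> real \<Rightarrow> real \<Rightarrow> (real \<Rightarrow> real) \<Rightarrow> bool" where
  "riccati_solution \<theta> \<gamma> a T z \<longleftrightarrow>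
     z 0 = a \<and>
     (\<forall>s\<in>{0..T}. (z has_real_derivative 2 * (z s)\<^sup>2 - 2 * z s * \<theta> s - \<gamma>) (at s within {0..T}))"

text \<open>
  \<open>riccati_domain \<theta> \<gamma> t\<close> is the set of initial values whose solution has not exploded by
  time \<open>t\<close>. A Riccati flow maps each initial value to its maximal solution; its values after
  the explosion time are unconstrained.
\<close>

definition riccati_domain :: "(real \<Rightarrow> real) \<Rightarrow> real \<Rightarrow> real \<Rightarrow> real set" where
  "riccati_domain \<theta> \<gamma> t = {a. \<exists>z. riccati_solution \<theta> \<gamma> a t z}"

definition riccati_flow :: "(real \<Rightarrow> real) \<Rightarrow> real \<Rightarrow> (real \<Rightarrow> real \<Rightarrow> real) \<Rightarrow> bool" where
  "riccati_flow \<theta> \<gamma> y \<longleftrightarrow>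
     (\<forall>t\<ge>0. \<forall>a\<in>riccati_domain \<theta> \<gamma> t. riccati_solution \<theta> \<gamma> a t (y a))"

text \<open>
  \<open>f\<close> is continuously differentiable on the closed quadrant with partial derivatives \<open>ft\<close>
  and \<open>fl\<close>; on the boundary the derivatives are one-sided.
\<close>

definition C1_quadrant ::
    "(real \<Rightarrow> real \<Rightarrow> real) \<Rightarrow> (real \<Rightarrow> real \<Rightarrow> real) \<Rightarrow> (real \<Rightarrow> real \<Rightarrow> real) \<Rightarrow> bool" where
  "C1_quadrant f ft fl \<longleftrightarrow>
     (\<forall>t\<ge>0. \<forall>l\<ge>0.
        ((\<lambda>s. f s l) has_real_derivative ft t l) (at t within {0..}) \<and>
        ((\<lambda>k. f t k) has_real_derivative fl t l) (at l within {0..})) \<and>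
     continuous_on ({0..} \<times> {0..}) (\<lambda>(t, l). ft t l) \<and>
     continuous_on ({0..} \<times> {0..}) (\<lambda>(t, l). fl t l)"

definition laplace_pde_solution ::
    "(real \<Rightarrow> real) \<Rightarrow> (real \<Rightarrow> real) \<Rightarrow> real \<Rightarrow> real \<Rightarrow> (real \<Rightarrow> real \<Rightarrow> real) \<Rightarrow> bool" where
  "laplace_pde_solution \<Delta> \<theta> x \<gamma> p \<longleftrightarrow>
     (\<exists>pt pl. C1_quadrant p pt pl \<and>
        (\<forall>t\<ge>0. \<forall>l\<ge>0. pt t l = (\<gamma> - 2 * l\<^sup>2 + 2 * l * \<theta> t) * pl t l - \<Delta> t * l * p t l)) \<and>
     (\<forall>l\<ge>0. p 0 l = exp (- x * l))"

end

(*
  Let z be the Riccati solution on [0,T] with z(T) = l.  It is nonnegative because l >= 0, and the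
  process exp(-z(s) X_s - gamma int_0^s X + int_0^s Delta z) is an exponential local martingale with
  integrand -2 z sqrt(X).  Taking expectations at times 0 and T gives the formula, once it is known
  that no mass is lost.  For simple integrands the exponential has expectation 1 by the Gaussian
  Laplace transform; Fatou's lemma gives the supermartingale inequality for X.  Applied with negative
  weights, this inequality yields exponential moments of int_s^t X for t - s small, a condition of
  Novikov type that turns the inequality into an equality on short intervals; the tower property
  then covers [0,T].

  The partial differential equation follows from the flow property of the Riccati solutions, and its
  solutions are unique because along such a solution (a characteristic) it becomes a linear ordinary
  differential equation.
*)
theory Submission
  imports Defs
begin

section \<open>The Riccati flow and the partial differential equation\<close>

text \<open>The Ito integral is given only as a limit in probability of simple integrals, so no Ito
  formula is at hand. Two things replace it. Brownian increments are Gaussian and independent of the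
  past, which gives exact exponential identities for simple integrands. And since the weight z is
  deterministic, int z dX is integrated by parts path by path; the probabilistic limit is then taken
  only for weights constant on an interval, and C1 weights are reached by refining a grid for each
  fixed path. Both limits can lose mass, and both losses are controlled by exponential moments of
  int X: 12 w^2 int X for a constant weight w, 24 W^2 int X for a weight bounded by W. These moments
  are established on short intervals, hence the subdivision of [0,T]. On the analytic side, the
  difference of two Riccati solutions solves a linear equation exactly. Uniqueness, contraction and
  the derivative in the end value are read off from one formula. With the flow property this also
  yields the time derivative of the candidate, by moving the end value instead of differentiating
  the flow in its end time.\<close>

lemma linear_ode_solution:
  fixes u g :: "real \<Rightarrow> real"
  assumes g: "continuous_on {0..T} g"
    and u: "\<And>s. s \<in> {0..T} \<Longrightarrow> (u has_real_derivative u s * g s) (at s within {0..T})"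
    and st: "0 \<le> s" "s \<le> t" "t \<le> T"
  shows "u s = u t * exp (- integral {s..t} g)"
proof -
  define G where "G r = integral {0..r} g" for r
  have G: "(G has_real_derivative g r) (at r within {0..T})" if "r \<in> {0..T}" for r
    unfolding G_def using integral_has_real_derivative[OF g that] .
  have "((\<lambda>r. u r * exp (- G r)) has_field_derivative 0) (at r within {0..T})"
    if "r \<in> {0..T}" for r
    by (rule derivative_eq_intros u[OF that] G[OF that] refl)+ (simp add: algebra_simps)
  then obtain c where c: "\<And>r. r \<in> {0..T} \<Longrightarrow> u r * exp (- G r) = c"
    using has_field_derivative_zero_constant[of "{0..T}" "\<lambda>r. u r * exp (- G r)"] by auto
  have e: "u s * exp (- G s) = u t * exp (- G t)"
    using c[of s] c[of t] st by simp
  have "g integrable_on {0..t}"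
    by (rule integrable_continuous_real, rule continuous_on_subset[OF g]) (use st in auto)
  then have I: "G s + integral {s..t} g = G t"
    unfolding G_def by (rule Henstock_Kurzweil_Integration.integral_combine[OF st(1,2)])
  have "u s = u s * exp (- G s) * exp (G s)"
    by (simp add: exp_minus)
  also have "\<dots> = u t * exp (G s - G t)"
    unfolding e by (simp add: exp_diff exp_minus divide_simps)
  finally show ?thesis using I by (simp add: algebra_simps)
qed

lemma riccati_solution_continuous:
  assumes "riccati_solution \<theta> \<gamma> a T z"
  shows "continuous_on {0..T} z"
  by (rule DERIV_continuous_on) (use assms in \<open>auto simp: riccati_solution_def\<close>)

lemma riccati_solution_subinterval:
  assumes "riccati_solution \<theta> \<gamma> a T z" "t \<le> T"
  shows "riccati_solution \<theta> \<gamma> a t z"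
  unfolding riccati_solution_def
proof (intro conjI ballI)
  fix s assume s: "s \<in> {0..t}"
  have "(z has_real_derivative 2 * (z s)\<^sup>2 - 2 * z s * \<theta> s - \<gamma>) (at s within {0..T})"
    using assms s by (auto simp: riccati_solution_def)
  then show "(z has_real_derivative 2 * (z s)\<^sup>2 - 2 * z s * \<theta> s - \<gamma>) (at s within {0..t})"
    by (rule has_field_derivative_subset) (use assms in auto)
qed (use assms in \<open>auto simp: riccati_solution_def\<close>)

text \<open>The nonlinearity is quadratic, so
  \<open>2 * z1^2 - 2 * z2^2 = 2 * (z1 + z2) * (z1 - z2)\<close> and the difference solves a linear
  equation whose coefficient contains the solutions themselves. Equality at time \<open>t\<close>
  forces equality at all earlier times, which is the form of uniqueness used below.\<close>

lemma riccati_difference: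
  assumes \<theta>: "continuous_on {0..T} \<theta>"
    and z1: "riccati_solution \<theta> \<gamma> a T z1" and z2: "riccati_solution \<theta> \<gamma> b T z2"
    and st: "0 \<le> s" "s \<le> t" "t \<le> T"
  shows "z1 s - z2 s = (z1 t - z2 t) * exp (- integral {s..t} (\<lambda>v. 2 * (z1 v + z2 v) - 2 * \<theta> v))"
proof (rule linear_ode_solution[OF _ _ st])
  show "continuous_on {0..T} (\<lambda>v. 2 * (z1 v + z2 v) - 2 * \<theta> v)"
    by (intro continuous_intros \<theta> riccati_solution_continuous[OF z1] riccati_solution_continuous[OF z2])
  fix r assume r: "r \<in> {0..T}"
  have 1: "(z1 has_real_derivative 2 * (z1 r)\<^sup>2 - 2 * z1 r * \<theta> r - \<gamma>) (at r within {0..T})"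
    and 2: "(z2 has_real_derivative 2 * (z2 r)\<^sup>2 - 2 * z2 r * \<theta> r - \<gamma>) (at r within {0..T})"
    using z1 z2 r by (auto simp: riccati_solution_def)
  show "((\<lambda>r. z1 r - z2 r) has_real_derivative (z1 r - z2 r) * (2 * (z1 r + z2 r) - 2 * \<theta> r))
      (at r within {0..T})"
    by (rule DERIV_cong[OF DERIV_diff[OF 1 2]]) (simp add: algebra_simps power2_eq_square)
qed

text \<open>With \<open>G\<close> the integral of \<open>2 * z - 2 * \<theta>\<close>, the product
  \<open>z * exp (- G)\<close> has derivative \<open>- \<gamma> * exp (- G)\<close> and so
  decreases. Its nonnegative value at the final time bounds it from below at all earlier
  times.\<close>

lemma riccati_nonneg:
  assumes \<theta>: "continuous_on {0..T} \<theta>" and z: "riccati_solution \<theta> \<gamma> a T z"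
    and \<gamma>: "0 < \<gamma>" and zT: "0 \<le> z T" and s: "0 \<le> s" "s \<le> T"
  shows "0 \<le> z s"
proof -
  define G where "G r = integral {0..r} (\<lambda>v. 2 * z v - 2 * \<theta> v)" for r
  have cont: "continuous_on {0..T} (\<lambda>v. 2 * z v - 2 * \<theta> v)"
    by (intro continuous_intros \<theta> riccati_solution_continuous[OF z])
  have G: "(G has_real_derivative 2 * z r - 2 * \<theta> r) (at r within {0..T})" if "r \<in> {0..T}" for r
    unfolding G_def using integral_has_real_derivative[OF cont that] .
  have d: "((\<lambda>r. z r * exp (- G r)) has_real_derivative - \<gamma> * exp (- G r)) (at r within {0..T})"
    if r: "r \<in> {0..T}" for r
  proof -
    have "(z has_real_derivative 2 * (z r)\<^sup>2 - 2 * z r * \<theta> r - \<gamma>) (at r within {0..T})"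
      using z r by (auto simp: riccati_solution_def)
    from DERIV_mult[OF this DERIV_chain2[OF DERIV_exp DERIV_minus[OF G[OF r]]]] show ?thesis
      by (rule DERIV_cong) (simp add: algebra_simps power2_eq_square)
  qed
  have ftc: "((\<lambda>r. - \<gamma> * exp (- G r)) has_integral (z T * exp (- G T) - z s * exp (- G s))) {s..T}"
  proof (rule fundamental_theorem_of_calculus[OF s(2)])
    fix r assume "r \<in> {s..T}"
    then show "((\<lambda>r. z r * exp (- G r)) has_vector_derivative - \<gamma> * exp (- G r)) (at r within {s..T})"
      unfolding has_real_derivative_iff_has_vector_derivative[symmetric]
      by (intro has_field_derivative_subset[OF d]) (use s in auto)
  qed
  have "z T * exp (- G T) - z s * exp (- G s) \<le> 0"
    by (rule has_integral_le[OF ftc has_integral_0]) (use \<gamma> in simp)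
  moreover have "0 \<le> z T * exp (- G T)" using zT by simp
  ultimately have "0 \<le> z s * exp (- G s)" by linarith
  then show ?thesis by (simp add: zero_le_mult_iff)
qed

section \<open>Characteristics: the Riccati flow parametrized by its end value\<close>

locale riccati_characteristics =
  fixes \<theta> :: "real \<Rightarrow> real" and \<gamma> :: real and y x0 x0_t x0_l :: "real \<Rightarrow> real \<Rightarrow> real"
  assumes \<theta>_cont: "continuous_on {0..} \<theta>" and \<theta>_nonpos: "\<And>t. 0 \<le> t \<Longrightarrow> \<theta> t \<le> 0"
    and \<gamma>_pos: "0 < \<gamma>"
    and flow: "riccati_flow \<theta> \<gamma> y"
    and x0_C1: "C1_quadrant x0 x0_t x0_l"
    and x0_domain: "\<And>t l. 0 \<le> t \<Longrightarrow> 0 \<le> l \<Longrightarrow> x0 t l \<in> riccati_domain \<theta> \<gamma> t"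
    and x0_hits: "\<And>t l. 0 \<le> t \<Longrightarrow> 0 \<le> l \<Longrightarrow> y (x0 t l) t = l"
    and x0_l_nz: "\<And>t l. 0 \<le> t \<Longrightarrow> 0 \<le> l \<Longrightarrow> x0_l t l \<noteq> 0"
begin

text \<open>\<open>w t l\<close> is the Riccati solution on \<open>{0..t}\<close> that ends at \<open>l\<close>; in particular \<open>w t l 0 = x0 t l\<close>.
  It is a characteristic of the partial differential equation.\<close>

definition w :: "real \<Rightarrow> real \<Rightarrow> real \<Rightarrow> real" where
  "w t l s = y (x0 t l) s"

lemma w_solution: "0 \<le> t \<Longrightarrow> 0 \<le> l \<Longrightarrow> riccati_solution \<theta> \<gamma> (x0 t l) t (w t l)"
  using flow x0_domain unfolding riccati_flow_def w_def[abs_def] by blast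

lemma w_0: "0 \<le> t \<Longrightarrow> 0 \<le> l \<Longrightarrow> w t l 0 = x0 t l"
  using w_solution by (simp add: riccati_solution_def)

lemma w_end: "0 \<le> t \<Longrightarrow> 0 \<le> l \<Longrightarrow> w t l t = l"
  using x0_hits by (simp add: w_def)

lemma \<theta>_cont': "0 \<le> s \<Longrightarrow> continuous_on {s..t} \<theta>"
  by (rule continuous_on_subset[OF \<theta>_cont]) auto

lemma w_nonneg: "0 \<le> l \<Longrightarrow> 0 \<le> s \<Longrightarrow> s \<le> t \<Longrightarrow> 0 \<le> w t l s"
  using riccati_nonneg[OF \<theta>_cont' w_solution \<gamma>_pos, of t l s] by (auto simp: w_end)

lemma w_continuous: "0 \<le> l \<Longrightarrow> 0 \<le> s \<Longrightarrow> s \<le> t \<Longrightarrow> continuous_on {s..t} (w t l)"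
  by (rule continuous_on_subset[OF riccati_solution_continuous[OF w_solution]]) auto

lemma w_deriv:
  assumes "0 \<le> l" "0 \<le> s" "s \<le> t"
  shows "(w t l has_real_derivative 2 * (w t l s)\<^sup>2 - 2 * w t l s * \<theta> s - \<gamma>) (at s within {0..t})"
  using w_solution[of t l] assms by (auto simp: riccati_solution_def)

text \<open>Both sides solve the Riccati equation on \<open>{0..s}\<close> and agree at time
  \<open>s\<close>, where \<open>w\<close> takes its prescribed end value. This cocycle property
  lets a change of the end time be traded for a change of the end value.\<close>

lemma w_flow:
  assumes "0 \<le> l" "0 \<le> u" "u \<le> s" "s \<le> t"
  shows "w s (w t l s) u = w t l u"
proof -
  have nn: "0 \<le> w t l s" using w_nonneg assms by simp
  have s1: "riccati_solution \<theta> \<gamma> (x0 s (w t l s)) s (w s (w t l s))"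
    using w_solution nn assms by simp
  have s2: "riccati_solution \<theta> \<gamma> (x0 t l) s (w t l)"
    using riccati_solution_subinterval[OF w_solution[of t l]] assms by simp
  show ?thesis
    using riccati_difference[OF \<theta>_cont' s1 s2, of u s] w_end[OF _ nn, of s] assms by simp
qed

lemma w_diff:
  assumes "0 \<le> l" "0 \<le> l'" "0 \<le> s" "s \<le> t"
  shows "w t l' s - w t l s =
    (l' - l) * exp (- integral {s..t} (\<lambda>v. 2 * (w t l' v + w t l v) - 2 * \<theta> v))"
  using riccati_difference[OF \<theta>_cont' w_solution w_solution, of t l' l s t] assms
  by (simp add: w_end)

text \<open>Nonnegative solutions and \<open>\<theta> \<le> 0\<close> make the exponent in
  \<open>w_diff\<close> nonpositive. Going backwards in time thus brings solutions together, with a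
  constant 1 that does not depend on \<open>t\<close>.\<close>

lemma w_contraction:
  assumes "0 \<le> l" "0 \<le> l'" "0 \<le> s" "s \<le> t"
  shows "\<bar>w t l' s - w t l s\<bar> \<le> \<bar>l' - l\<bar>"
proof -
  have "0 \<le> integral {s..t} (\<lambda>v. 2 * (w t l' v + w t l v) - 2 * \<theta> v)"
  proof (rule integral_nonneg)
    show "(\<lambda>v. 2 * (w t l' v + w t l v) - 2 * \<theta> v) integrable_on {s..t}"
      by (rule integrable_continuous_real) (intro continuous_intros w_continuous \<theta>_cont' assms)
    show "0 \<le> 2 * (w t l' v + w t l v) - 2 * \<theta> v" if "v \<in> {s..t}" for v
      using that assms w_nonneg[of l v t] w_nonneg[of l' v t] \<theta>_nonpos[of v] by auto
  qed
  then show ?thesis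
    by (simp add: w_diff[OF assms] abs_mult mult_left_le)
qed

text \<open>The limit of the exponential factor in \<open>w_diff\<close> as \<open>l'\<close> tends
  to \<open>l\<close>, that is, the derivative of \<open>w t l s\<close> in the end value
  \<open>l\<close>.\<close>

definition D :: "real \<Rightarrow> real \<Rightarrow> real \<Rightarrow> real" where
  "D t l s = exp (- integral {s..t} (\<lambda>v. 4 * w t l v - 2 * \<theta> v))"

text \<open>The difference quotient in \<open>k\<close> equals \<open>exp (- J k)\<close> exactly,
  so only continuity of \<open>J\<close> at \<open>l\<close> has to be shown; it follows from the
  contraction, integrated over \<open>{s..t}\<close>.\<close>

lemma w_l_deriv:
  assumes l: "0 \<le> l" and s: "0 \<le> s" "s \<le> t"
  shows "((\<lambda>k. w t k s) has_real_derivative D t l s) (at l within {0..})"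
proof -
  define J where "J k = integral {s..t} (\<lambda>v. 2 * (w t k v + w t l v) - 2 * \<theta> v)" for k
  have int: "(\<lambda>v. 2 * (w t k v + w t l v) - 2 * \<theta> v) integrable_on {s..t}" if "0 \<le> k" for k
    by (rule integrable_continuous_real) (intro continuous_intros w_continuous \<theta>_cont' that l s)
  have bd: "\<bar>J k - J l\<bar> \<le> 2 * \<bar>k - l\<bar> * (t - s)" if "0 \<le> k" for k
  proof -
    have "J k - J l = integral {s..t} (\<lambda>v. 2 * (w t k v - w t l v))"
      unfolding J_def
      by (subst Henstock_Kurzweil_Integration.integral_diff[OF int[OF that] int[OF l], symmetric])
        (simp add: algebra_simps)
    moreover have cont: "continuous_on {s..t} (\<lambda>v. 2 * (w t k v - w t l v))"
      by (intro continuous_intros w_continuous that l s)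
    moreover have le: "norm (2 * (w t k v - w t l v)) \<le> 2 * \<bar>k - l\<bar>" if v: "v \<in> {s..t}" for v
      using w_contraction[OF l \<open>0 \<le> k\<close>, of v t] v s unfolding real_norm_def abs_mult by simp
    have "norm (integral {s..t} (\<lambda>v. 2 * (w t k v - w t l v))) \<le> 2 * \<bar>k - l\<bar> * (t - s)"
      by (rule integral_bound[OF s(2) cont le])
    ultimately show ?thesis by simp
  qed
  have "((\<lambda>k. J k - J l) \<longlongrightarrow> 0) (at l within {0..})"
  proof (rule Lim_null_comparison)
    show "\<forall>\<^sub>F k in at l within {0..}. norm (J k - J l) \<le> 2 * \<bar>k - l\<bar> * (t - s)"
      using bd by (auto simp: eventually_at_filter)
    show "((\<lambda>k. 2 * \<bar>k - l\<bar> * (t - s)) \<longlongrightarrow> 0) (at l within {0..})"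
      by (auto intro!: tendsto_eq_intros)
  qed
  then have "(J \<longlongrightarrow> J l) (at l within {0..})"
    by (simp add: LIM_zero_iff)
  then have lim: "((\<lambda>k. exp (- J k)) \<longlongrightarrow> exp (- J l)) (at l within {0..})"
    by (intro tendsto_intros)
  have "J l = integral {s..t} (\<lambda>v. 4 * w t l v - 2 * \<theta> v)"
    unfolding J_def by simp
  then have D: "exp (- J l) = D t l s" by (simp add: D_def)
  have "((\<lambda>k. (w t k s - w t l s) / (k - l)) \<longlongrightarrow> D t l s) (at l within {0..})"
    using lim unfolding D
    by (rule Lim_transform_eventually)
       (use w_diff[OF l _ s] in \<open>auto simp: eventually_at_filter J_def\<close>)
  then show ?thesis by (simp add: has_field_derivative_iff)
qed

text \<open>Derivatives within \<open>{0..}\<close> are unique because the filter is nontrivial,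
  also at the corner \<open>l = 0\<close>. Through this identity the assumed joint continuity of
  \<open>x0_l\<close> becomes available for \<open>D\<close>.\<close>

lemma x0_l_eq_D:
  assumes "0 \<le> t" "0 \<le> l"
  shows "x0_l t l = D t l 0"
proof -
  have "((\<lambda>k. x0 t k) has_real_derivative x0_l t l) (at l within {0..})"
    using x0_C1 assms by (auto simp: C1_quadrant_def)
  moreover have "((\<lambda>k. x0 t k) has_real_derivative D t l 0) (at l within {0..})"
    by (rule has_field_derivative_transform_within[OF w_l_deriv[of l 0 t] zero_less_one])
      (use assms in \<open>auto simp: w_0\<close>)
  moreover have "at l within {0..} \<noteq> bot"
  proof -
    have "at l within {l<..} \<le> at l within {0..}"
      by (rule at_le) (use assms in auto)
    then show ?thesis
      using trivial_limit_at_right_real[of l] by (auto simp: bot_unique)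
  qed
  ultimately show ?thesis
    using has_field_derivative_unique by blast
qed

end

text \<open>\<open>C1_quadrant\<close> speaks of partial derivatives only. One partial derivative at
  the point and continuity of the other give the total derivative, which the chain rule along a
  characteristic requires.\<close>

lemma quadrant_has_derivative:
  fixes f ft fl :: "real \<Rightarrow> real \<Rightarrow> real"
  assumes ft: "((\<lambda>s. f s l) has_real_derivative ft t l) (at t within {0..})"
    and fl: "\<And>t l. 0 \<le> t \<Longrightarrow> 0 \<le> l \<Longrightarrow> ((\<lambda>k. f t k) has_real_derivative fl t l) (at l within {0..})"
    and cont: "continuous_on ({0..} \<times> {0..}) (\<lambda>(t, l). fl t l)"
    and tl: "0 \<le> t" "0 \<le> l"
  shows "((\<lambda>(t, l). f t l) has_derivative (\<lambda>(a, b). ft t l * a + fl t l * b)) (at (t, l) within {0..} \<times> {0..})"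
proof -
  have "((\<lambda>(t, l). f t l) has_derivative (\<lambda>(a, b). ft t l * a + blinfun_mult_right (fl t l) b))
      (at (t, l) within {0..} \<times> {0..})"
  proof (rule has_derivative_partialsI)
    show "((\<lambda>s. f s l) has_derivative (*) (ft t l)) (at t within {0..})"
      using ft by (simp add: has_field_derivative_def)
    show "((\<lambda>k. f s k) has_derivative blinfun_apply (blinfun_mult_right (fl s k))) (at k within {0..})"
      if "s \<in> {0..}" "k \<in> {0..}" for s k
      using fl[of s k] that by (simp add: has_field_derivative_def)
    have "continuous_on ({0..} \<times> {0..}) (\<lambda>(t, l). blinfun_mult_right (fl t l))"
      using bounded_linear.continuous_on[OF bounded_linear_blinfun_mult_right cont]
      by (simp add: case_prod_unfold)
    then show "continuous (at (t, l) within {0..} \<times> {0..}) (\<lambda>(t, l). blinfun_mult_right (fl t l))"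
      using tl by (auto simp: continuous_on_eq_continuous_within)
  qed (use tl in auto)
  then show ?thesis by simp
qed

section \<open>Joint continuity of the characteristics and of their derivative in the end
  value\<close>

context riccati_characteristics
begin

text \<open>For \<open>w \<ge> 0\<close> and \<open>\<theta> \<le> 0\<close> the right-hand side of
  the Riccati equation is at least \<open>- \<gamma>\<close>. Integrating this up to the end time,
  where the value is \<open>l\<close>, bounds the characteristic at earlier times.\<close>

lemma w_le:
  assumes l: "0 \<le> l" and s: "0 \<le> s" "s \<le> t"
  shows "w t l s \<le> l + \<gamma> * (t - s)"
proof -
  have 1: "((\<lambda>r. 2 * (w t l r)\<^sup>2 - 2 * w t l r * \<theta> r - \<gamma>) has_integral (w t l t - w t l s)) {s..t}"
  proof (rule fundamental_theorem_of_calculus[OF s(2)])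
    fix r assume "r \<in> {s..t}"
    then show "(w t l has_vector_derivative 2 * (w t l r)\<^sup>2 - 2 * w t l r * \<theta> r - \<gamma>) (at r within {s..t})"
      unfolding has_real_derivative_iff_has_vector_derivative[symmetric]
      by (intro has_field_derivative_subset[OF w_deriv[OF l]]) (use s in auto)
  qed
  have 2: "((\<lambda>_. - \<gamma>) has_integral (t - s) * - \<gamma>) {s..t}"
    using has_integral_const_real[of "- \<gamma>" s t] s by simp
  have "(t - s) * - \<gamma> \<le> w t l t - w t l s"
  proof (rule has_integral_le[OF 2 1])
    fix r assume "r \<in> {s..t}"
    then have "0 \<le> w t l r" "\<theta> r \<le> 0" using w_nonneg[OF l] \<theta>_nonpos s by auto
    then show "- \<gamma> \<le> 2 * (w t l r)\<^sup>2 - 2 * w t l r * \<theta> r - \<gamma>"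
      using mult_nonneg_nonpos[of "w t l r" "\<theta> r"] zero_le_power2[of "w t l r"] by linarith
  qed
  then show ?thesis using w_end[of t l] l s by (simp add: algebra_simps)
qed

text \<open>By \<open>w_le\<close> all these characteristics stay in one interval
  \<open>[0, K]\<close>, so the right-hand side of the equation has a common bound \<open>C\<close>.
  Joint continuity needs this uniformity in the end time and the end value.\<close>

lemma w_lipschitz_time:
  "\<exists>C\<ge>0. \<forall>t l s s'. 0 \<le> l \<longrightarrow> l \<le> L \<longrightarrow> t \<le> T \<longrightarrow> 0 \<le> s \<longrightarrow> s \<le> t \<longrightarrow> 0 \<le> s' \<longrightarrow> s' \<le> t \<longrightarrow>
      \<bar>w t l s - w t l s'\<bar> \<le> C * \<bar>s - s'\<bar>"
proof -
  have "compact (\<theta> ` {0..T})"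
    by (rule compact_continuous_image[OF \<theta>_cont']) auto
  then obtain Q where Q: "\<And>s. s \<in> {0..T} \<Longrightarrow> \<bar>\<theta> s\<bar> \<le> Q"
    using compact_imp_bounded bounded_iff by (metis imageI real_norm_def)
  define K where "K = \<bar>L\<bar> + \<gamma> * \<bar>T\<bar>"
  define C where "C = 2 * K\<^sup>2 + 2 * K * \<bar>Q\<bar> + \<gamma>"
  have K: "0 \<le> K" using \<gamma>_pos by (simp add: K_def)
  show ?thesis
  proof (intro exI[of _ C] conjI allI impI)
    show "0 \<le> C" using K \<gamma>_pos by (simp add: C_def)
    fix t l s s' :: real
    assume l: "0 \<le> l" "l \<le> L" and t: "t \<le> T" and s: "0 \<le> s" "s \<le> t" "0 \<le> s'" "s' \<le> t"
    have bd: "norm (2 * (w t l r)\<^sup>2 - 2 * w t l r * \<theta> r - \<gamma>) \<le> C" if r: "r \<in> {0..t}" for r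
    proof -
      have 1: "0 \<le> w t l r" using w_nonneg l r by simp
      have "w t l r \<le> l + \<gamma> * (t - r)" using w_le l r by simp
      also have "\<dots> \<le> K" unfolding K_def using l t r \<gamma>_pos by (intro add_mono mult_left_mono) auto
      finally have 2: "w t l r \<le> K" .
      have 3: "\<bar>\<theta> r\<bar> \<le> \<bar>Q\<bar>" using Q[of r] r t by simp
      have "(w t l r)\<^sup>2 \<le> K\<^sup>2" using 1 2 by (rule power_mono[rotated])
      moreover have "\<bar>w t l r * \<theta> r\<bar> \<le> K * \<bar>Q\<bar>"
        unfolding abs_mult using 1 2 3 K by (intro mult_mono) auto
      moreover have "0 \<le> (w t l r)\<^sup>2" by simp
      ultimately show ?thesis using \<gamma>_pos unfolding C_def real_norm_def by linarith
    qed
    have dw: "(w t l has_real_derivative 2 * (w t l r)\<^sup>2 - 2 * w t l r * \<theta> r - \<gamma>) (at r within {0..t})"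
      if "r \<in> {0..t}" for r
      using w_deriv[OF l(1)] that by simp
    show "\<bar>w t l s - w t l s'\<bar> \<le> C * \<bar>s - s'\<bar>"
      using field_differentiable_bound[OF convex_real_interval(5) dw bd, of s s'] s
      by (simp only: real_norm_def) auto
  qed
qed

text \<open>A change of \<open>l\<close> is handled by the contraction, a change of \<open>s\<close>
  by the time bound, a change of \<open>t\<close> by the flow: the characteristic that ends later is
  restarted at the earlier end time with the value it has there, which is within
  \<open>C * \<bar>t' - t\<bar>\<close> of \<open>l\<close>.\<close>

lemma w_lipschitz:
  "\<exists>C\<ge>0. \<forall>t l s t' l' s'. 0 \<le> l \<longrightarrow> l \<le> L \<longrightarrow> 0 \<le> l' \<longrightarrow> l' \<le> L \<longrightarrow> t \<le> T \<longrightarrow> t' \<le> T \<longrightarrow>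
      0 \<le> s \<longrightarrow> s \<le> t \<longrightarrow> 0 \<le> s' \<longrightarrow> s' \<le> t' \<longrightarrow>
      \<bar>w t' l' s' - w t l s\<bar> \<le> \<bar>l' - l\<bar> + C * \<bar>t' - t\<bar> + C * \<bar>s' - s\<bar>"
proof -
  obtain C where C0: "0 \<le> C"
    and C1: "\<forall>t l s s'. 0 \<le> l \<longrightarrow> l \<le> L \<longrightarrow> t \<le> T \<longrightarrow> 0 \<le> s \<longrightarrow> s \<le> t \<longrightarrow> 0 \<le> s' \<longrightarrow> s' \<le> t \<longrightarrow>
      \<bar>w t l s - w t l s'\<bar> \<le> C * \<bar>s - s'\<bar>"
    using w_lipschitz_time[of L T] by blast
  note C = C1[rule_format]
  have *: "\<bar>w t' l' s' - w t l s\<bar> \<le> \<bar>l' - l\<bar> + C * \<bar>t' - t\<bar> + C * \<bar>s' - s\<bar>"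
    if l: "0 \<le> l" "l \<le> L" "0 \<le> l'" "l' \<le> L" and t: "t \<le> t'" "t' \<le> T"
      and s: "0 \<le> s" "s \<le> t" "0 \<le> s'" "s' \<le> t'" for t l s t' l' s'
  proof -
    have 1: "\<bar>w t' l' s' - w t' l s'\<bar> \<le> \<bar>l' - l\<bar>" using w_contraction l s by simp
    have "\<bar>w t' l s' - w t l s\<bar> \<le> C * \<bar>t' - t\<bar> + C * \<bar>s' - s\<bar>"
    proof (cases "s' \<le> t")
      case True
      have "w t' l s' = w t (w t' l t) s'" using w_flow[of l s' t t'] l s t True by simp
      then have "\<bar>w t' l s' - w t l s'\<bar> \<le> \<bar>w t' l t - l\<bar>"
        using w_contraction[of l "w t' l t" s' t] w_nonneg[of l t t'] l s t True by simp
      also have "\<dots> \<le> C * \<bar>t' - t\<bar>"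
        using C[of l t' t t'] w_end[of t' l] l s t by (simp add: abs_minus_commute)
      finally show ?thesis using C[of l t s' s] l s t True by simp
    next
      \<comment> \<open>The time \<open>s'\<close> lies beyond the end time \<open>t\<close>, where
        \<open>w t l\<close> is not controlled. Both values are compared with the common end value
        \<open>l\<close> instead.\<close>
      case False
      have "\<bar>w t' l s' - l\<bar> \<le> C * (t' - s')"
        using C[of l t' s' t'] w_end[of t' l] l s t by simp
      also have "\<dots> \<le> C * \<bar>t' - t\<bar>" using False t C0 by (intro mult_left_mono) auto
      finally have a: "\<bar>w t' l s' - l\<bar> \<le> C * \<bar>t' - t\<bar>" .
      have "\<bar>w t l s - l\<bar> \<le> C * (t - s)"
        using C[of l t s t] w_end[of t l] l s t by simp
      also have "\<dots> \<le> C * \<bar>s' - s\<bar>" using False s C0 by (intro mult_left_mono) auto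
      finally show ?thesis using a by linarith
    qed
    then show ?thesis using 1 by linarith
  qed
  show ?thesis
  proof (intro exI[of _ C] conjI allI impI C0)
    fix t l s t' l' s' :: real
    assume h: "0 \<le> l" "l \<le> L" "0 \<le> l'" "l' \<le> L" "t \<le> T" "t' \<le> T" "0 \<le> s" "s \<le> t" "0 \<le> s'" "s' \<le> t'"
    show "\<bar>w t' l' s' - w t l s\<bar> \<le> \<bar>l' - l\<bar> + C * \<bar>t' - t\<bar> + C * \<bar>s' - s\<bar>"
    proof (cases "t \<le> t'")
      case True
      then show ?thesis using *[of l l' t t' s s'] h by simp
    next
      case False
      then show ?thesis using *[of l' l t' t s' s] h by (simp add: abs_minus_commute)
    qed
  qed
qed

lemma w_joint_continuous:
  "continuous_on {(t, l, s). 0 \<le> l \<and> 0 \<le> s \<and> s \<le> t} (\<lambda>(t, l, s). w t l s)"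
  unfolding continuous_on_def
proof
  fix p :: "real \<times> real \<times> real" assume p: "p \<in> {(t, l, s). 0 \<le> l \<and> 0 \<le> s \<and> s \<le> t}"
  obtain t l s where p_eq: "p = (t, l, s)" by (cases p) auto
  obtain C where C: "\<forall>t1 l1 s1 t' l' s'. 0 \<le> l1 \<longrightarrow> l1 \<le> l + 1 \<longrightarrow> 0 \<le> l' \<longrightarrow> l' \<le> l + 1 \<longrightarrow>
      t1 \<le> t + 1 \<longrightarrow> t' \<le> t + 1 \<longrightarrow> 0 \<le> s1 \<longrightarrow> s1 \<le> t1 \<longrightarrow> 0 \<le> s' \<longrightarrow> s' \<le> t' \<longrightarrow>
      \<bar>w t' l' s' - w t1 l1 s1\<bar> \<le> \<bar>l' - l1\<bar> + C * \<bar>t' - t1\<bar> + C * \<bar>s' - s1\<bar>"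
    using w_lipschitz[of "l + 1" "t + 1"] by blast
  let ?F = "at p within {(t, l, s). 0 \<le> l \<and> 0 \<le> s \<and> s \<le> t}"
  have lim: "((\<lambda>q. fst q) \<longlongrightarrow> t) ?F" "((\<lambda>q. fst (snd q)) \<longlongrightarrow> l) ?F" "((\<lambda>q. snd (snd q)) \<longlongrightarrow> s) ?F"
    using p_eq by (auto intro!: tendsto_eq_intros)
  have "((\<lambda>q. (case q of (t, l, s) \<Rightarrow> w t l s) - w t l s) \<longlongrightarrow> 0) ?F"
  proof (rule Lim_null_comparison)
    show "((\<lambda>q. \<bar>fst (snd q) - l\<bar> + C * \<bar>fst q - t\<bar> + C * \<bar>snd (snd q) - s\<bar>) \<longlongrightarrow> 0) ?F"
      using lim by (auto intro!: tendsto_eq_intros simp: p_eq)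
    have "\<forall>\<^sub>F q in ?F. q \<in> {(t, l, s). 0 \<le> l \<and> 0 \<le> s \<and> s \<le> t}"
      by (auto simp: eventually_at_filter)
    moreover have "\<forall>\<^sub>F q in ?F. fst q < t + 1" by (rule order_tendstoD[OF lim(1)]) simp
    moreover have "\<forall>\<^sub>F q in ?F. fst (snd q) < l + 1" by (rule order_tendstoD[OF lim(2)]) simp
    ultimately show "\<forall>\<^sub>F q in ?F. norm ((case q of (t, l, s) \<Rightarrow> w t l s) - w t l s)
        \<le> \<bar>fst (snd q) - l\<bar> + C * \<bar>fst q - t\<bar> + C * \<bar>snd (snd q) - s\<bar>"
    proof eventually_elim
      case (elim q)
      then show ?case
        using C[rule_format, of l "fst (snd q)" t "fst q" s "snd (snd q)"] p p_eq by (auto split: prod.splits)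
    qed
  qed
  then show "((\<lambda>(t, l, s). w t l s) \<longlongrightarrow> (case p of (t, l, s) \<Rightarrow> w t l s)) ?F"
    by (simp add: LIM_zero_iff p_eq)
qed

lemma w_continuous_compose:
  assumes "continuous_on S f" "continuous_on S g" "continuous_on S k"
    and "\<And>p. p \<in> S \<Longrightarrow> 0 \<le> g p \<and> 0 \<le> k p \<and> k p \<le> f p"
  shows "continuous_on S (\<lambda>p. w (f p) (g p) (k p))"
proof -
  have "continuous_on S (\<lambda>p. (f p, g p, k p))" by (intro continuous_on_Pair assms)
  moreover have "(\<lambda>p. (f p, g p, k p)) ` S \<subseteq> {(t, l, s). 0 \<le> l \<and> 0 \<le> s \<and> s \<le> t}"
    using assms(4) by auto
  ultimately show ?thesis using continuous_on_compose2[OF w_joint_continuous] by fastforce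
qed

lemma x0_l_continuous_compose:
  assumes "continuous_on S f" "continuous_on S g" and "\<And>p. p \<in> S \<Longrightarrow> 0 \<le> f p \<and> 0 \<le> g p"
  shows "continuous_on S (\<lambda>p. x0_l (f p) (g p))"
proof -
  have "continuous_on ({0..} \<times> {0..}) (\<lambda>(t, l). x0_l t l)"
    using x0_C1 by (simp add: C1_quadrant_def)
  moreover have "continuous_on S (\<lambda>p. (f p, g p))" by (intro continuous_on_Pair assms)
  moreover have "(\<lambda>p. (f p, g p)) ` S \<subseteq> {0..} \<times> {0..}"
    using assms(3) by auto
  ultimately show ?thesis using continuous_on_compose2 by fastforce
qed

text \<open>This formula gives the joint continuity of \<open>D\<close> without parameter-dependent integrals.\<close>

lemma D_eq_x0_l:
  assumes "0 \<le> l" "0 \<le> s" "s \<le> t"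
  shows "D t l s = x0_l t l / x0_l s (w t l s)"
proof -
  let ?f = "\<lambda>v. 4 * w t l v - 2 * \<theta> v"
  have nn: "0 \<le> w t l s" using w_nonneg assms by simp
  have "?f integrable_on {0..t}"
    by (rule integrable_continuous_real) (intro continuous_intros w_continuous \<theta>_cont', use assms in auto)
  then have "integral {0..s} ?f + integral {s..t} ?f = integral {0..t} ?f"
    by (rule Henstock_Kurzweil_Integration.integral_combine[OF assms(2,3)])
  \<comment> \<open>Up to time \<open>s\<close> the two characteristics coincide by the flow
    property, so the exponent of \<open>D t l 0\<close> splits at \<open>s\<close> into those of
    \<open>D t l s\<close> and \<open>D s (w t l s) 0\<close>: the chain rule for the flow.\<close>
  moreover have "integral {0..s} (\<lambda>v. 4 * w s (w t l s) v - 2 * \<theta> v) = integral {0..s} ?f"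
    by (rule integral_cong) (use w_flow[OF assms(1) _ _ assms(3)] in auto)
  ultimately have "D t l 0 = D t l s * D s (w t l s) 0"
    by (simp add: D_def flip: exp_add)
  moreover have "D s (w t l s) 0 \<noteq> 0" by (simp add: D_def)
  ultimately show ?thesis using nn assms by (simp add: x0_l_eq_D)
qed

lemma D_continuous_compose:
  assumes "continuous_on S f" "continuous_on S g" "continuous_on S k"
    and "\<And>p. p \<in> S \<Longrightarrow> 0 \<le> g p \<and> 0 \<le> k p \<and> k p \<le> f p"
  shows "continuous_on S (\<lambda>p. D (f p) (g p) (k p))"
proof -
  have "continuous_on S (\<lambda>p. x0_l (f p) (g p) / x0_l (k p) (w (f p) (g p) (k p)))"
    by (intro continuous_on_divide x0_l_continuous_compose w_continuous_compose assms ballI x0_l_nz)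
      (use assms(4) w_nonneg in \<open>force+\<close>)
  then show ?thesis
    by (rule continuous_on_eq) (use assms(4) in \<open>auto simp: D_eq_x0_l\<close>)
qed

end

section \<open>The candidate exponent and its partial derivatives\<close>

locale bessel_characteristics = riccati_characteristics +
  fixes \<Delta> :: "real \<Rightarrow> real" and x :: real
  assumes \<Delta>_cont: "continuous_on {0..} \<Delta>"
begin

text \<open>\<open>h\<close> is minus the logarithm of the claimed Laplace transform.\<close>

definition h :: "real \<Rightarrow> real \<Rightarrow> real" where
  "h t l = x * x0 t l + integral {0..t} (\<lambda>u. \<Delta> u * w t l u)"

definition h_l :: "real \<Rightarrow> real \<Rightarrow> real" where
  "h_l t l = x * x0_l t l + integral {0..t} (\<lambda>u. \<Delta> u * D t l u)"

lemma \<Delta>_cont': "0 \<le> s \<Longrightarrow> continuous_on {s..t} \<Delta>"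
  by (rule continuous_on_subset[OF \<Delta>_cont]) auto

lemma \<Delta>_continuous_compose:
  assumes "continuous_on S f" and "\<And>p. p \<in> S \<Longrightarrow> 0 \<le> f p"
  shows "continuous_on S (\<lambda>p. \<Delta> (f p))"
  by (rule continuous_on_compose2[OF \<Delta>_cont assms(1)]) (use assms(2) in auto)

text \<open>The substitution \<open>u = t * r\<close> moves the integral to the fixed interval
  \<open>{0..1}\<close>, where continuity in parameters applies; the factor \<open>t\<close> in
  front takes care of \<open>t = 0\<close>.\<close>

lemma h_l_continuous: "continuous_on ({0..} \<times> {0..}) (\<lambda>(t, l). h_l t l)"
proof -
  let ?S = "({0..} \<times> {0..}) :: (real \<times> real) set"
  have D: "continuous_on (?S \<times> {0..1}) (\<lambda>q. D (fst (fst q)) (snd (fst q)) (fst (fst q) * snd q))"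
    by (intro D_continuous_compose continuous_intros) (auto simp: mult_left_le)
  have \<Delta>: "continuous_on (?S \<times> {0..1}) (\<lambda>q. \<Delta> (fst (fst q) * snd q))"
    by (intro \<Delta>_continuous_compose continuous_intros) auto
  have "continuous_on ?S (\<lambda>p. integral (cbox 0 1) (\<lambda>r. \<Delta> (fst p * r) * D (fst p) (snd p) (fst p * r)))"
    by (rule integral_continuous_on_param)
      (use continuous_on_mult[OF \<Delta> D] in \<open>simp add: case_prod_unfold cbox_interval\<close>)
  then have "continuous_on ?S (\<lambda>p. x * x0_l (fst p) (snd p) +
      fst p * integral {0..1} (\<lambda>r. \<Delta> (fst p * r) * D (fst p) (snd p) (fst p * r)))"
    by (intro continuous_intros x0_l_continuous_compose) (auto simp: cbox_interval)
  then show ?thesis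
  proof (rule continuous_on_eq)
    fix p :: "real \<times> real" assume "p \<in> ?S"
    then obtain t l where p: "p = (t, l)" "0 \<le> t" "0 \<le> l" by auto
    show "x * x0_l (fst p) (snd p) + fst p *
      integral {0..1} (\<lambda>r. \<Delta> (fst p * r) * D (fst p) (snd p) (fst p * r)) = (case p of (t, l) \<Rightarrow> h_l t l)"
    proof (cases "t = 0")
      case False
      then have "(\<lambda>r. r / t) ` {0..t} = {0..1}" using p by (simp add: image_divide_atLeastAtMost)
      then show ?thesis
        using integral_stretch_real[OF False, of 0 t "\<lambda>u. \<Delta> u * D t l u"] False p
        by (simp add: h_l_def)
    qed (simp add: p h_l_def)
  qed
qed

lemma h_l_deriv:
  assumes t: "0 \<le> t" and l: "0 \<le> l"
  shows "((\<lambda>k. h t k) has_real_derivative h_l t l) (at l within {0..})"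
proof -
  have 1: "((\<lambda>k. x0 t k) has_real_derivative x0_l t l) (at l within {0..})"
    using x0_C1 assms by (auto simp: C1_quadrant_def)
  have "((\<lambda>k. integral (cbox 0 t) (\<lambda>u. \<Delta> u * w t k u)) has_field_derivative
      integral (cbox 0 t) (\<lambda>u. \<Delta> u * D t l u)) (at l within {0..})"
  proof (rule leibniz_rule_field_derivative)
    show "((\<lambda>k. \<Delta> u * w t k u) has_field_derivative \<Delta> u * D t k u) (at k within {0..})"
      if "k \<in> {0..}" "u \<in> cbox 0 t" for k u
      by (rule DERIV_cmult[OF w_l_deriv]) (use that in \<open>auto simp: cbox_interval\<close>)
    show "(\<lambda>u. \<Delta> u * w t k u) integrable_on cbox 0 t" if "k \<in> {0..}" for k
      unfolding cbox_interval
      by (rule integrable_continuous_real) (intro continuous_intros w_continuous \<Delta>_cont', use that t in auto)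
    have D: "continuous_on ({0..} \<times> {0..t}) (\<lambda>q. D t (fst q) (snd q))"
      by (intro D_continuous_compose continuous_intros) auto
    have "continuous_on ({0..} \<times> {0..t}) (\<lambda>q. \<Delta> (snd q))"
      by (intro \<Delta>_continuous_compose continuous_intros) auto
    from continuous_on_mult[OF this D]
    show "continuous_on ({0..} \<times> cbox 0 t) (\<lambda>(k, u). \<Delta> u * D t k u)"
      by (simp add: case_prod_unfold cbox_interval)
  qed (use l in auto)
  from DERIV_add[OF DERIV_cmult[OF 1, of x] this] show ?thesis
    by (simp add: h_def h_l_def cbox_interval)
qed

text \<open>The two end values may come in either order, so the intermediate point is located by its
  distance to \<open>l\<close> rather than by an interval.\<close>

lemma h_mvt:
  assumes t: "0 \<le> t" and l: "0 \<le> l" and m: "0 \<le> m"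
  shows "\<exists>\<nu>\<ge>0. \<bar>\<nu> - l\<bar> \<le> \<bar>m - l\<bar> \<and> h t m - h t l = (m - l) * h_l t \<nu>"
proof -
  have *: "\<exists>\<nu>. a < \<nu> \<and> \<nu> < b \<and> h t b - h t a = (b - a) * h_l t \<nu>" if "0 \<le> a" "a < b" for a b
  proof -
    have "\<exists>\<nu>\<in>{a<..<b}. h t b - h t a = h_l t \<nu> * (b - a)"
    proof (rule mvt_simple[OF \<open>a < b\<close>])
      fix r assume "a \<le> r" "r \<le> b"
      then have "(h t has_real_derivative h_l t r) (at r within {a..b})"
        by (intro has_field_derivative_subset[OF h_l_deriv[OF t]]) (use that in auto)
      then show "(h t has_derivative (*) (h_l t r)) (at r within {a..b})"
        by (simp add: has_field_derivative_def)
    qed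
    then show ?thesis by (auto simp: mult.commute)
  qed
  consider "l < m" | "m < l" | "l = m" by linarith
  then show ?thesis
  proof cases
    case 1
    with *[OF l this] l obtain \<nu> where "l < \<nu>" "\<nu> < m" "h t m - h t l = (m - l) * h_l t \<nu>" by blast
    then show ?thesis using l by (intro exI[of _ \<nu>]) auto
  next
    case 2
    with *[OF m this] m obtain \<nu> where \<nu>: "m < \<nu>" "\<nu> < l" "h t l - h t m = (l - m) * h_l t \<nu>" by blast
    then have "h t m - h t l = (m - l) * h_l t \<nu>" by (simp add: algebra_simps)
    then show ?thesis using m \<nu> by (intro exI[of _ \<nu>]) auto
  qed (use l in auto)
qed

text \<open>The initial value \<open>x0\<close> is the same all along a characteristic, so
  \<open>h\<close> changes there only through the integral of \<open>\<Delta> * w\<close>. This is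
  the integrated form of the partial differential equation.\<close>

lemma h_flow:
  assumes l: "0 \<le> l" and s: "0 \<le> s" "s \<le> t"
  shows "h t l = h s (w t l s) + integral {s..t} (\<lambda>u. \<Delta> u * w t l u)"
proof -
  have nn: "0 \<le> w t l s" using w_nonneg assms by simp
  have "(\<lambda>u. \<Delta> u * w t l u) integrable_on {0..t}"
    by (rule integrable_continuous_real) (intro continuous_intros w_continuous \<Delta>_cont', use assms in auto)
  from Henstock_Kurzweil_Integration.integral_combine[OF s this]
  have "integral {0..t} (\<lambda>u. \<Delta> u * w t l u) =
      integral {0..s} (\<lambda>u. \<Delta> u * w t l u) + integral {s..t} (\<lambda>u. \<Delta> u * w t l u)" ..
  moreover have "integral {0..s} (\<lambda>u. \<Delta> u * w s (w t l s) u) = integral {0..s} (\<lambda>u. \<Delta> u * w t l u)"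
    by (rule integral_cong) (use w_flow[OF l _ _ s(2)] in auto)
  moreover have "x0 s (w t l s) = x0 t l"
    using w_flow[of l 0 s t] w_0[OF s(1) nn] w_0[of t l] l s by simp
  ultimately show ?thesis by (simp add: h_def)
qed

text \<open>The increment in time at fixed \<open>l\<close> is taken along the characteristic
  through \<open>(b, l)\<close>: \<open>h_flow\<close> leads back to time \<open>a\<close> with end
  value \<open>w b l a\<close>, and at time \<open>a\<close> only the end value differs. The
  increments of \<open>h a\<close>, of \<open>w b l\<close> and of the integral get their own mean
  value points \<open>\<nu>\<close>, \<open>\<xi>\<close> and \<open>\<zeta>\<close>.\<close>

lemma h_time_increment:
  assumes l: "0 \<le> l" and ab: "0 \<le> a" "a < b"
  shows "\<exists>\<xi>\<in>{a..b}. \<exists>\<zeta>\<in>{a..b}. \<exists>\<nu>\<ge>0. \<bar>\<nu> - l\<bar> \<le> \<bar>w b l a - l\<bar> \<and>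
    h b l - h a l = (b - a) *
      (\<Delta> \<zeta> * w b l \<zeta> - (2 * (w b l \<xi>)\<^sup>2 - 2 * w b l \<xi> * \<theta> \<xi> - \<gamma>) * h_l a \<nu>)"
proof -
  have nn: "0 \<le> w b l a" using w_nonneg assms by simp
  obtain \<nu> where \<nu>: "0 \<le> \<nu>" "\<bar>\<nu> - l\<bar> \<le> \<bar>w b l a - l\<bar>" "h a (w b l a) - h a l = (w b l a - l) * h_l a \<nu>"
    using h_mvt[OF ab(1) l nn] by blast
  have "\<exists>\<xi>\<in>{a<..<b}. w b l b - w b l a = (2 * (w b l \<xi>)\<^sup>2 - 2 * w b l \<xi> * \<theta> \<xi> - \<gamma>) * (b - a)"
  proof (rule mvt_simple[OF ab(2)])
    fix r assume "a \<le> r" "r \<le> b"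
    then have "(w b l has_real_derivative 2 * (w b l r)\<^sup>2 - 2 * w b l r * \<theta> r - \<gamma>) (at r within {a..b})"
      by (intro has_field_derivative_subset[OF w_deriv[OF l]]) (use ab in auto)
    then show "(w b l has_derivative (*) (2 * (w b l r)\<^sup>2 - 2 * w b l r * \<theta> r - \<gamma>)) (at r within {a..b})"
      by (simp add: has_field_derivative_def)
  qed
  moreover have "w b l b = l" using w_end l ab by simp
  ultimately obtain \<xi> where \<xi>: "\<xi> \<in> {a..b}"
    "l - w b l a = (2 * (w b l \<xi>)\<^sup>2 - 2 * w b l \<xi> * \<theta> \<xi> - \<gamma>) * (b - a)"
    by (metis greaterThanLessThan_subseteq_atLeastAtMost_iff order_refl subsetD)
  have cont: "continuous_on {a..b} (\<lambda>u. \<Delta> u * w b l u)"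
    by (intro continuous_intros w_continuous \<Delta>_cont') (use l ab in auto)
  define G where "G r = integral {a..r} (\<lambda>u. \<Delta> u * w b l u)" for r
  have "\<exists>\<zeta>\<in>{a<..<b}. G b - G a = (\<Delta> \<zeta> * w b l \<zeta>) * (b - a)"
  proof (rule mvt_simple[OF ab(2)])
    fix r assume "a \<le> r" "r \<le> b"
    then have "(G has_real_derivative \<Delta> r * w b l r) (at r within {a..b})"
      unfolding G_def by (intro integral_has_real_derivative[OF cont]) auto
    then show "(G has_derivative (*) (\<Delta> r * w b l r)) (at r within {a..b})"
      by (simp add: has_field_derivative_def)
  qed
  moreover have "G b - G a = integral {a..b} (\<lambda>u. \<Delta> u * w b l u)" by (simp add: G_def)
  ultimately obtain \<zeta> where \<zeta>: "\<zeta> \<in> {a..b}" "integral {a..b} (\<lambda>u. \<Delta> u * w b l u) = (\<Delta> \<zeta> * w b l \<zeta>) * (b - a)"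
    by (metis greaterThanLessThan_subseteq_atLeastAtMost_iff order_refl subsetD)
  have "h b l - h a l = (w b l a - l) * h_l a \<nu> + (\<Delta> \<zeta> * w b l \<zeta>) * (b - a)"
    using h_flow[OF l ab(1), of b] \<nu>(3) \<zeta>(2) ab by simp
  also have "w b l a - l = - ((2 * (w b l \<xi>)\<^sup>2 - 2 * w b l \<xi> * \<theta> \<xi> - \<gamma>) * (b - a))"
    using \<xi>(2) by linarith
  finally have "h b l - h a l = (b - a) *
      (\<Delta> \<zeta> * w b l \<zeta> - (2 * (w b l \<xi>)\<^sup>2 - 2 * w b l \<xi> * \<theta> \<xi> - \<gamma>) * h_l a \<nu>)"
    by (simp add: algebra_simps)
  then show ?thesis using \<nu>(1,2) \<xi>(1) \<zeta>(1) by blast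
qed

text \<open>Solving the partial differential equation for the time derivative of
  \<open>- ln p\<close> gives this expression. The equation for \<open>exp (- h)\<close> is then
  algebra, and the content lies in \<open>h_t_deriv\<close>.\<close>

definition h_t :: "real \<Rightarrow> real \<Rightarrow> real" where
  "h_t t l = \<Delta> t * l - (2 * l\<^sup>2 - 2 * l * \<theta> t - \<gamma>) * h_l t l"

text \<open>The increment formula needs \<open>a < b\<close>, so it is applied to
  \<open>min s t\<close> and \<open>max s t\<close>; both one-sided limits are treated at once. As
  \<open>s\<close> tends to \<open>t\<close>, the mean value points are squeezed to \<open>t\<close>
  and to \<open>l\<close>, and joint continuity of \<open>h_l\<close> gives the limit.\<close>

lemma h_t_deriv:
  assumes t: "0 \<le> t" and l: "0 \<le> l"
  shows "((\<lambda>s. h s l) has_real_derivative h_t t l) (at t within {0..})"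
proof -
  obtain C where C0: "0 \<le> C" and C1: "\<forall>b k s s'. 0 \<le> k \<longrightarrow> k \<le> l \<longrightarrow> b \<le> t + 1 \<longrightarrow> 0 \<le> s \<longrightarrow> s \<le> b \<longrightarrow>
      0 \<le> s' \<longrightarrow> s' \<le> b \<longrightarrow> \<bar>w b k s - w b k s'\<bar> \<le> C * \<bar>s - s'\<bar>"
    using w_lipschitz_time[of l "t + 1"] by blast
  note C = C1[rule_format, OF l order_refl]
  define q where "q s \<xi> \<zeta> \<nu> = \<Delta> \<zeta> * w (max s t) l \<zeta> -
     (2 * (w (max s t) l \<xi>)\<^sup>2 - 2 * w (max s t) l \<xi> * \<theta> \<xi> - \<gamma>) * h_l (min s t) \<nu>" for s \<xi> \<zeta> \<nu>
  define G where "G s z \<longleftrightarrow> (case z of (\<xi>, \<zeta>, \<nu>) \<Rightarrow>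
      \<xi> \<in> {min s t..max s t} \<and> \<zeta> \<in> {min s t..max s t} \<and> 0 \<le> \<nu> \<and>
      \<bar>\<nu> - l\<bar> \<le> \<bar>w (max s t) l (min s t) - l\<bar> \<and> (h s l - h t l) / (s - t) = q s \<xi> \<zeta> \<nu>)" for s z
  have "\<exists>z. G s z" if s: "0 \<le> s" "s \<noteq> t" for s
  proof -
    have "min s t < max s t" "0 \<le> min s t" using s t by auto
    from h_time_increment[OF l this(2,1)] obtain \<xi> \<zeta> \<nu> where
      *: "\<xi> \<in> {min s t..max s t}" "\<zeta> \<in> {min s t..max s t}" "0 \<le> \<nu>"
        "\<bar>\<nu> - l\<bar> \<le> \<bar>w (max s t) l (min s t) - l\<bar>"
        "h (max s t) l - h (min s t) l = (max s t - min s t) * q s \<xi> \<zeta> \<nu>"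
      unfolding q_def by blast
    have "h s l - h t l = (s - t) * q s \<xi> \<zeta> \<nu>"
    proof (cases "t \<le> s")
      case True
      then show ?thesis using *(5) by (simp add: max_def min_def split: if_splits)
    next
      case False
      then show ?thesis using *(5) by (simp add: max_def min_def algebra_simps)
    qed
    then have "(h s l - h t l) / (s - t) = q s \<xi> \<zeta> \<nu>" using s by simp
    then show ?thesis using * by (intro exI[of _ "(\<xi>, \<zeta>, \<nu>)"]) (simp add: G_def)
  qed
  \<comment> \<open>Choice turns the mean value points into functions of \<open>s\<close>, so that
    their limits make sense.\<close>
  then have "\<forall>s\<in>{s. 0 \<le> s \<and> s \<noteq> t}. \<exists>z. G s z" by blast
  from bchoice[OF this] obtain f where f: "\<And>s. 0 \<le> s \<Longrightarrow> s \<noteq> t \<Longrightarrow> G s (f s)" by blast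
  define \<xi> \<zeta> \<nu> where \<xi>_def: "\<xi> s = fst (f s)" and \<zeta>_def: "\<zeta> s = fst (snd (f s))"
    and \<nu>_def: "\<nu> s = snd (snd (f s))" for s
  have I: "\<xi> s \<in> {min s t..max s t}" "\<zeta> s \<in> {min s t..max s t}" "0 \<le> \<nu> s"
      "\<bar>\<nu> s - l\<bar> \<le> \<bar>w (max s t) l (min s t) - l\<bar>"
      "(h s l - h t l) / (s - t) = q s (\<xi> s) (\<zeta> s) (\<nu> s)" if "0 \<le> s" "s \<noteq> t" for s
    using f[OF that] unfolding \<xi>_def \<zeta>_def \<nu>_def G_def case_prod_unfold by blast+
  let ?F = "at t within {0..}"
  have ev: "\<forall>\<^sub>F s in ?F. 0 \<le> s \<and> s \<noteq> t \<and> s < t + 1"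
    using order_tendstoD(2)[OF tendsto_ident_at, of t "t + 1" "{0..}"]
    by (auto simp: eventually_at_filter elim: eventually_mono)
  have dist0: "((\<lambda>s. \<bar>s - t\<bar>) \<longlongrightarrow> 0) ?F" by (auto intro!: tendsto_eq_intros)
  have near: "(f \<longlongrightarrow> t) ?F" if "\<And>s. 0 \<le> s \<Longrightarrow> s \<noteq> t \<Longrightarrow> f s \<in> {min s t..max s t}" for f
  proof (rule LIM_zero_cancel, rule Lim_null_comparison[OF _ dist0])
    show "\<forall>\<^sub>F s in ?F. norm (f s - t) \<le> \<bar>s - t\<bar>"
      using ev by eventually_elim (use that in \<open>fastforce simp: min_def max_def split: if_splits\<close>)
  qed
  have wnear: "((\<lambda>s. w (max s t) l (f s)) \<longlongrightarrow> l) ?F"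
    if f: "\<And>s. 0 \<le> s \<Longrightarrow> s \<noteq> t \<Longrightarrow> f s \<in> {min s t..max s t}" for f
  proof (rule LIM_zero_cancel, rule Lim_null_comparison)
    show "((\<lambda>s. C * \<bar>s - t\<bar>) \<longlongrightarrow> 0) ?F" by (auto intro!: tendsto_eq_intros)
    show "\<forall>\<^sub>F s in ?F. norm (w (max s t) l (f s) - l) \<le> C * \<bar>s - t\<bar>"
      using ev
    proof eventually_elim
      case (elim s)
      have fs: "f s \<in> {min s t..max s t}" using f elim by simp
      have "\<bar>w (max s t) l (f s) - w (max s t) l (max s t)\<bar> \<le> C * \<bar>f s - max s t\<bar>"
        by (rule C) (use fs elim t in auto)
      also have "\<dots> \<le> C * \<bar>s - t\<bar>" using fs C0 by (intro mult_left_mono) auto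
      finally show ?case using w_end[of "max s t" l] l t by simp
    qed
  qed
  have \<nu>: "(\<nu> \<longlongrightarrow> l) ?F"
  proof (rule LIM_zero_cancel, rule Lim_null_comparison)
    show "((\<lambda>s. \<bar>w (max s t) l (min s t) - l\<bar>) \<longlongrightarrow> 0) ?F"
      using wnear[of "\<lambda>s. min s t"] by (auto intro!: tendsto_eq_intros)
    show "\<forall>\<^sub>F s in ?F. norm (\<nu> s - l) \<le> \<bar>w (max s t) l (min s t) - l\<bar>"
      using ev by eventually_elim (use I(4) in auto)
  qed
  have ran: "\<forall>\<^sub>F s in ?F. f s \<in> {0..}" if "\<And>s. 0 \<le> s \<Longrightarrow> s \<noteq> t \<Longrightarrow> f s \<in> {min s t..max s t}" for f
    using ev by eventually_elim (use that t in fastforce)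
  have lim\<theta>: "((\<lambda>s. \<theta> (\<xi> s)) \<longlongrightarrow> \<theta> t) ?F"
    by (rule continuous_on_tendsto_compose[OF \<theta>_cont near[OF I(1)] _ ran[OF I(1)]]) (use t in auto)
  have lim\<Delta>: "((\<lambda>s. \<Delta> (\<zeta> s)) \<longlongrightarrow> \<Delta> t) ?F"
    by (rule continuous_on_tendsto_compose[OF \<Delta>_cont near[OF I(2)] _ ran[OF I(2)]]) (use t in auto)
  have limh: "((\<lambda>s. h_l (min s t) (\<nu> s)) \<longlongrightarrow> h_l t l) ?F"
  proof -
    have "((\<lambda>s. (min s t, \<nu> s)) \<longlongrightarrow> (t, l)) ?F"
      by (intro tendsto_Pair near \<nu>) auto
    moreover have "\<forall>\<^sub>F s in ?F. (min s t, \<nu> s) \<in> {0..} \<times> {0..}"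
      using ev by eventually_elim (use I(3) t in auto)
    ultimately show ?thesis
      using continuous_on_tendsto_compose[OF h_l_continuous] t l by fastforce
  qed
  have "((\<lambda>s. q s (\<xi> s) (\<zeta> s) (\<nu> s)) \<longlongrightarrow> h_t t l) ?F"
    unfolding q_def h_t_def
    by (intro tendsto_intros wnear[OF I(1)] wnear[OF I(2)] lim\<theta> lim\<Delta> limh)
  then have "((\<lambda>s. (h s l - h t l) / (s - t)) \<longlongrightarrow> h_t t l) ?F"
    by (rule Lim_transform_eventually)
      (use ev in eventually_elim, use I(5) in auto)
  then show ?thesis by (simp add: has_field_derivative_iff)
qed

lemma h_t_continuous: "continuous_on ({0..} \<times> {0..}) (\<lambda>(t, l). h_t t l)"
proof -
  have "continuous_on ({0..} \<times> {0..}) (\<lambda>p::real \<times> real. \<theta> (fst p))"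
    "continuous_on ({0..} \<times> {0..}) (\<lambda>p::real \<times> real. \<Delta> (fst p))"
    by (rule continuous_on_compose2[OF \<theta>_cont] continuous_on_compose2[OF \<Delta>_cont];
        auto intro!: continuous_intros)+
  with h_l_continuous show ?thesis
    unfolding h_t_def case_prod_unfold by (intro continuous_intros)
qed

section \<open>Existence and uniqueness for the partial differential equation\<close>

lemma exp_h_pde: "laplace_pde_solution \<Delta> \<theta> x \<gamma> (\<lambda>t l. exp (- h t l))"
  unfolding laplace_pde_solution_def C1_quadrant_def
proof (intro exI conjI allI impI)
  fix t l :: real assume tl: "0 \<le> t" "0 \<le> l"
  show "((\<lambda>s. exp (- h s l)) has_real_derivative exp (- h t l) * - h_t t l) (at t within {0..})"
    by (rule DERIV_chain2[OF DERIV_exp DERIV_minus[OF h_t_deriv[OF tl]]])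
  show "((\<lambda>k. exp (- h t k)) has_real_derivative exp (- h t l) * - h_l t l) (at l within {0..})"
    by (rule DERIV_chain2[OF DERIV_exp DERIV_minus[OF h_l_deriv[OF tl]]])
  show "exp (- h t l) * - h_t t l =
      (\<gamma> - 2 * l\<^sup>2 + 2 * l * \<theta> t) * (exp (- h t l) * - h_l t l) - \<Delta> t * l * exp (- h t l)"
    by (simp add: h_t_def algebra_simps)
next
  \<comment> \<open>The derivatives of \<open>exp (- h)\<close> contain \<open>h\<close> itself, so
    their continuity needs joint continuity of \<open>h\<close>; it comes from the total
    derivative.\<close>
  have "((\<lambda>(t, l). h t l) has_derivative
      (\<lambda>(a, b). h_t (fst p) (snd p) * a + h_l (fst p) (snd p) * b)) (at p within {0..} \<times> {0..})"
    if "p \<in> {0..} \<times> {0..}" for p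
    using quadrant_has_derivative[where f = h and ft = h_t and fl = h_l and t = "fst p" and l = "snd p",
        OF h_t_deriv h_l_deriv h_l_continuous] that by auto
  then have "continuous_on ({0..} \<times> {0..}) (\<lambda>(t, l). h t l)"
    by (rule has_derivative_continuous_on)
  then show "continuous_on ({0..} \<times> {0..}) (\<lambda>(t, l). exp (- h t l) * - h_t t l)"
    "continuous_on ({0..} \<times> {0..}) (\<lambda>(t, l). exp (- h t l) * - h_l t l)"
    using h_t_continuous h_l_continuous unfolding case_prod_unfold by (auto intro!: continuous_intros)
next
  fix l :: real assume l: "0 \<le> l"
  show "exp (- h 0 l) = exp (- x * l)"
    using w_0[of 0 l] w_end[of 0 l] l by (simp add: h_def)
qed

lemma pde_unique:
  assumes q: "laplace_pde_solution \<Delta> \<theta> x \<gamma> q" and T: "0 \<le> T" and l: "0 \<le> l"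
  shows "q T l = exp (- h T l)"
proof -
  obtain qt ql where C1: "C1_quadrant q qt ql"
    and pde: "\<And>t l. 0 \<le> t \<Longrightarrow> 0 \<le> l \<Longrightarrow>
      qt t l = (\<gamma> - 2 * l\<^sup>2 + 2 * l * \<theta> t) * ql t l - \<Delta> t * l * q t l"
    and init: "\<And>l. 0 \<le> l \<Longrightarrow> q 0 l = exp (- x * l)"
    using q unfolding laplace_pde_solution_def by blast
  \<comment> \<open>The characteristic moves with a velocity that is minus the coefficient of
    \<open>ql\<close> in the equation. The terms in \<open>ql\<close> therefore cancel in the
    derivative of \<open>c\<close>, and only \<open>- \<Delta> * w * c\<close> remains.\<close>
  define c where "c s = q s (w T l s)" for s
  have "c 0 = c T * exp (- integral {0..T} (\<lambda>s. - (\<Delta> s * w T l s)))"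
  proof (rule linear_ode_solution)
    show "continuous_on {0..T} (\<lambda>s. - (\<Delta> s * w T l s))"
      by (intro continuous_intros w_continuous \<Delta>_cont') (use l T in auto)
    fix s assume s: "s \<in> {0..T}"
    define v where "v = w T l s"
    define v' where "v' = 2 * v\<^sup>2 - 2 * v * \<theta> s - \<gamma>"
    have v: "0 \<le> v" unfolding v_def using w_nonneg l s by simp
    have dv: "(w T l has_real_derivative v') (at s within {0..T})"
      unfolding v'_def v_def using w_deriv l s by simp
    have "((\<lambda>r. (r, w T l r)) has_derivative (\<lambda>d. (d, v' * d))) (at s within {0..T})"
      using dv by (intro has_derivative_Pair has_derivative_ident) (simp add: has_field_derivative_def)
    moreover have "((\<lambda>(t, l). q t l) has_derivative (\<lambda>(a, b). qt s v * a + ql s v * b))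
        (at (s, w T l s) within (\<lambda>r. (r, w T l r)) ` {0..T})"
    proof (rule has_derivative_subset)
      show "((\<lambda>(t, l). q t l) has_derivative (\<lambda>(a, b). qt s v * a + ql s v * b))
        (at (s, w T l s) within {0..} \<times> {0..})"
        unfolding v_def[symmetric]
        by (rule quadrant_has_derivative) (use C1 s v in \<open>auto simp: C1_quadrant_def\<close>)
      show "(\<lambda>r. (r, w T l r)) ` {0..T} \<subseteq> {0..} \<times> {0..}"
        using w_nonneg[OF l] by auto
    qed
    ultimately have "((\<lambda>p. (\<lambda>(t, l). q t l) (p, w T l p)) has_derivative
        (\<lambda>d. (\<lambda>(a, b). qt s v * a + ql s v * b) (d, v' * d))) (at s within {0..T})"
      by (rule has_derivative_in_compose)
    then have "(c has_derivative (\<lambda>d. (\<lambda>(a, b). qt s v * a + ql s v * b) (d, v' * d))) (at s within {0..T})"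
      by (simp add: c_def[abs_def])
    then have "(c has_real_derivative (qt s v + ql s v * v')) (at s within {0..T})"
      unfolding has_field_derivative_def
      by (rule has_derivative_eq_rhs) (simp add: fun_eq_iff algebra_simps)
    then show "(c has_real_derivative c s * - (\<Delta> s * w T l s)) (at s within {0..T})"
      by (rule DERIV_cong) (use pde[of s v] s v in \<open>simp add: c_def v'_def v_def algebra_simps\<close>)
  qed (use T in auto)
  then have "c T = c 0 * exp (- integral {0..T} (\<lambda>s. \<Delta> s * w T l s))"
    by (simp add: exp_minus)
  moreover have "c T = q T l" using w_end[OF T l] by (simp add: c_def)
  moreover have "c 0 = exp (- x * x0 T l)"
    using init[of "w T l 0"] w_nonneg[OF l order_refl T] w_0[OF T l] by (simp add: c_def)
  ultimately show ?thesis by (simp add: h_def flip: exp_add)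
qed

end

lemma C1_quadrant_cong:
  assumes "C1_quadrant f ft fl" and eq: "\<And>t l. 0 \<le> t \<Longrightarrow> 0 \<le> l \<Longrightarrow> f t l = g t l"
  shows "C1_quadrant g ft fl"
  unfolding C1_quadrant_def
proof (intro conjI allI impI)
  fix t l :: real assume tl: "0 \<le> t" "0 \<le> l"
  have f: "((\<lambda>s. f s l) has_real_derivative ft t l) (at t within {0..})"
    "((\<lambda>k. f t k) has_real_derivative fl t l) (at l within {0..})"
    using assms(1) tl by (auto simp: C1_quadrant_def)
  show "((\<lambda>s. g s l) has_real_derivative ft t l) (at t within {0..})"
    by (rule has_field_derivative_transform_within[OF f(1) zero_less_one]) (use tl eq in auto)
  show "((\<lambda>k. g t k) has_real_derivative fl t l) (at l within {0..})"
    by (rule has_field_derivative_transform_within[OF f(2) zero_less_one]) (use tl eq in auto)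
qed (use assms(1) in \<open>auto simp: C1_quadrant_def\<close>)

text \<open>The notion of solution looks only at nonnegative arguments. This transfers the equation
  from \<open>exp (- h)\<close> to the Laplace transform, the two being identified on the quadrant
  only.\<close>

lemma laplace_pde_solution_cong:
  assumes "laplace_pde_solution \<Delta> \<theta> x \<gamma> p" and eq: "\<And>t l. 0 \<le> t \<Longrightarrow> 0 \<le> l \<Longrightarrow> p t l = q t l"
  shows "laplace_pde_solution \<Delta> \<theta> x \<gamma> q"
proof -
  obtain pt pl where p: "C1_quadrant p pt pl"
    "\<And>t l. 0 \<le> t \<Longrightarrow> 0 \<le> l \<Longrightarrow> pt t l = (\<gamma> - 2 * l\<^sup>2 + 2 * l * \<theta> t) * pl t l - \<Delta> t * l * p t l"
    "\<And>l. 0 \<le> l \<Longrightarrow> p 0 l = exp (- x * l)"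
    using assms(1) unfolding laplace_pde_solution_def by blast
  show ?thesis
    unfolding laplace_pde_solution_def
  proof (intro exI conjI allI impI)
    show "C1_quadrant q pt pl" using p(1) eq by (rule C1_quadrant_cong)
    show "pt t l = (\<gamma> - 2 * l\<^sup>2 + 2 * l * \<theta> t) * pl t l - \<Delta> t * l * q t l" if "0 \<le> t" "0 \<le> l" for t l
      using p(2)[OF that] eq[OF that] by simp
    show "q 0 l = exp (- x * l)" if "0 \<le> l" for l
      using p(3)[OF that] eq[OF order_refl that] by simp
  qed
qed

section \<open>Exponentials of simple stochastic integrals\<close>

locale brownian_space =
  fixes M :: "'a measure" and F :: "real \<Rightarrow> 'a measure" and B :: "real \<Rightarrow> 'a \<Rightarrow> real"
  assumes filtered: "filtered_prob_space M F" and brownian: "brownian_motion M F B"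

sublocale brownian_space \<subseteq> prob_space M
  using filtered by (simp add: filtered_prob_space_def)

text \<open>Completing the square: the exponential factor shifts the mean of the Gaussian law from 0
  to \<open>z * d\<close>, and the shifted density has total mass 1.\<close>

lemma nn_integral_gaussian_exponential:
  assumes "0 < d"
  shows "(\<integral>\<^sup>+r. ennreal (exp (z * r - z\<^sup>2 * d / 2)) \<partial>density lborel (normal_density 0 (sqrt d))) = 1"
proof -
  have "normal_density 0 (sqrt d) r * exp (z * r - z\<^sup>2 * d / 2) = normal_density (z * d) (sqrt d) r" for r
  proof -
    have "- (r - 0)\<^sup>2 / (2 * d) + (z * r - z\<^sup>2 * d / 2) = - (r - z * d)\<^sup>2 / (2 * d)"
      using assms by (simp add: field_simps power2_eq_square)
    then show ?thesis
      using assms by (simp add: normal_density_def mult.assoc flip: exp_add)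
  qed
  then have "(\<integral>\<^sup>+r. ennreal (exp (z * r - z\<^sup>2 * d / 2)) \<partial>density lborel (normal_density 0 (sqrt d)))
      = (\<integral>\<^sup>+r. ennreal (normal_density (z * d) (sqrt d) r) \<partial>lborel)"
    by (subst nn_integral_density) (auto simp: normal_density_nonneg simp flip: ennreal_mult')
  also have "\<dots> = emeasure (density lborel (normal_density (z * d) (sqrt d))) UNIV"
    by (simp add: emeasure_density)
  also have "\<dots> = 1"
    using prob_space.emeasure_space_1[OF prob_space_normal_density, of "sqrt d" "z * d"] assms by simp
  finally show ?thesis .
qed

context brownian_space
begin

lemma space_F: "space (F t) = space M" and sets_F: "sets (F t) \<subseteq> sets M"
  using filtered by (auto simp: filtered_prob_space_def subalgebra_def)

lemma sets_F_mono: "s \<le> t \<Longrightarrow> sets (F s) \<subseteq> sets (F t)"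
  using filtered filtration.sets_F_mono[of "space M" F s t] by (simp add: filtered_prob_space_def)

lemma measurable_F_M: "f \<in> measurable (F t) N \<Longrightarrow> f \<in> measurable M N"
  using measurable_from_subalg[of M "F t"] filtered by (simp add: filtered_prob_space_def)

lemma measurable_F_mono: "f \<in> measurable (F s) N \<Longrightarrow> s \<le> t \<Longrightarrow> f \<in> measurable (F t) N"
  using sets_F_mono unfolding measurable_def space_F by blast

lemma B_measurable: "0 \<le> s \<Longrightarrow> s \<le> t \<Longrightarrow> B s \<in> borel_measurable (F t)"
  by (rule measurable_F_mono[of _ s]) (use brownian in \<open>auto simp: brownian_motion_def\<close>)

text \<open>Independence is recast as a product law. The identity map, regarded as a random element
  of \<open>F s\<close>, carries all information up to time \<open>s\<close>, so integrals of
  functions of the past and of the increment reduce to Fubini.\<close>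

lemma B_increment_joint:
  assumes st: "0 \<le> s" "s < t"
  shows "distr M (F s \<Otimes>\<^sub>M borel) (\<lambda>\<omega>. (\<omega>, B t \<omega> - B s \<omega>)) =
    distr M (F s) (\<lambda>\<omega>. \<omega>) \<Otimes>\<^sub>M density lborel (normal_density 0 (sqrt (t - s)))"
proof -
  let ?D = "\<lambda>\<omega>. B t \<omega> - B s \<omega>"
  have D: "distributed M lborel ?D (normal_density 0 (sqrt (t - s)))"
    and ind: "indep_set (sets (F s)) {?D -` C \<inter> space M | C. C \<in> sets borel}"
    using brownian st by (auto simp: brownian_motion_def)
  have id: "(\<lambda>\<omega>. \<omega>) \<in> measurable M (F s)"
    by (rule measurableI) (use sets_F space_F in \<open>auto dest: sets.sets_into_space\<close>)
  have Dm: "?D \<in> borel_measurable M" using distributed_measurable[OF D] by simp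
  have pm: "(\<lambda>\<omega>. (\<omega>, ?D \<omega>)) \<in> measurable M (F s \<Otimes>\<^sub>M borel)"
    by (rule measurable_Pair[OF id Dm])
  have N: "density lborel (normal_density 0 (sqrt (t - s))) = distr M borel ?D"
    using distributed_distr_eq_density[OF D] by (simp cong: distr_cong)
  show ?thesis
    unfolding N
  proof (rule pair_measure_eqI[symmetric])
    show "sigma_finite_measure (distr M (F s) (\<lambda>\<omega>. \<omega>))" "sigma_finite_measure (distr M borel ?D)"
      using prob_space_distr[OF id] prob_space_distr[OF Dm]
      by (auto intro: prob_space_imp_sigma_finite)
    show "sets (distr M (F s) (\<lambda>\<omega>. \<omega>) \<Otimes>\<^sub>M distr M borel ?D) =
        sets (distr M (F s \<Otimes>\<^sub>M borel) (\<lambda>\<omega>. (\<omega>, ?D \<omega>)))"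
      by (simp cong: sets_pair_measure_cong)
    fix A C assume "A \<in> sets (distr M (F s) (\<lambda>\<omega>. \<omega>))" "C \<in> sets (distr M borel ?D)"
    then have AC: "A \<in> sets (F s)" "C \<in> sets borel" by auto
    have A: "A \<subseteq> space M" "A \<in> sets M" using sets.sets_into_space[OF AC(1)] space_F subsetD[OF sets_F AC(1)] by auto
    have "emeasure M (A \<inter> (?D -` C \<inter> space M)) = emeasure M A * emeasure M (?D -` C \<inter> space M)"
    proof -
      have "?D -` C \<inter> space M \<in> {?D -` C \<inter> space M | C. C \<in> sets borel}" using AC(2) by blast
      from indep_setD[OF ind AC(1) this] show ?thesis
        by (simp add: emeasure_eq_measure ennreal_mult')
    qed
    moreover have "emeasure (distr M (F s) (\<lambda>\<omega>. \<omega>)) A = emeasure M A"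
      using emeasure_distr[OF id AC(1)] A by (simp add: Int_absorb2)
    moreover have "emeasure (distr M borel ?D) C = emeasure M (?D -` C \<inter> space M)"
      by (rule emeasure_distr[OF Dm AC(2)])
    moreover have "emeasure (distr M (F s \<Otimes>\<^sub>M borel) (\<lambda>\<omega>. (\<omega>, ?D \<omega>))) (A \<times> C) =
        emeasure M (A \<inter> (?D -` C \<inter> space M))"
      by (subst emeasure_distr[OF pm]) (use AC in \<open>auto intro!: arg_cong[where f = "emeasure M"]\<close>)
    ultimately show "emeasure (distr M (F s) (\<lambda>\<omega>. \<omega>)) A * emeasure (distr M borel ?D) C =
        emeasure (distr M (F s \<Otimes>\<^sub>M borel) (\<lambda>\<omega>. (\<omega>, ?D \<omega>))) (A \<times> C)"
      by simp
  qed
qed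

text \<open>By the product law \<open>\<omega>\<close> can be frozen while the increment is
  integrated, and the inner Gaussian integral is 1 whatever \<open>Z \<omega>\<close> is. The case
  \<open>s = t\<close>, where the increment has no density, is trivial.\<close>

lemma increment_exponential:
  assumes st: "0 \<le> s" "s \<le> t"
    and Y: "Y \<in> borel_measurable (F s)" and Z: "Z \<in> borel_measurable (F s)"
  shows "(\<integral>\<^sup>+\<omega>. Y \<omega> * ennreal (exp (Z \<omega> * (B t \<omega> - B s \<omega>) - (Z \<omega>)\<^sup>2 * (t - s) / 2)) \<partial>M) = (\<integral>\<^sup>+\<omega>. Y \<omega> \<partial>M)"
proof (cases "s = t")
  case False
  then have st': "s < t" using st by simp
  let ?D = "\<lambda>\<omega>. B t \<omega> - B s \<omega>"
  let ?N = "density lborel (normal_density 0 (sqrt (t - s)))"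
  let ?f = "\<lambda>(\<omega>, r). Y \<omega> * ennreal (exp (Z \<omega> * r - (Z \<omega>)\<^sup>2 * (t - s) / 2))"
  have id: "(\<lambda>\<omega>. \<omega>) \<in> measurable M (F s)"
    by (rule measurableI) (use sets_F space_F in \<open>auto dest: sets.sets_into_space\<close>)
  have Dm: "?D \<in> borel_measurable M"
    using measurable_F_M[OF B_measurable[of t t]] measurable_F_M[OF B_measurable[of s s]] st by simp
  have pm: "(\<lambda>\<omega>. (\<omega>, ?D \<omega>)) \<in> measurable M (F s \<Otimes>\<^sub>M borel)"
    by (rule measurable_Pair[OF id Dm])
  note [measurable] = Y Z
  have f: "?f \<in> borel_measurable (F s \<Otimes>\<^sub>M borel)" by measurable
  interpret N: prob_space ?N using prob_space_normal_density[of "sqrt (t - s)" 0] st' by simp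
  have "(\<integral>\<^sup>+\<omega>. ?f (\<omega>, ?D \<omega>) \<partial>M) = integral\<^sup>N (distr M (F s \<Otimes>\<^sub>M borel) (\<lambda>\<omega>. (\<omega>, ?D \<omega>))) ?f"
    by (rule nn_integral_distr[symmetric, OF pm]) (use f in simp)
  also have "\<dots> = integral\<^sup>N (distr M (F s) (\<lambda>\<omega>. \<omega>) \<Otimes>\<^sub>M ?N) ?f"
    by (simp only: B_increment_joint[OF st(1) st'])
  also have "\<dots> = (\<integral>\<^sup>+\<omega>. \<integral>\<^sup>+r. ?f (\<omega>, r) \<partial>?N \<partial>distr M (F s) (\<lambda>\<omega>. \<omega>))"
    by (rule N.nn_integral_fst[symmetric]) (use f in \<open>simp cong: measurable_cong_sets\<close>)
  also have "\<dots> = (\<integral>\<^sup>+\<omega>. Y \<omega> \<partial>distr M (F s) (\<lambda>\<omega>. \<omega>))"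
    using nn_integral_gaussian_exponential[of "t - s"] st' by (simp add: nn_integral_cmult)
  also have "\<dots> = (\<integral>\<^sup>+\<omega>. Y \<omega> \<partial>M)"
    by (rule nn_integral_distr[OF id]) simp
  finally show ?thesis by simp
qed simp

section \<open>Exponentials of sums over a deterministic time grid\<close>

context
  fixes \<sigma> :: "nat \<Rightarrow> real" and Z :: "nat \<Rightarrow> 'a \<Rightarrow> real" and n :: nat and s :: real
  assumes s: "0 \<le> s" "s \<le> \<sigma> 0" and \<sigma>: "\<And>i. i < n \<Longrightarrow> \<sigma> i \<le> \<sigma> (Suc i)"
    and Z: "\<And>i. i < n \<Longrightarrow> Z i \<in> borel_measurable (F (\<sigma> i))"
begin

lemma grid_mono: "i \<le> j \<Longrightarrow> j \<le> n \<Longrightarrow> \<sigma> i \<le> \<sigma> j"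
proof (induction j rule: dec_induct)
  case (step j)
  then show ?case using \<sigma>[of j] by simp
qed simp

lemma grid_ge: "i \<le> n \<Longrightarrow> s \<le> \<sigma> i"
  using grid_mono[of 0 i] s by simp

lemma grid_measurable: "i < j \<Longrightarrow> j \<le> n \<Longrightarrow> Z i \<in> borel_measurable (F (\<sigma> j))"
  "i \<le> j \<Longrightarrow> j \<le> n \<Longrightarrow> B (\<sigma> i) \<in> borel_measurable (F (\<sigma> j))"
  using measurable_F_mono[OF Z grid_mono, of i j] B_measurable[OF _ grid_mono, of i j] grid_ge[of i] s by auto

lemma grid_exponential_measurable:
  "j \<le> n \<Longrightarrow> (\<lambda>\<omega>. exp ((\<Sum>i<j. Z i \<omega> * (B (\<sigma> (Suc i)) \<omega> - B (\<sigma> i) \<omega>)) -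
    (\<Sum>i<j. (Z i \<omega>)\<^sup>2 * (\<sigma> (Suc i) - \<sigma> i)) / 2)) \<in> borel_measurable (F (\<sigma> j))"
  by (intro borel_measurable_exp borel_measurable_diff borel_measurable_sum borel_measurable_times
      borel_measurable_divide borel_measurable_power grid_measurable borel_measurable_const measurable_compose[OF _ borel_measurable_exp])
    auto

text \<open>Induction peels off the last increment: everything before it, together with
  \<open>Y\<close>, is measurable at time \<open>\<sigma> j\<close> and serves as the
  \<open>Y\<close> of \<open>increment_exponential\<close>.\<close>

lemma grid_exponential:
  assumes Y: "Y \<in> borel_measurable (F s)"
  shows "j \<le> n \<Longrightarrow> (\<integral>\<^sup>+\<omega>. Y \<omega> * ennreal (exp ((\<Sum>i<j. Z i \<omega> * (B (\<sigma> (Suc i)) \<omega> - B (\<sigma> i) \<omega>)) -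
    (\<Sum>i<j. (Z i \<omega>)\<^sup>2 * (\<sigma> (Suc i) - \<sigma> i)) / 2)) \<partial>M) = (\<integral>\<^sup>+\<omega>. Y \<omega> \<partial>M)"
proof (induction j)
  case (Suc j)
  let ?E = "\<lambda>\<omega>. exp ((\<Sum>i<j. Z i \<omega> * (B (\<sigma> (Suc i)) \<omega> - B (\<sigma> i) \<omega>)) -
    (\<Sum>i<j. (Z i \<omega>)\<^sup>2 * (\<sigma> (Suc i) - \<sigma> i)) / 2)"
  have j: "j < n" using Suc by simp
  have Ym: "(\<lambda>\<omega>. Y \<omega> * ennreal (?E \<omega>)) \<in> borel_measurable (F (\<sigma> j))"
    using measurable_F_mono[OF Y grid_ge, of j] grid_exponential_measurable[of j] j by simp
  have "(\<integral>\<^sup>+\<omega>. Y \<omega> * ennreal (exp ((\<Sum>i<Suc j. Z i \<omega> * (B (\<sigma> (Suc i)) \<omega> - B (\<sigma> i) \<omega>)) -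
    (\<Sum>i<Suc j. (Z i \<omega>)\<^sup>2 * (\<sigma> (Suc i) - \<sigma> i)) / 2)) \<partial>M)
    = (\<integral>\<^sup>+\<omega>. (Y \<omega> * ennreal (?E \<omega>)) * ennreal (exp (Z j \<omega> * (B (\<sigma> (Suc j)) \<omega> - B (\<sigma> j) \<omega>) -
      (Z j \<omega>)\<^sup>2 * (\<sigma> (Suc j) - \<sigma> j) / 2)) \<partial>M)"
    by (intro nn_integral_cong)
      (simp add: mult.assoc diff_divide_distrib add_divide_distrib algebra_simps flip: ennreal_mult' exp_add)
  also have "\<dots> = (\<integral>\<^sup>+\<omega>. Y \<omega> * ennreal (?E \<omega>) \<partial>M)"
    by (rule increment_exponential[OF _ _ Ym]) (use grid_ge[of j] \<sigma>[OF j] Z[OF j] s j in auto)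
  finally show ?case using Suc by simp
qed simp

end

text \<open>\<open>V\<close> plays the role of the quadratic variation of the martingale increment \<open>S\<close> after time
  \<open>s\<close>. The variable \<open>N\<close> is the exponential martingale stopped just before \<open>V\<close> exceeds \<open>R\<close>.\<close>

definition exponential_pair :: "real \<Rightarrow> ('a \<Rightarrow> real) \<Rightarrow> ('a \<Rightarrow> real) \<Rightarrow> bool" where
  "exponential_pair s S V \<longleftrightarrow> S \<in> borel_measurable M \<and> V \<in> borel_measurable M \<and>
    (\<forall>Y\<in>borel_measurable (F s).
      (\<integral>\<^sup>+\<omega>. Y \<omega> * ennreal (exp (S \<omega> - V \<omega> / 2)) \<partial>M) = (\<integral>\<^sup>+\<omega>. Y \<omega> \<partial>M)) \<and>
    (\<forall>R\<ge>0. \<exists>N\<in>borel_measurable M. (\<forall>\<omega>. 0 \<le> N \<omega>) \<and>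
      (\<forall>Y\<in>borel_measurable (F s). (\<integral>\<^sup>+\<omega>. Y \<omega> * ennreal (N \<omega>) \<partial>M) = (\<integral>\<^sup>+\<omega>. Y \<omega> \<partial>M)) \<and>
      (\<integral>\<^sup>+\<omega>. ennreal ((N \<omega>)\<^sup>2) \<partial>M) \<le> ennreal (exp R) \<and>
      (\<forall>\<omega>. V \<omega> \<le> R \<longrightarrow> N \<omega> = exp (S \<omega> - V \<omega> / 2)))"

text \<open>For the truncated variable \<open>N\<close> the coefficients are switched off before the
  quadratic variation can exceed \<open>R\<close>. This is possible without anticipation because its
  next value is known at the beginning of each grid interval.\<close>

lemma grid_exponential_pair:
  fixes \<sigma> :: "nat \<Rightarrow> real" and Z :: "nat \<Rightarrow> 'a \<Rightarrow> real" and n :: nat and s :: real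
  assumes s: "0 \<le> s" "s \<le> \<sigma> 0" and \<sigma>: "\<And>i. i < n \<Longrightarrow> \<sigma> i \<le> \<sigma> (Suc i)"
    and Z: "\<And>i. i < n \<Longrightarrow> Z i \<in> borel_measurable (F (\<sigma> i))"
  defines "S \<equiv> \<lambda>\<omega>. \<Sum>i<n. Z i \<omega> * (B (\<sigma> (Suc i)) \<omega> - B (\<sigma> i) \<omega>)"
    and "V \<equiv> \<lambda>\<omega>. \<Sum>i<n. (Z i \<omega>)\<^sup>2 * (\<sigma> (Suc i) - \<sigma> i)"
  shows "exponential_pair s S V"
  unfolding exponential_pair_def
proof (intro conjI ballI allI impI)
  have Zm: "Z i \<in> borel_measurable M" if "i < n" for i
    using measurable_F_M[OF Z[OF that]] .
  have Bm: "B (\<sigma> i) \<in> borel_measurable M" if "i \<le> n" for i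
    using measurable_F_M[OF B_measurable[OF _ order_refl]] grid_ge[OF s \<sigma> Z that] s by simp
  show "S \<in> borel_measurable M" "V \<in> borel_measurable M"
    using Zm Bm unfolding S_def V_def
    by (auto intro!: borel_measurable_sum borel_measurable_times borel_measurable_diff borel_measurable_power)
  show "(\<integral>\<^sup>+\<omega>. Y \<omega> * ennreal (exp (S \<omega> - V \<omega> / 2)) \<partial>M) = (\<integral>\<^sup>+\<omega>. Y \<omega> \<partial>M)"
    if "Y \<in> borel_measurable (F s)" for Y
    unfolding S_def V_def by (rule grid_exponential[OF s \<sigma> Z that order_refl])
  fix R :: real assume R: "0 \<le> R"
  define W where "W j \<omega> = (\<Sum>i<j. (Z i \<omega>)\<^sup>2 * (\<sigma> (Suc i) - \<sigma> i))" for j \<omega>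
  \<comment> \<open>The test uses \<open>W (Suc i)\<close>, which includes the current interval, and
    not \<open>W i\<close>; hence \<open>V'\<close> never exceeds \<open>R\<close>. Still
    \<open>Z' i\<close> is measurable at \<open>\<sigma> i\<close>, since \<open>W (Suc i)\<close>
    involves only \<open>Z 0\<close>, ..., \<open>Z i\<close> and deterministic lengths.\<close>
  define Z' where "Z' i \<omega> = (if W (Suc i) \<omega> \<le> R then Z i \<omega> else 0)" for i \<omega>
  define V' where "V' j \<omega> = (\<Sum>i<j. (Z' i \<omega>)\<^sup>2 * (\<sigma> (Suc i) - \<sigma> i))" for j \<omega>
  define S' where "S' \<omega> = (\<Sum>i<n. Z' i \<omega> * (B (\<sigma> (Suc i)) \<omega> - B (\<sigma> i) \<omega>))" for \<omega>
  have W_mono: "W i \<omega> \<le> W j \<omega>" if "i \<le> j" "j \<le> n" for i j \<omega>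
    unfolding W_def by (rule sum_mono2) (use that \<sigma> in auto)
  have Z'_eq: "Z' i \<omega> = Z i \<omega>" if "W j \<omega> \<le> R" "i < j" "j \<le> n" for i j \<omega>
    using W_mono[of "Suc i" j \<omega>] that by (simp add: Z'_def)
  have V'_le: "V' j \<omega> \<le> R" if "j \<le> n" for j \<omega>
    using that
  proof (induction j)
    case 0 then show ?case using R by (simp add: V'_def)
  next
    case (Suc j)
    show ?case
    proof (cases "W (Suc j) \<omega> \<le> R")
      case True
      have "V' (Suc j) \<omega> = W (Suc j) \<omega>"
        unfolding V'_def W_def by (rule sum.cong) (use Z'_eq[OF True _ Suc.prems] in auto)
      then show ?thesis using True by simp
    next
      case False
      then have "V' (Suc j) \<omega> = V' j \<omega>" by (simp add: V'_def Z'_def)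
      then show ?thesis using Suc by simp
    qed
  qed
  have Z'm: "Z' i \<in> borel_measurable (F (\<sigma> i))" if i: "i < n" for i
  proof -
    have [measurable]: "Z j \<in> borel_measurable (F (\<sigma> i))" if "j \<le> i" for j
      using measurable_F_mono[OF Z grid_mono[OF s \<sigma> Z, where n = n and j = i and i = j]] that i by simp
    have [measurable]: "W (Suc i) \<in> borel_measurable (F (\<sigma> i))" unfolding W_def by measurable
    show ?thesis unfolding Z'_def[abs_def] by measurable
  qed
  have Z'm2: "(\<lambda>\<omega>. 2 * Z' i \<omega>) \<in> borel_measurable (F (\<sigma> i))" if "i < n" for i
    using Z'm[OF that] by simp
  let ?N = "\<lambda>\<omega>. exp (S' \<omega> - V' n \<omega> / 2)"
  have Nm: "?N \<in> borel_measurable M"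
    using measurable_F_M[OF grid_exponential_measurable[OF s \<sigma> Z'm order_refl]] by (simp add: S'_def V'_def)
  moreover have "(\<integral>\<^sup>+\<omega>. Y \<omega> * ennreal (?N \<omega>) \<partial>M) = (\<integral>\<^sup>+\<omega>. Y \<omega> \<partial>M)" if "Y \<in> borel_measurable (F s)" for Y
    using grid_exponential[OF s \<sigma> Z'm that order_refl] by (simp add: S'_def V'_def)
  moreover have "(\<integral>\<^sup>+\<omega>. ennreal ((?N \<omega>)\<^sup>2) \<partial>M) \<le> ennreal (exp R)"
  proof -
    \<comment> \<open>The exponential for doubled coefficients is
      \<open>exp (2 * S' - 2 * V' n)\<close>. The square of \<open>?N\<close> is this times
      \<open>exp (V' n)\<close>, with \<open>V' n \<le> R\<close>, and \<open>?N2\<close> has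
      expectation 1.\<close>
    let ?N2 = "\<lambda>\<omega>. exp ((\<Sum>i<n. (2 * Z' i \<omega>) * (B (\<sigma> (Suc i)) \<omega> - B (\<sigma> i) \<omega>)) -
      (\<Sum>i<n. (2 * Z' i \<omega>)\<^sup>2 * (\<sigma> (Suc i) - \<sigma> i)) / 2)"
    have eq: "?N2 \<omega> = exp (2 * S' \<omega> - 2 * V' n \<omega>)" for \<omega>
      unfolding S'_def V'_def
      by (simp add: power_mult_distrib sum_distrib_left sum_divide_distrib mult_ac)
    have N2m: "?N2 \<in> borel_measurable M"
      by (rule measurable_F_M[OF grid_exponential_measurable[OF s \<sigma> Z'm2 order_refl]])
    have "(\<integral>\<^sup>+\<omega>. ennreal ((?N \<omega>)\<^sup>2) \<partial>M) \<le> (\<integral>\<^sup>+\<omega>. ennreal (exp R) * ennreal (?N2 \<omega>) \<partial>M)"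
    proof (rule nn_integral_mono)
      fix \<omega>
      have "(?N \<omega>)\<^sup>2 = exp (2 * S' \<omega> - V' n \<omega>)" by (simp flip: exp_double)
      also have "\<dots> \<le> exp (R + (2 * S' \<omega> - 2 * V' n \<omega>))" using V'_le[of n \<omega>] by simp
      finally show "ennreal ((?N \<omega>)\<^sup>2) \<le> ennreal (exp R) * ennreal (?N2 \<omega>)"
        unfolding eq by (simp add: exp_add flip: ennreal_mult')
    qed
    also have "\<dots> = ennreal (exp R) * (\<integral>\<^sup>+\<omega>. 1 * ennreal (?N2 \<omega>) \<partial>M)"
      using N2m by (simp add: nn_integral_cmult)
    also have "(\<integral>\<^sup>+\<omega>. 1 * ennreal (?N2 \<omega>) \<partial>M) = (\<integral>\<^sup>+\<omega>. 1 \<partial>M)"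
      by (rule grid_exponential[OF s \<sigma> Z'm2 _ order_refl]) auto
    finally show ?thesis by (simp add: emeasure_space_1)
  qed
  moreover have "?N \<omega> = exp (S \<omega> - V \<omega> / 2)" if "V \<omega> \<le> R" for \<omega>
  proof -
    have "W n \<omega> \<le> R" using that by (simp add: V_def W_def)
    then show ?thesis unfolding S'_def V'_def S_def V_def using Z'_eq[of n \<omega>] by simp
  qed
  ultimately show "\<exists>N\<in>borel_measurable M. (\<forall>\<omega>. 0 \<le> N \<omega>) \<and>
      (\<forall>Y\<in>borel_measurable (F s). (\<integral>\<^sup>+\<omega>. Y \<omega> * ennreal (N \<omega>) \<partial>M) = (\<integral>\<^sup>+\<omega>. Y \<omega> \<partial>M)) \<and>
      (\<integral>\<^sup>+\<omega>. ennreal ((N \<omega>)\<^sup>2) \<partial>M) \<le> ennreal (exp R) \<and>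
      (\<forall>\<omega>. V \<omega> \<le> R \<longrightarrow> N \<omega> = exp (S \<omega> - V \<omega> / 2))"
    by (intro bexI[of _ ?N]) auto
qed

end

section \<open>Simple integrands: pathwise squares and increments\<close>

lemma simple_value_square:
  assumes "\<And>i. i < n \<Longrightarrow> \<tau> i \<le> \<tau> (Suc i)"
  shows "(simple_value n \<tau> \<xi> u \<omega>)\<^sup>2 = (\<Sum>i<n. (\<xi> i \<omega>)\<^sup>2 * indicator {\<tau> i<..\<tau> (Suc i)} u)"
  using assms
proof (induction n)
  case (Suc n)
  have mono: "\<tau> (Suc i) \<le> \<tau> n" if "i < n" for i
  proof -
    have "Suc i \<le> j \<Longrightarrow> j \<le> n \<Longrightarrow> \<tau> (Suc i) \<le> \<tau> j" for j
    proof (induction j rule: dec_induct)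
      case (step j)
      then show ?case using Suc.prems[of j] by simp
    qed simp
    then show ?thesis using that by simp
  qed
  have split: "simple_value (Suc n) \<tau> \<xi> u \<omega> =
      simple_value n \<tau> \<xi> u \<omega> + \<xi> n \<omega> * indicator {\<tau> n<..\<tau> (Suc n)} u"
    by (simp add: simple_value_def)
  have "simple_value n \<tau> \<xi> u \<omega> = 0" if "u \<in> {\<tau> n<..\<tau> (Suc n)}"
    unfolding simple_value_def
  proof (intro sum.neutral ballI)
    fix i assume "i \<in> {..<n}"
    then have "\<tau> (Suc i) < u" using mono[of i] that by simp
    then show "\<xi> i \<omega> * indicator {\<tau> i<..\<tau> (Suc i)} u = 0" by simp
  qed
  then have "(simple_value (Suc n) \<tau> \<xi> u \<omega>)\<^sup>2 =
      (simple_value n \<tau> \<xi> u \<omega>)\<^sup>2 + (\<xi> n \<omega>)\<^sup>2 * indicator {\<tau> n<..\<tau> (Suc n)} u"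
    unfolding split by (auto simp: indicator_def)
  then show ?case using Suc by simp
qed (simp add: simple_value_def)

text \<open>The endpoints are clamped to \<open>{s..t}\<close>, so an interval that misses
  \<open>{s<..t}\<close> gets length 0. Replacing \<open>\<xi> i\<close> by 0 when
  \<open>\<tau> i > t\<close> changes nothing in the sum, but makes the coefficient measurable at
  the clamped time, as the grid lemmas demand.\<close>

lemma simple_value_square_integral:
  assumes \<tau>: "\<And>i. i < n \<Longrightarrow> \<tau> i \<le> \<tau> (Suc i)" and st: "s \<le> t"
  shows "(LINT u:{s<..t}|lborel. (simple_value n \<tau> \<xi> u \<omega>)\<^sup>2) =
    (\<Sum>i<n. (if \<tau> i \<le> t then \<xi> i \<omega> else 0)\<^sup>2 * (max s (min (\<tau> (Suc i)) t) - max s (min (\<tau> i) t)))"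
proof -
  let ?A = "\<lambda>i. {max s (min (\<tau> i) t)<..max s (min (\<tau> (Suc i)) t)}"
  have le: "max s (min (\<tau> i) t) \<le> max s (min (\<tau> (Suc i)) t)" if "i < n" for i
    using \<tau>[OF that] by auto
  have fin: "emeasure lborel (?A i) < \<infinity>" if "i < n" for i
    by (subst emeasure_lborel_Ioc[OF le[OF that]]) simp
  have "(LINT u:{s<..t}|lborel. (simple_value n \<tau> \<xi> u \<omega>)\<^sup>2) =
      (LINT u|lborel. (\<Sum>i<n. (\<xi> i \<omega>)\<^sup>2 * indicator (?A i) u))"
    unfolding set_lebesgue_integral_def
  proof (rule Bochner_Integration.integral_cong[OF refl])
    fix u
    have "indicator {s<..t} u * indicator {\<tau> i<..\<tau> (Suc i)} u = (indicator (?A i) u :: real)" for i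
      using st by (auto simp: indicator_def)
    then show "indicator {s<..t} u *\<^sub>R (simple_value n \<tau> \<xi> u \<omega>)\<^sup>2 = (\<Sum>i<n. (\<xi> i \<omega>)\<^sup>2 * indicator (?A i) u)"
      by (simp only: simple_value_square[where \<tau> = \<tau> and n = n, OF \<tau>] real_scaleR_def sum_distrib_left
          mult.left_commute[of "indicator {s<..t} u"])
  qed
  also have "\<dots> = (\<Sum>i<n. (\<xi> i \<omega>)\<^sup>2 * measure lborel (?A i))"
    by (subst Bochner_Integration.integral_sum)
      (use fin in \<open>auto intro!: integrable_mult_right integrable_real_indicator\<close>)
  also have "\<dots> = (\<Sum>i<n. (if \<tau> i \<le> t then \<xi> i \<omega> else 0)\<^sup>2 *
      (max s (min (\<tau> (Suc i)) t) - max s (min (\<tau> i) t)))"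
  proof (rule sum.cong[OF refl])
    fix i assume "i \<in> {..<n}"
    then show "(\<xi> i \<omega>)\<^sup>2 * measure lborel (?A i) = (if \<tau> i \<le> t then \<xi> i \<omega> else 0)\<^sup>2 *
      (max s (min (\<tau> (Suc i)) t) - max s (min (\<tau> i) t))"
      using le[of i] \<tau>[of i] by simp
  qed
  finally show ?thesis .
qed

text \<open>For \<open>s \<le> t\<close> the path at a clamped time is
  \<open>B (min r t) - B (min r s) + B s\<close>, and \<open>B s\<close> cancels in differences. The
  sum has the same grid and coefficients as the squared integral above.\<close>

lemma simple_integral_increment:
  assumes \<tau>: "\<And>i. i < n \<Longrightarrow> \<tau> i \<le> \<tau> (Suc i)" and st: "s \<le> t"
  shows "simple_integral B n \<tau> \<xi> t \<omega> - simple_integral B n \<tau> \<xi> s \<omega> =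
    (\<Sum>i<n. (if \<tau> i \<le> t then \<xi> i \<omega> else 0) *
      (B (max s (min (\<tau> (Suc i)) t)) \<omega> - B (max s (min (\<tau> i) t)) \<omega>))"
proof -
  have clamp: "B (max s (min r t)) \<omega> = B (min r t) \<omega> - B (min r s) \<omega> + B s \<omega>" for r
    using st by (cases "r \<le> s") (auto simp: max_def min_def)
  show ?thesis
    unfolding simple_integral_def sum_subtractf[symmetric]
  proof (rule sum.cong[OF refl])
    fix i assume "i \<in> {..<n}"
    then show "\<xi> i \<omega> * (B (min (\<tau> (Suc i)) t) \<omega> - B (min (\<tau> i) t) \<omega>) -
        \<xi> i \<omega> * (B (min (\<tau> (Suc i)) s) \<omega> - B (min (\<tau> i) s) \<omega>) =
      (if \<tau> i \<le> t then \<xi> i \<omega> else 0) *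
        (B (max s (min (\<tau> (Suc i)) t)) \<omega> - B (max s (min (\<tau> i) t)) \<omega>)"
      using \<tau>[of i] st unfolding clamp by (cases "\<tau> i \<le> t") (auto simp: algebra_simps min_def)
  qed
qed

context brownian_space
begin

lemma simple_exponential:
  fixes a :: real
  assumes simple: "simple_integrand M F n \<tau> \<xi>" and s: "0 \<le> s" and st: "s \<le> t"
  defines "S \<equiv> \<lambda>\<omega>. a * (simple_integral B n \<tau> \<xi> t \<omega> - simple_integral B n \<tau> \<xi> s \<omega>)"
    and "V \<equiv> \<lambda>\<omega>. a\<^sup>2 * (LINT u:{s<..t}|lborel. (simple_value n \<tau> \<xi> u \<omega>)\<^sup>2)"
  shows "exponential_pair s S V"
proof -
  define \<sigma> where "\<sigma> i = max s (min (\<tau> i) t)" for i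
  define Z where "Z i \<omega> = a * (if \<tau> i \<le> t then \<xi> i \<omega> else 0)" for i \<omega>
  have \<tau>: "\<And>i. i < n \<Longrightarrow> \<tau> i \<le> \<tau> (Suc i)"
    and \<xi>: "\<And>i. i < n \<Longrightarrow> \<xi> i \<in> borel_measurable (F (\<tau> i))"
    using simple by (auto simp: simple_integrand_def)
  have S: "S \<omega> = (\<Sum>i<n. Z i \<omega> * (B (\<sigma> (Suc i)) \<omega> - B (\<sigma> i) \<omega>))" for \<omega>
  proof -
    have "simple_integral B n \<tau> \<xi> t \<omega> - simple_integral B n \<tau> \<xi> s \<omega> =
        (\<Sum>i<n. (if \<tau> i \<le> t then \<xi> i \<omega> else 0) * (B (\<sigma> (Suc i)) \<omega> - B (\<sigma> i) \<omega>))"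
      unfolding \<sigma>_def by (rule simple_integral_increment) (use \<tau> st in auto)
    then show ?thesis unfolding S_def Z_def by (simp add: sum_distrib_left mult.assoc)
  qed
  have V: "V \<omega> = (\<Sum>i<n. (Z i \<omega>)\<^sup>2 * (\<sigma> (Suc i) - \<sigma> i))" for \<omega>
  proof -
    have "(LINT u:{s<..t}|lborel. (simple_value n \<tau> \<xi> u \<omega>)\<^sup>2) =
        (\<Sum>i<n. (if \<tau> i \<le> t then \<xi> i \<omega> else 0)\<^sup>2 * (\<sigma> (Suc i) - \<sigma> i))"
      unfolding \<sigma>_def by (rule simple_value_square_integral) (use \<tau> st in auto)
    then show ?thesis unfolding V_def Z_def by (simp add: sum_distrib_left power_mult_distrib mult.assoc)
  qed
  have s\<sigma>: "s \<le> \<sigma> 0" by (simp add: \<sigma>_def)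
  have \<sigma>: "\<sigma> i \<le> \<sigma> (Suc i)" if "i < n" for i
    using \<tau>[OF that] by (auto simp: \<sigma>_def)
  have Z: "Z i \<in> borel_measurable (F (\<sigma> i))" if "i < n" for i
  proof (cases "\<tau> i \<le> t")
    case True
    have "\<xi> i \<in> borel_measurable (F (\<sigma> i))"
      by (rule measurable_F_mono[OF \<xi>[OF that]]) (use True in \<open>auto simp: \<sigma>_def\<close>)
    then show ?thesis using True by (simp add: Z_def[abs_def])
  qed (simp add: Z_def[abs_def])
  show ?thesis
    unfolding S[abs_def] V[abs_def] by (rule grid_exponential_pair[OF s s\<sigma> \<sigma> Z])
qed

end

text \<open>Truncation at 1 turns convergence in probability into convergence in \<open>L^1\<close>,
  since the integral of \<open>min 1 (f k)\<close> is at most \<open>\<epsilon>\<close> plus the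
  probability of exceeding \<open>\<epsilon>\<close>; a subsequence then converges almost
  everywhere. Along it the values are eventually below 1, where the truncation is invisible.\<close>

lemma (in prob_space) tendsto_in_prob_AE_subseq:
  fixes f :: "nat \<Rightarrow> 'a \<Rightarrow> ennreal"
  assumes f[measurable]: "\<And>k. f k \<in> borel_measurable M"
    and lim: "\<And>\<epsilon>. 0 < \<epsilon> \<Longrightarrow> (\<lambda>k. measure M {\<omega>\<in>space M. ennreal \<epsilon> < f k \<omega>}) \<longlonglongrightarrow> 0"
  shows "\<exists>r::nat \<Rightarrow> nat. strict_mono r \<and> (AE \<omega> in M. (\<lambda>k. f (r k) \<omega>) \<longlonglongrightarrow> 0)"
proof -
  define u where "u k \<omega> = enn2real (min 1 (f k \<omega>))" for k \<omega>
  have um[measurable]: "u k \<in> borel_measurable M" for k unfolding u_def[abs_def] by measurable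
  have u01: "0 \<le> u k \<omega>" "u k \<omega> \<le> 1" for k \<omega>
    unfolding u_def by (auto intro: enn2real_leI)
  have ui: "integrable M (u k)" for k
    by (rule integrable_const_bound[of _ 1]) (use u01 in auto)
  have le: "(\<integral>\<omega>. norm (u k \<omega>) \<partial>M) \<le> \<epsilon> + measure M {\<omega>\<in>space M. ennreal \<epsilon> < f k \<omega>}" if "0 < \<epsilon>" for k \<epsilon>
  proof -
    let ?A = "{\<omega>\<in>space M. ennreal \<epsilon> < f k \<omega>}"
    have "(\<integral>\<omega>. norm (u k \<omega>) \<partial>M) \<le> (\<integral>\<omega>. \<epsilon> + indicator ?A \<omega> \<partial>M)"
    proof (rule integral_mono)
      show "integrable M (\<lambda>\<omega>. norm (u k \<omega>))" using ui by simp
      show "integrable M (\<lambda>\<omega>. \<epsilon> + indicator ?A \<omega>)"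
        by (intro Bochner_Integration.integrable_add integrable_const) (auto simp: emeasure_eq_measure)
      fix \<omega> assume w: "\<omega> \<in> space M"
      show "norm (u k \<omega>) \<le> \<epsilon> + indicator ?A \<omega>"
      proof (cases "ennreal \<epsilon> < f k \<omega>")
        case True
        then show ?thesis using u01[of k \<omega>] that w by (simp add: indicator_def)
      next
        case False
        then have "u k \<omega> \<le> \<epsilon>"
          unfolding u_def using that by (intro enn2real_leI) (auto simp: min_le_iff_disj not_less)
        then show ?thesis using u01[of k \<omega>] by (simp add: indicator_def False)
      qed
    qed
    also have "\<dots> = \<epsilon> + measure M ?A"
      by (subst Bochner_Integration.integral_add) (auto simp: emeasure_eq_measure prob_space)
    finally show ?thesis .
  qed
  have "(\<lambda>k. \<integral>\<omega>. norm (u k \<omega>) \<partial>M) \<longlonglongrightarrow> 0"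
  proof (rule LIMSEQ_I)
    fix e :: real assume e: "0 < e"
    then have "\<forall>\<^sub>F k in sequentially. measure M {\<omega>\<in>space M. ennreal (e/2) < f k \<omega>} < e/2"
      using order_tendstoD(2)[OF lim, of "e/2" "e/2"] by simp
    then obtain K where K: "\<And>k. K \<le> k \<Longrightarrow> measure M {\<omega>\<in>space M. ennreal (e/2) < f k \<omega>} < e/2"
      by (auto simp: eventually_sequentially)
    show "\<exists>K. \<forall>k\<ge>K. norm ((\<integral>\<omega>. norm (u k \<omega>) \<partial>M) - 0) < e"
    proof (intro exI[of _ K] allI impI)
      fix k assume "K \<le> k"
      then have "(\<integral>\<omega>. norm (u k \<omega>) \<partial>M) < e" using le[of "e/2" k] K[of k] e by simp
      then show "norm ((\<integral>\<omega>. norm (u k \<omega>) \<partial>M) - 0) < e" by simp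
    qed
  qed
  then obtain r :: "nat \<Rightarrow> nat" where r: "strict_mono r" "AE \<omega> in M. (\<lambda>k. u (r k) \<omega>) \<longlonglongrightarrow> 0"
    using tendsto_L1_AE_subseq[of M u, OF ui] by blast
  have "AE \<omega> in M. (\<lambda>k. f (r k) \<omega>) \<longlonglongrightarrow> 0"
    using r(2)
  proof eventually_elim
    case (elim \<omega>)
    have "(\<lambda>k. ennreal (u (r k) \<omega>)) \<longlonglongrightarrow> ennreal 0" by (rule tendsto_ennrealI[OF elim])
    moreover have "\<forall>\<^sub>F k in sequentially. ennreal (u (r k) \<omega>) = f (r k) \<omega>"
      using order_tendstoD(2)[OF elim zero_less_one]
    proof eventually_elim
      case (elim k)
      have "min 1 (f (r k) \<omega>) < top" by (rule le_less_trans[of _ 1]) auto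
      then have eq: "ennreal (u (r k) \<omega>) = min 1 (f (r k) \<omega>)" unfolding u_def by (rule ennreal_enn2real)
      also have "\<dots> < 1" using elim eq[symmetric] ennreal_lessI[of 1 "u (r k) \<omega>"] by simp
      finally show ?case using eq by (auto simp: min_def split: if_splits)
    qed
    ultimately show ?case by (simp add: tendsto_cong)
  qed
  then show ?thesis using r(1) by blast
qed

text \<open>Convergence in \<open>L^2\<close> of one fixed path gives convergence of the squared
  norms. The cross term is split by Young's inequality with a weight \<open>e\<close> that tends to
  0 more slowly than the squared distance.\<close>

lemma square_integral_tendsto:
  fixes f :: "nat \<Rightarrow> real \<Rightarrow> real"
  assumes H: "continuous_on {0..T} H"
    and f: "\<And>k. f k \<in> borel_measurable borel" and fb: "\<And>k. \<exists>C. \<forall>u. \<bar>f k u\<bar> \<le> C"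
    and lim: "(\<lambda>k. \<integral>\<^sup>+u\<in>{0..T}. ennreal ((f k u - H u)\<^sup>2) \<partial>lborel) \<longlonglongrightarrow> 0"
    and st: "0 \<le> s" "s \<le> t" "t \<le> T"
  shows "(\<lambda>k. LINT u:{s<..t}|lborel. (f k u)\<^sup>2) \<longlonglongrightarrow> (LINT u:{s<..t}|lborel. (H u)\<^sup>2)"
proof -
  \<comment> \<open>\<open>H\<close> is controlled only on \<open>{0..T}\<close>; the cut-off makes
    it measurable and bounded on the whole line.\<close>
  define h where "h u = indicator {0..T} u * H u" for u
  have hm: "h \<in> borel_measurable borel"
    using borel_measurable_continuous_on_indicator[OF _ H] by (simp add: h_def[abs_def])
  have "compact (H ` {0..T})" by (rule compact_continuous_image[OF H]) auto
  then obtain Q where Q: "\<And>u. u \<in> {0..T} \<Longrightarrow> \<bar>H u\<bar> \<le> Q"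
    using compact_imp_bounded bounded_iff by (metis imageI real_norm_def)
  have hb: "\<bar>h u\<bar> \<le> \<bar>Q\<bar>" for u using Q[of u] by (auto simp: h_def indicator_def)
  have int: "set_integrable lborel {s<..t} g" if "g \<in> borel_measurable borel" "\<And>u. \<bar>g u\<bar> \<le> C" for g :: "real \<Rightarrow> real" and C
    unfolding set_integrable_def
    by (rule integrableI_bounded_set_indicator[where B = C]) (use that st in auto)
  have sq: "\<bar>r\<^sup>2\<bar> \<le> c\<^sup>2" if "\<bar>r\<bar> \<le> c" for r c :: real
    using power_mono[OF that abs_ge_zero, of 2] by simp
  have Hh: "(LINT u:{s<..t}|lborel. (H u)\<^sup>2) = (LINT u:{s<..t}|lborel. (h u)\<^sup>2)"
    by (rule set_lebesgue_integral_cong) (use st in \<open>auto simp: h_def\<close>)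
  define A where "A = (LINT u:{s<..t}|lborel. (h u)\<^sup>2)"
  define U where "U k = (LINT u:{s<..t}|lborel. (f k u - h u)\<^sup>2)" for k
  have ih: "set_integrable lborel {s<..t} (\<lambda>u. (h u)\<^sup>2)"
    by (rule int[OF _ sq[OF hb]]) (use hm in simp)
  have iff: "set_integrable lborel {s<..t} (\<lambda>u. (f k u)\<^sup>2)"
    and ifh: "set_integrable lborel {s<..t} (\<lambda>u. (f k u - h u)\<^sup>2)" for k
  proof -
    obtain C where C: "\<And>u. \<bar>f k u\<bar> \<le> C" using fb[of k] by blast
    show "set_integrable lborel {s<..t} (\<lambda>u. (f k u)\<^sup>2)"
      by (rule int[OF _ sq[OF C]]) (use f in simp)
    have fh: "\<bar>f k u - h u\<bar> \<le> C + \<bar>Q\<bar>" for u using C[of u] hb[of u] by linarith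
    show "set_integrable lborel {s<..t} (\<lambda>u. (f k u - h u)\<^sup>2)"
      by (rule int[OF _ sq[OF fh]]) (use f hm in simp)
  qed
  have U0: "0 \<le> U k" and A0: "0 \<le> A" for k
    unfolding U_def A_def set_lebesgue_integral_def by (auto intro!: integral_nonneg_AE)
  have "(\<lambda>k. ennreal (U k)) \<longlonglongrightarrow> 0"
  proof (rule tendsto_sandwich[OF _ _ tendsto_const lim])
    show "\<forall>\<^sub>F k in sequentially. ennreal (U k) \<le> (\<integral>\<^sup>+u\<in>{0..T}. ennreal ((f k u - H u)\<^sup>2) \<partial>lborel)"
    proof (rule always_eventually, rule allI)
      fix k
      have "ennreal (U k) = (\<integral>\<^sup>+u. ennreal (indicator {s<..t} u *\<^sub>R (f k u - h u)\<^sup>2) \<partial>lborel)"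
        unfolding U_def set_lebesgue_integral_def
        by (rule nn_integral_eq_integral[symmetric])
          (use ifh[of k] in \<open>auto simp: set_integrable_def\<close>)
      also have "\<dots> \<le> (\<integral>\<^sup>+u\<in>{0..T}. ennreal ((f k u - H u)\<^sup>2) \<partial>lborel)"
        by (rule nn_integral_mono) (use st in \<open>auto simp: indicator_def h_def\<close>)
      finally show "ennreal (U k) \<le> (\<integral>\<^sup>+u\<in>{0..T}. ennreal ((f k u - H u)\<^sup>2) \<partial>lborel)" .
    qed
  qed auto
  then have U: "U \<longlonglongrightarrow> 0"
    using U0 by (simp flip: ennreal_0 add: tendsto_ennreal_iff)
  have bd: "norm ((LINT u:{s<..t}|lborel. (f k u)\<^sup>2) - A) \<le> U k + sqrt (U k) + (sqrt (U k) + 1 / real (Suc k)) * A" for k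
  proof -
    \<comment> \<open>The part \<open>sqrt (U k)\<close> ensures
      \<open>U k / e \<le> sqrt (U k)\<close>, so all error terms vanish in the limit;
      \<open>1 / real (Suc k)\<close> keeps \<open>e\<close> positive when
      \<open>U k = 0\<close>.\<close>
    define e where "e = sqrt (U k) + 1 / real (Suc k)"
    have e: "0 < e" using U0[of k] by (simp add: e_def add_nonneg_pos)
    have pt: "\<bar>(f k u)\<^sup>2 - (h u)\<^sup>2\<bar> \<le> (1 + 1 / e) * (f k u - h u)\<^sup>2 + e * (h u)\<^sup>2" for u
    proof -
      have "0 \<le> (e * h u - (f k u - h u))\<^sup>2 / e" "0 \<le> (e * h u + (f k u - h u))\<^sup>2 / e" using e by auto
      then have "\<bar>2 * h u * (f k u - h u)\<bar> \<le> e * (h u)\<^sup>2 + (f k u - h u)\<^sup>2 / e"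
        using e by (simp add: power2_eq_square field_simps abs_le_iff)
      moreover have "(f k u)\<^sup>2 - (h u)\<^sup>2 = (f k u - h u)\<^sup>2 + 2 * h u * (f k u - h u)"
        by (simp add: power2_eq_square algebra_simps)
      moreover have "(1 + 1 / e) * (f k u - h u)\<^sup>2 = (f k u - h u)\<^sup>2 + (f k u - h u)\<^sup>2 / e"
        by (simp add: algebra_simps)
      ultimately show ?thesis using zero_le_power2[of "f k u - h u"] by linarith
    qed
    have i2: "set_integrable lborel {s<..t} (\<lambda>u. (1 + 1 / e) * (f k u - h u)\<^sup>2 + e * (h u)\<^sup>2)"
      by (intro set_integral_add set_integrable_mult_right ifh ih)
    have "norm ((LINT u:{s<..t}|lborel. (f k u)\<^sup>2) - A) =
        norm (LINT u:{s<..t}|lborel. ((f k u)\<^sup>2 - (h u)\<^sup>2))"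
      unfolding A_def by (simp add: set_integral_diff[OF iff ih])
    also have "\<dots> \<le> (LINT u:{s<..t}|lborel. \<bar>(f k u)\<^sup>2 - (h u)\<^sup>2\<bar>)"
      using set_integral_norm_bound[OF set_integral_diff(1)[OF iff ih]] by simp
    also have "\<dots> \<le> (LINT u:{s<..t}|lborel. (1 + 1 / e) * (f k u - h u)\<^sup>2 + e * (h u)\<^sup>2)"
      by (rule set_integral_mono[OF _ i2])
        (use pt set_integrable_abs[OF set_integral_diff(1)[OF iff ih]] in auto)
    also have "\<dots> = (1 + 1 / e) * U k + e * A"
      unfolding U_def A_def
      by (subst set_integral_add(2)) (auto intro!: set_integrable_mult_right ifh ih)
    also have "1 / e * U k \<le> sqrt (U k)"
    proof -
      have "U k = sqrt (U k) * sqrt (U k)" using U0[of k] by simp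
      also have "\<dots> \<le> sqrt (U k) * e" using U0[of k] by (intro mult_left_mono) (auto simp: e_def)
      finally show ?thesis using e by (simp add: field_simps)
    qed
    then have "(1 + 1 / e) * U k + e * A \<le> U k + sqrt (U k) + e * A" by (simp add: algebra_simps)
    finally show ?thesis by (simp add: e_def)
  qed
  have "(\<lambda>k. (LINT u:{s<..t}|lborel. (f k u)\<^sup>2) - A) \<longlonglongrightarrow> 0"
  proof (rule Lim_null_comparison[OF always_eventually])
    show "\<forall>k. norm ((LINT u:{s<..t}|lborel. (f k u)\<^sup>2) - A) \<le> U k + sqrt (U k) + (sqrt (U k) + 1 / real (Suc k)) * A"
      using bd by blast
    have "(\<lambda>k. U k + sqrt (U k) + (sqrt (U k) + 1 / real (Suc k)) * A) \<longlonglongrightarrow> 0 + sqrt 0 + (sqrt 0 + 0) * A"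
      by (intro tendsto_intros U LIMSEQ_Suc[OF lim_1_over_n])
    then show "(\<lambda>k. U k + sqrt (U k) + (sqrt (U k) + 1 / real (Suc k)) * A) \<longlonglongrightarrow> 0" by simp
  qed
  then show ?thesis unfolding Hh A_def[symmetric] by (simp add: LIM_zero_iff)
qed

section \<open>Exponential martingales of the squared Bessel process\<close>

locale squared_bessel = brownian_space +
  fixes \<Delta> \<theta> :: "real \<Rightarrow> real" and x :: real and X :: "real \<Rightarrow> 'a \<Rightarrow> real"
  assumes \<Delta>_cont: "continuous_on {0..} \<Delta>"
    and \<theta>_cont: "continuous_on {0..} \<theta>" and \<theta>_nonpos: "\<And>t. 0 \<le> t \<Longrightarrow> \<theta> t \<le> 0"
    and bessel: "gen_sq_bessel2 M F B \<Delta> \<theta> x X"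
begin

lemma X_measurable: "0 \<le> s \<Longrightarrow> s \<le> t \<Longrightarrow> X s \<in> borel_measurable (F t)"
  by (rule measurable_F_mono[of _ s]) (use bessel in \<open>auto simp: gen_sq_bessel2_def\<close>)

lemma X_continuous: "\<omega> \<in> space M \<Longrightarrow> 0 \<le> s \<Longrightarrow> continuous_on {s..t} (\<lambda>u. X u \<omega>)"
  using bessel by (auto simp: gen_sq_bessel2_def intro: continuous_on_subset[of "{0..}"])

lemma X_nonneg: "\<omega> \<in> space M \<Longrightarrow> 0 \<le> t \<Longrightarrow> 0 \<le> X t \<omega>"
  using bessel by (auto simp: gen_sq_bessel2_def)

lemma \<Delta>_cont': "0 \<le> s \<Longrightarrow> continuous_on {s..t} \<Delta>" and \<theta>_cont': "0 \<le> s \<Longrightarrow> continuous_on {s..t} \<theta>"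
  by (auto intro: continuous_on_subset[OF \<Delta>_cont] continuous_on_subset[OF \<theta>_cont])

lemma sqrt_X_progressive: "progressively_measurable F (\<lambda>u \<omega>. sqrt (X u \<omega>))"
  using bessel by (auto simp: gen_sq_bessel2_def is_ito_integral_def)

text \<open>Progressive measurability is given for \<open>sqrt X\<close>, so the integrand is
  written with the square of that root. Fubini on \<open>{0..t}\<close> with the sigma-algebra
  \<open>F t\<close> then yields adaptedness, not merely measurability in \<open>M\<close>.\<close>

lemma integral_X_measurable:
  assumes f: "continuous_on {s..t} f" and s: "0 \<le> s" and st: "s \<le> t"
  shows "(\<lambda>\<omega>. integral {s..t} (\<lambda>u. f u * X u \<omega>)) \<in> borel_measurable (F t)"
proof -
  let ?R = "restrict_space lborel {0..t}"
  interpret R: finite_measure ?R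
    by (rule finite_measureI) (use s st in \<open>simp add: emeasure_restrict_space space_restrict_space\<close>)
  define g where "g u = indicator {s..t} u * f u" for u
  have "g \<in> borel_measurable borel"
    using borel_measurable_continuous_on_indicator[OF _ f] by (simp add: g_def[abs_def])
  then have g: "g \<in> borel_measurable (restrict_space borel {0..t})" by (rule measurable_restrict_space1)
  have sX: "(\<lambda>(u, \<omega>). sqrt (X u \<omega>)) \<in> borel_measurable (restrict_space borel {0..t} \<Otimes>\<^sub>M F t)"
    using sqrt_X_progressive s st by (auto simp: progressively_measurable_def)
  have "(\<lambda>p. g (fst p) * (case p of (u, \<omega>) \<Rightarrow> sqrt (X u \<omega>))\<^sup>2) \<in>
      borel_measurable (restrict_space borel {0..t} \<Otimes>\<^sub>M F t)"
    by (intro borel_measurable_times borel_measurable_power sX measurable_compose[OF measurable_fst g])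
  then have "(\<lambda>(u, \<omega>). g u * (sqrt (X u \<omega>))\<^sup>2) \<in> borel_measurable (restrict_space borel {0..t} \<Otimes>\<^sub>M F t)"
    by (simp add: case_prod_unfold)
  from measurable_pair_swap[OF this]
  have "(\<lambda>(\<omega>, u). g u * (sqrt (X u \<omega>))\<^sup>2) \<in> borel_measurable (F t \<Otimes>\<^sub>M restrict_space borel {0..t})"
    by simp
  also have "borel_measurable (F t \<Otimes>\<^sub>M restrict_space borel {0..t}) = borel_measurable (F t \<Otimes>\<^sub>M ?R)"
    by (intro measurable_cong_sets sets_pair_measure_cong sets_restrict_space_cong refl) simp
  finally have "(\<lambda>\<omega>. \<integral>u. g u * (sqrt (X u \<omega>))\<^sup>2 \<partial>?R) \<in> borel_measurable (F t)"
    by (rule R.borel_measurable_lebesgue_integral)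
  moreover have "(\<integral>u. g u * (sqrt (X u \<omega>))\<^sup>2 \<partial>?R) = integral {s..t} (\<lambda>u. f u * X u \<omega>)"
    if \<omega>: "\<omega> \<in> space (F t)" for \<omega>
  proof -
    have w: "\<omega> \<in> space M" using \<omega> space_F by simp
    have "continuous_on {s..t} (\<lambda>u. f u * X u \<omega>)"
      by (intro continuous_intros f X_continuous w s)
    then have "integral {s..t} (\<lambda>u. f u * X u \<omega>) = (LINT u:{s..t}|lborel. f u * X u \<omega>)"
      using set_borel_integral_eq_integral(2)[OF borel_integrable_atLeastAtMost'] by metis
    also have "\<dots> = (\<integral>u. g u * (sqrt (X u \<omega>))\<^sup>2 \<partial>?R)"
      unfolding set_lebesgue_integral_def
      by (subst integral_restrict_space, simp, rule Bochner_Integration.integral_cong[OF refl])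
        (use s X_nonneg[OF w] in \<open>auto simp: g_def indicator_def\<close>)
    finally show ?thesis by simp
  qed
  ultimately show ?thesis by (subst measurable_cong) auto
qed

lemma drift_measurable:
  assumes s: "0 \<le> s" and st: "s \<le> t"
  shows "(\<lambda>\<omega>. integral {s..t} (\<lambda>u. \<Delta> u + 2 * \<theta> u * X u \<omega>)) \<in> borel_measurable (F t)"
proof -
  have "(\<lambda>\<omega>. integral {s..t} \<Delta> + integral {s..t} (\<lambda>u. 2 * \<theta> u * X u \<omega>)) \<in> borel_measurable (F t)"
    by (intro borel_measurable_add borel_measurable_const integral_X_measurable continuous_intros \<theta>_cont' s st)
  moreover have "integral {s..t} \<Delta> + integral {s..t} (\<lambda>u. 2 * \<theta> u * X u \<omega>) =
      integral {s..t} (\<lambda>u. \<Delta> u + 2 * \<theta> u * X u \<omega>)" if "\<omega> \<in> space (F t)" for \<omega>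
    by (rule Henstock_Kurzweil_Integration.integral_add[symmetric])
      (use that space_F s in \<open>auto intro!: integrable_continuous_real continuous_intros \<Delta>_cont' \<theta>_cont' X_continuous\<close>)
  ultimately show ?thesis by (subst (asm) measurable_cong) auto
qed

text \<open>Almost surely this is twice the increment of the Ito integral. The expression through
  \<open>X\<close> and its drift is adapted by construction, whereas the version \<open>I\<close> of
  the integral is only given as measurable in \<open>M\<close>.\<close>

definition martingale_part :: "real \<Rightarrow> real \<Rightarrow> 'a \<Rightarrow> real" where
  "martingale_part s t \<omega> = X t \<omega> - X s \<omega> - integral {s..t} (\<lambda>u. \<Delta> u + 2 * \<theta> u * X u \<omega>)"

text \<open>A quarter of the quadratic variation of the martingale part over the same
  interval.\<close>

definition clock :: "real \<Rightarrow> real \<Rightarrow> 'a \<Rightarrow> real" where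
  "clock s t \<omega> = integral {s..t} (\<lambda>u. X u \<omega>)"

lemma martingale_part_measurable:
  "0 \<le> s \<Longrightarrow> s \<le> t \<Longrightarrow> martingale_part s t \<in> borel_measurable (F t)"
  unfolding martingale_part_def[abs_def]
  by (intro borel_measurable_diff X_measurable drift_measurable) auto

lemma clock_measurable: "0 \<le> s \<Longrightarrow> s \<le> t \<Longrightarrow> clock s t \<in> borel_measurable (F t)"
  unfolding clock_def[abs_def] using integral_X_measurable[of s t "\<lambda>_. 1"] by simp

lemma clock_nonneg: "\<omega> \<in> space M \<Longrightarrow> 0 \<le> s \<Longrightarrow> 0 \<le> clock s t \<omega>"
  unfolding clock_def
  by (rule integral_nonneg) (auto intro!: integrable_continuous_real X_continuous X_nonneg)

text \<open>The pairs come from simple integrands approximating \<open>sqrt X\<close>, multiplied by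
  \<open>- 2 * w\<close>. The 2 is the factor in front of the Ito integral, and its square is the 4
  in the limit of \<open>V\<close>.\<close>

lemma increment_approximation:
  fixes w :: real
  assumes s: "0 \<le> s" and st: "s \<le> t"
  shows "\<exists>S V. (\<forall>k. exponential_pair s (S k) (V k)) \<and>
    (AE \<omega> in M. (\<lambda>k. S k \<omega>) \<longlonglongrightarrow> - w * martingale_part s t \<omega>) \<and>
    (AE \<omega> in M. (\<lambda>k. V k \<omega>) \<longlonglongrightarrow> 4 * w\<^sup>2 * clock s t \<omega>)"
proof -
  have t: "0 \<le> t" using s st by simp
  obtain I where ito: "is_ito_integral M F B (\<lambda>u \<omega>. sqrt (X u \<omega>)) I"
    and sde: "AE \<omega> in M. \<forall>t\<ge>0. X t \<omega> = x + 2 * I t \<omega> + integral {0..t} (\<lambda>u. \<Delta> u + 2 * \<theta> u * X u \<omega>)"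
    using bessel by (auto simp: gen_sq_bessel2_def)
  have Im: "I u \<in> borel_measurable M" if "0 \<le> u" for u using ito that by (auto simp: is_ito_integral_def)
  obtain n \<tau> \<xi> where simple_all: "\<forall>k. simple_integrand M F (n k) (\<tau> k) (\<xi> k)"
    and lim1_all: "\<forall>T\<ge>0. \<forall>\<epsilon>>0. (\<lambda>k. measure M {\<omega>\<in>space M. ennreal \<epsilon> <
      (\<integral>\<^sup>+u\<in>{0..T}. ennreal ((simple_value (n k) (\<tau> k) (\<xi> k) u \<omega> - sqrt (X u \<omega>))\<^sup>2) \<partial>lborel)}) \<longlonglongrightarrow> 0"
    and lim2_all: "\<forall>u\<ge>0. \<forall>\<epsilon>>0. (\<lambda>k. measure M {\<omega>\<in>space M.
      \<epsilon> < \<bar>simple_integral B (n k) (\<tau> k) (\<xi> k) u \<omega> - I u \<omega>\<bar>}) \<longlonglongrightarrow> 0"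
    using ito unfolding is_ito_integral_def by (elim conjE exE) (rule that, assumption+)
  note simple = simple_all[rule_format] and lim1 = lim1_all[rule_format] and lim2 = lim2_all[rule_format]
  have \<tau>: "0 \<le> \<tau> k 0" "\<And>i. i < n k \<Longrightarrow> \<tau> k i \<le> \<tau> k (Suc i)"
    and \<xi>: "\<And>i. i < n k \<Longrightarrow> \<xi> k i \<in> borel_measurable M" for k
    using simple[of k] by (auto simp: simple_integrand_def intro: measurable_F_M)
  have \<tau>0: "i \<le> n k \<Longrightarrow> 0 \<le> \<tau> k i" for i k
  proof (induction i)
    case (Suc i)
    then show ?case using \<tau>(2)[of i k] by simp
  qed (use \<tau> in simp)
  have Bm: "B (min (\<tau> k i) u) \<in> borel_measurable M" if "i \<le> n k" "0 \<le> u" for i k u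
    using measurable_F_M[OF B_measurable[of "min (\<tau> k i) u" "min (\<tau> k i) u"]] \<tau>0[OF that(1)] that(2) by simp
  define f1 where "f1 k \<omega> = (\<integral>\<^sup>+u\<in>{0..t}. ennreal ((simple_value (n k) (\<tau> k) (\<xi> k) u \<omega> - sqrt (X u \<omega>))\<^sup>2) \<partial>lborel)" for k \<omega>
  define f2 where "f2 u k \<omega> = ennreal \<bar>simple_integral B (n k) (\<tau> k) (\<xi> k) u \<omega> - I u \<omega>\<bar>" for u k \<omega>
  have f1m: "f1 k \<in> borel_measurable M" for k
  proof -
    let ?R = "restrict_space lborel {0..t}"
    let ?Rb = "restrict_space borel {0..t} :: real measure"
    interpret R: finite_measure ?R
      by (rule finite_measureI) (use t in \<open>simp add: emeasure_restrict_space space_restrict_space\<close>)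
    have id: "(\<lambda>\<omega>. \<omega>) \<in> measurable M (F t)"
      by (rule measurableI) (use subsetD[OF sets_F] space_F in \<open>auto dest: sets.sets_into_space\<close>)
    have "(\<lambda>(u, \<omega>). sqrt (X u \<omega>)) \<in> borel_measurable (?Rb \<Otimes>\<^sub>M F t)"
      using sqrt_X_progressive t by (auto simp: progressively_measurable_def)
    moreover have "(\<lambda>p. (fst p, snd p)) \<in> measurable (?Rb \<Otimes>\<^sub>M M) (?Rb \<Otimes>\<^sub>M F t)"
      by (rule measurable_Pair[OF measurable_fst measurable_compose[OF measurable_snd id]])
    ultimately have 1: "(\<lambda>p. sqrt (X (fst p) (snd p))) \<in> borel_measurable (?Rb \<Otimes>\<^sub>M M)"
      using measurable_compose by fastforce
    have 2: "(\<lambda>p. simple_value (n k) (\<tau> k) (\<xi> k) (fst p) (snd p)) \<in> borel_measurable (?Rb \<Otimes>\<^sub>M M)"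
      unfolding simple_value_def
    proof (intro borel_measurable_sum borel_measurable_times)
      fix i assume "i \<in> {..<n k}"
      then show "(\<lambda>p. \<xi> k i (snd p)) \<in> borel_measurable (?Rb \<Otimes>\<^sub>M M)"
        by (intro measurable_compose[OF measurable_snd \<xi>]) simp
      have "indicator {\<tau> k i<..\<tau> k (Suc i)} \<in> borel_measurable ?Rb"
        by (rule measurable_restrict_space1) simp
      then show "(\<lambda>p. indicator {\<tau> k i<..\<tau> k (Suc i)} (fst p)) \<in> borel_measurable (?Rb \<Otimes>\<^sub>M M)"
        by (rule measurable_compose[OF measurable_fst])
    qed
    have "(\<lambda>p. ennreal ((simple_value (n k) (\<tau> k) (\<xi> k) (fst p) (snd p) - sqrt (X (fst p) (snd p)))\<^sup>2))
        \<in> borel_measurable (?Rb \<Otimes>\<^sub>M M)"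
      by (intro measurable_compose[OF _ measurable_ennreal] borel_measurable_power borel_measurable_diff 1 2)
    from measurable_pair_swap[OF this]
    have "(\<lambda>(\<omega>, u). ennreal ((simple_value (n k) (\<tau> k) (\<xi> k) u \<omega> - sqrt (X u \<omega>))\<^sup>2))
        \<in> borel_measurable (M \<Otimes>\<^sub>M ?Rb)" by simp
    also have "borel_measurable (M \<Otimes>\<^sub>M ?Rb) = borel_measurable (M \<Otimes>\<^sub>M ?R)"
      by (intro measurable_cong_sets sets_pair_measure_cong sets_restrict_space_cong refl) simp
    finally have "(\<lambda>\<omega>. \<integral>\<^sup>+u. ennreal ((simple_value (n k) (\<tau> k) (\<xi> k) u \<omega> - sqrt (X u \<omega>))\<^sup>2) \<partial>?R)
        \<in> borel_measurable M"
      by (rule R.borel_measurable_nn_integral)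
    then show ?thesis
      unfolding f1_def[abs_def] by (simp add: nn_integral_restrict_space)
  qed
  have f2m: "f2 u k \<in> borel_measurable M" if u: "0 \<le> u" for u k
  proof -
    have "(\<lambda>\<omega>. simple_integral B (n k) (\<tau> k) (\<xi> k) u \<omega>) \<in> borel_measurable M"
      unfolding simple_integral_def
      by (intro borel_measurable_sum borel_measurable_times borel_measurable_diff Bm \<xi>) (use u in auto)
    then show ?thesis
      unfolding f2_def[abs_def]
      by (intro measurable_compose[OF _ measurable_ennreal] borel_measurable_abs borel_measurable_diff Im[OF u])
  qed
  have lim2': "(\<lambda>k. measure M {\<omega>\<in>space M. ennreal \<epsilon> < f2 u k \<omega>}) \<longlonglongrightarrow> 0" if "0 \<le> u" "0 < \<epsilon>" for u \<epsilon>
    using lim2[OF that] that by (simp add: f2_def ennreal_less_iff)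
  \<comment> \<open>Three successive subsequences make the squared distance on \<open>{0..t}\<close>
    and the integrals at \<open>t\<close> and at \<open>s\<close> converge almost surely along the
    same indices.\<close>
  obtain r1 :: "nat \<Rightarrow> nat" where r1: "strict_mono r1" "AE \<omega> in M. (\<lambda>k. f1 (r1 k) \<omega>) \<longlonglongrightarrow> 0"
    using tendsto_in_prob_AE_subseq[of f1, OF f1m lim1[OF t, folded f1_def]] by blast
  have "(\<lambda>k. measure M {\<omega>\<in>space M. ennreal \<epsilon> < f2 t (r1 k) \<omega>}) \<longlonglongrightarrow> 0" if "0 < \<epsilon>" for \<epsilon>
    using LIMSEQ_subseq_LIMSEQ[OF lim2'[OF t that] r1(1)] by (simp add: o_def)
  then obtain r2 :: "nat \<Rightarrow> nat" where r2: "strict_mono r2" "AE \<omega> in M. (\<lambda>k. f2 t (r1 (r2 k)) \<omega>) \<longlonglongrightarrow> 0"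
    using tendsto_in_prob_AE_subseq[of "\<lambda>k. f2 t (r1 k)", OF f2m[OF t]] by blast
  have r12: "strict_mono (r1 \<circ> r2)" using r1(1) r2(1) by (rule strict_mono_o)
  have "(\<lambda>k. measure M {\<omega>\<in>space M. ennreal \<epsilon> < f2 s (r1 (r2 k)) \<omega>}) \<longlonglongrightarrow> 0" if "0 < \<epsilon>" for \<epsilon>
    using LIMSEQ_subseq_LIMSEQ[OF lim2'[OF s that] r12] by (simp add: o_def)
  then obtain r3 :: "nat \<Rightarrow> nat" where r3: "strict_mono r3" "AE \<omega> in M. (\<lambda>k. f2 s (r1 (r2 (r3 k))) \<omega>) \<longlonglongrightarrow> 0"
    using tendsto_in_prob_AE_subseq[of "\<lambda>k. f2 s (r1 (r2 k))", OF f2m[OF s]] by blast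
  define r where "r k = r1 (r2 (r3 k))" for k
  have a1: "AE \<omega> in M. (\<lambda>k. f1 (r k) \<omega>) \<longlonglongrightarrow> 0"
    using r1(2)
  proof eventually_elim
    case (elim \<omega>)
    from LIMSEQ_subseq_LIMSEQ[OF elim strict_mono_o[OF r2(1) r3(1)]] show ?case by (simp add: o_def r_def)
  qed
  have a2: "AE \<omega> in M. (\<lambda>k. f2 t (r k) \<omega>) \<longlonglongrightarrow> 0"
    using r2(2)
  proof eventually_elim
    case (elim \<omega>)
    from LIMSEQ_subseq_LIMSEQ[OF elim r3(1)] show ?case by (simp add: o_def r_def)
  qed
  have a3: "AE \<omega> in M. (\<lambda>k. f2 s (r k) \<omega>) \<longlonglongrightarrow> 0" using r3(2) by (simp add: r_def)
  have f2D: "(\<lambda>k. simple_integral B (n (r k)) (\<tau> (r k)) (\<xi> (r k)) u \<omega>) \<longlonglongrightarrow> I u \<omega>"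
    if "(\<lambda>k. f2 u (r k) \<omega>) \<longlonglongrightarrow> 0" for u \<omega>
  proof -
    have "(\<lambda>k. \<bar>simple_integral B (n (r k)) (\<tau> (r k)) (\<xi> (r k)) u \<omega> - I u \<omega>\<bar>) \<longlonglongrightarrow> 0"
      using that unfolding f2_def by (simp flip: ennreal_0 add: tendsto_ennreal_iff)
    then show ?thesis by (simp add: tendsto_rabs_zero_iff LIM_zero_iff)
  qed
  let ?S = "\<lambda>k \<omega>. (- 2 * w) * (simple_integral B (n (r k)) (\<tau> (r k)) (\<xi> (r k)) t \<omega> -
      simple_integral B (n (r k)) (\<tau> (r k)) (\<xi> (r k)) s \<omega>)"
  let ?V = "\<lambda>k \<omega>. (- 2 * w)\<^sup>2 * (LINT u:{s<..t}|lborel. (simple_value (n (r k)) (\<tau> (r k)) (\<xi> (r k)) u \<omega>)\<^sup>2)"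
  have lS: "AE \<omega> in M. (\<lambda>k. ?S k \<omega>) \<longlonglongrightarrow> - w * martingale_part s t \<omega>"
    using a2 a3 sde AE_space
  proof eventually_elim
    case (elim \<omega>)
    have "integral {0..s} (\<lambda>u. \<Delta> u + 2 * \<theta> u * X u \<omega>) + integral {s..t} (\<lambda>u. \<Delta> u + 2 * \<theta> u * X u \<omega>) =
        integral {0..t} (\<lambda>u. \<Delta> u + 2 * \<theta> u * X u \<omega>)"
      by (rule Henstock_Kurzweil_Integration.integral_combine[OF s st])
        (use elim in \<open>auto intro!: integrable_continuous_real continuous_intros \<Delta>_cont' \<theta>_cont' X_continuous\<close>)
    then have "martingale_part s t \<omega> = 2 * (I t \<omega> - I s \<omega>)"
      using elim(3) s t unfolding martingale_part_def by simp
    moreover have "(\<lambda>k. ?S k \<omega>) \<longlonglongrightarrow> (- 2 * w) * (I t \<omega> - I s \<omega>)"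
      by (intro tendsto_intros f2D elim)
    moreover have "(- 2 * w) * (I t \<omega> - I s \<omega>) = - w * (2 * (I t \<omega> - I s \<omega>))" by simp
    ultimately show ?case by (simp only:)
  qed
  have lV: "AE \<omega> in M. (\<lambda>k. ?V k \<omega>) \<longlonglongrightarrow> 4 * w\<^sup>2 * clock s t \<omega>"
    using a1 AE_space
  proof eventually_elim
    case (elim \<omega>)
    note w = elim(2)
    have cont: "continuous_on {0..t} (\<lambda>u. sqrt (X u \<omega>))"
      by (intro continuous_intros X_continuous w) simp
    have "(\<lambda>k. LINT u:{s<..t}|lborel. (simple_value (n (r k)) (\<tau> (r k)) (\<xi> (r k)) u \<omega>)\<^sup>2)
        \<longlonglongrightarrow> (LINT u:{s<..t}|lborel. (sqrt (X u \<omega>))\<^sup>2)"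
    proof (rule square_integral_tendsto[OF cont _ _ _ s st order_refl])
      show "(\<lambda>u. simple_value (n (r k)) (\<tau> (r k)) (\<xi> (r k)) u \<omega>) \<in> borel_measurable borel" for k
        unfolding simple_value_def by measurable
      show "\<exists>C. \<forall>u. \<bar>simple_value (n (r k)) (\<tau> (r k)) (\<xi> (r k)) u \<omega>\<bar> \<le> C" for k
      proof (intro exI allI)
        fix u
        show "\<bar>simple_value (n (r k)) (\<tau> (r k)) (\<xi> (r k)) u \<omega>\<bar> \<le> (\<Sum>i<n (r k). \<bar>\<xi> (r k) i \<omega>\<bar>)"
          unfolding simple_value_def
          by (rule order_trans[OF sum_abs sum_mono]) (simp add: abs_mult indicator_def)
      qed
      show "(\<lambda>k. \<integral>\<^sup>+u\<in>{0..t}. ennreal ((simple_value (n (r k)) (\<tau> (r k)) (\<xi> (r k)) u \<omega> - sqrt (X u \<omega>))\<^sup>2) \<partial>lborel)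
          \<longlonglongrightarrow> 0"
        using elim(1) by (simp add: f1_def)
    qed
    moreover have "(LINT u:{s<..t}|lborel. (sqrt (X u \<omega>))\<^sup>2) = clock s t \<omega>"
    proof -
      have "(LINT u:{s<..t}|lborel. (sqrt (X u \<omega>))\<^sup>2) = (LINT u:{s<..t}|lborel. X u \<omega>)"
        by (rule set_lebesgue_integral_cong) (use s X_nonneg[OF w] in auto)
      also have "\<dots> = (LINT u:{s..t}|lborel. X u \<omega>)"
      proof -
        have "AE u in lborel. u \<noteq> s" by (rule AE_lborel_singleton)
        moreover have si: "set_integrable lborel {s..t} (\<lambda>u. X u \<omega>)"
          by (rule borel_integrable_atLeastAtMost'[OF X_continuous[OF w s]])
        moreover have "set_integrable lborel {s<..t} (\<lambda>u. X u \<omega>)"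
          by (rule set_integrable_subset[OF si]) auto
        ultimately show ?thesis
          unfolding set_lebesgue_integral_def set_integrable_def
          by (intro integral_cong_AE) (auto simp: indicator_def elim!: eventually_mono)
      qed
      also have "\<dots> = clock s t \<omega>"
        unfolding clock_def
        by (rule set_borel_integral_eq_integral(2)[OF borel_integrable_atLeastAtMost'[OF X_continuous[OF w s]]])
      finally show ?thesis .
    qed
    ultimately have "(\<lambda>k. ?V k \<omega>) \<longlonglongrightarrow> (- 2 * w)\<^sup>2 * clock s t \<omega>"
      by (intro tendsto_intros) simp
    then show ?case by (simp add: power_mult_distrib)
  qed
  have "exponential_pair s (?S k) (?V k)" for k
    by (rule simple_exponential[OF simple s st])
  then show ?thesis using lS lV by (intro exI[of _ ?S] exI[of _ ?V] conjI allI)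
qed


section \<open>Exponentials with a weight that is constant on an interval\<close>

definition step_exponential :: "real \<Rightarrow> real \<Rightarrow> real \<Rightarrow> 'a \<Rightarrow> real" where
  "step_exponential w s t \<omega> = exp (- w * martingale_part s t \<omega> - 2 * w\<^sup>2 * clock s t \<omega>)"

lemma step_exponential_eq_exp_half:
  "step_exponential w s t \<omega> = exp (- w * martingale_part s t \<omega> - 4 * w\<^sup>2 * clock s t \<omega> / 2)"
  by (simp add: step_exponential_def)

lemma step_exponential_measurable:
  "0 \<le> s \<Longrightarrow> s \<le> t \<Longrightarrow> step_exponential w s t \<in> borel_measurable (F t)"
  unfolding step_exponential_def[abs_def]
  by (intro measurable_compose[OF _ borel_measurable_exp] borel_measurable_diff borel_measurable_times
      borel_measurable_const martingale_part_measurable clock_measurable)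

lemma step_exponential_le:
  assumes s: "0 \<le> s" and st: "s \<le> t"
    and Y: "Y \<in> borel_measurable (F s)" and Y0: "\<And>\<omega>. 0 \<le> Y \<omega>"
  shows "(\<integral>\<^sup>+\<omega>. ennreal (Y \<omega> * step_exponential w s t \<omega>) \<partial>M) \<le> (\<integral>\<^sup>+\<omega>. ennreal (Y \<omega>) \<partial>M)"
proof -
  obtain S V where ep: "\<And>k. exponential_pair s (S k) (V k)"
    and lS: "AE \<omega> in M. (\<lambda>k. S k \<omega>) \<longlonglongrightarrow> - w * martingale_part s t \<omega>"
    and lV: "AE \<omega> in M. (\<lambda>k. V k \<omega>) \<longlonglongrightarrow> 4 * w\<^sup>2 * clock s t \<omega>"
    using increment_approximation[OF s st, of w] by blast
  have Sm: "S k \<in> borel_measurable M" and Vm: "V k \<in> borel_measurable M" for k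
    using ep[of k] by (auto simp: exponential_pair_def)
  have E: "(\<integral>\<^sup>+\<omega>. Y \<omega> * ennreal (exp (S k \<omega> - V k \<omega> / 2)) \<partial>M) = (\<integral>\<^sup>+\<omega>. Y \<omega> \<partial>M)"
    if "Y \<in> borel_measurable (F s)" for k Y
    using ep[of k] that unfolding exponential_pair_def by blast
  have Ym: "Y \<in> borel_measurable M" using measurable_F_M[OF Y] .
  let ?u = "\<lambda>k \<omega>. ennreal (Y \<omega> * exp (S k \<omega> - V k \<omega> / 2))"
  have um: "?u k \<in> borel_measurable M" for k
    using Ym Sm[of k] Vm[of k] by measurable
  have "(\<integral>\<^sup>+\<omega>. ennreal (Y \<omega> * step_exponential w s t \<omega>) \<partial>M) = (\<integral>\<^sup>+\<omega>. liminf (\<lambda>k. ?u k \<omega>) \<partial>M)"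
  proof (rule nn_integral_cong_AE)
    show "AE \<omega> in M. ennreal (Y \<omega> * step_exponential w s t \<omega>) = liminf (\<lambda>k. ?u k \<omega>)"
      using lS lV
    proof eventually_elim
      case (elim \<omega>)
      have "(\<lambda>k. ?u k \<omega>) \<longlonglongrightarrow> ennreal (Y \<omega> * exp (- w * martingale_part s t \<omega> - 4 * w\<^sup>2 * clock s t \<omega> / 2))"
        by (intro tendsto_intros elim tendsto_ennrealI) simp
      from lim_imp_Liminf[OF sequentially_bot this] show ?case
        by (simp only: step_exponential_eq_exp_half)
    qed
  qed
  also have "\<dots> \<le> liminf (\<lambda>k. integral\<^sup>N M (?u k))"
    by (rule nn_integral_liminf[OF um])
  also have "integral\<^sup>N M (?u k) = (\<integral>\<^sup>+\<omega>. ennreal (Y \<omega>) \<partial>M)" for k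
    using E[of "\<lambda>\<omega>. ennreal (Y \<omega>)" k] Y Y0 by (simp add: ennreal_mult)
  then have "liminf (\<lambda>k. integral\<^sup>N M (?u k)) = (\<integral>\<^sup>+\<omega>. ennreal (Y \<omega>) \<partial>M)"
    by (simp add: Liminf_const)
  finally show ?thesis .
qed

text \<open>A second-moment argument excludes a loss of mass. The truncated variables satisfy
  \<open>E (Y * N) = E Y\<close> and \<open>E N^2 \<le> exp R\<close>, and equal the exponential
  unless \<open>V k > R\<close>. Cutting at \<open>exp (2 * R)\<close> costs about
  \<open>exp (- 2 * R) * exp R\<close>; the event \<open>V k > R\<close> costs
  \<open>exp (2 * R)\<close> times a probability, which in the limit is at most
  \<open>exp (- 3 * R)\<close> times the assumed moment. Both vanish as \<open>R\<close>
  grows.\<close>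

lemma step_exponential_ge_bounded:
  assumes s: "0 \<le> s" and st: "s \<le> t"
    and Y: "Y \<in> borel_measurable (F s)" and Y0: "\<And>\<omega>. 0 \<le> Y \<omega>" and YC: "\<And>\<omega>. Y \<omega> \<le> C"
    and K: "(\<integral>\<^sup>+\<omega>. ennreal (exp (12 * w\<^sup>2 * clock s t \<omega>)) \<partial>M) < \<infinity>"
  shows "(\<integral>\<^sup>+\<omega>. ennreal (Y \<omega>) \<partial>M) \<le> (\<integral>\<^sup>+\<omega>. ennreal (Y \<omega> * step_exponential w s t \<omega>) \<partial>M)"
proof -
  obtain S V where ep: "\<And>k. exponential_pair s (S k) (V k)"
    and lS: "AE \<omega> in M. (\<lambda>k. S k \<omega>) \<longlonglongrightarrow> - w * martingale_part s t \<omega>"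
    and lV: "AE \<omega> in M. (\<lambda>k. V k \<omega>) \<longlonglongrightarrow> 4 * w\<^sup>2 * clock s t \<omega>"
    using increment_approximation[OF s st, of w] by blast
  have Sm[measurable]: "S k \<in> borel_measurable M" and Vm[measurable]: "V k \<in> borel_measurable M" for k
    using ep[of k] by (auto simp: exponential_pair_def)
  have Ym[measurable]: "Y \<in> borel_measurable M" using measurable_F_M[OF Y] .
  have [measurable]: "step_exponential w s t \<in> borel_measurable M" "clock s t \<in> borel_measurable M"
    using measurable_F_M step_exponential_measurable[OF s st] clock_measurable[OF s st] by blast+
  have C0: "0 \<le> C" using Y0 YC order_trans by blast
  let ?EY = "\<integral>\<^sup>+\<omega>. ennreal (Y \<omega>) \<partial>M"
  let ?A = "\<integral>\<^sup>+\<omega>. ennreal (Y \<omega> * step_exponential w s t \<omega>) \<partial>M"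
  let ?K = "\<integral>\<^sup>+\<omega>. ennreal (exp (12 * w\<^sup>2 * clock s t \<omega>)) \<partial>M"
  have main: "?EY \<le> ?A + ennreal (C * exp (- R)) * ?K + ennreal (2 * C * exp (- R))" if R: "0 \<le> R" for R
  proof -
    define g where "g k \<omega> = Y \<omega> * min (exp (S k \<omega> - V k \<omega> / 2)) (exp (2 * R)) +
      C * exp (2 * R) * min 1 (exp (3 * (V k \<omega> - R)))" for k \<omega>
    define G where "G \<omega> = Y \<omega> * min (step_exponential w s t \<omega>) (exp (2 * R)) +
      C * exp (2 * R) * min 1 (exp (3 * (4 * w\<^sup>2 * clock s t \<omega> - R)))" for \<omega>
    have gm[measurable]: "g k \<in> borel_measurable M" for k unfolding g_def[abs_def] by measurable
    have Gm[measurable]: "G \<in> borel_measurable M" unfolding G_def[abs_def] by measurable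
    have g0: "0 \<le> g k \<omega>" for k \<omega> unfolding g_def using Y0 C0 by simp
    have step: "?EY \<le> (\<integral>\<^sup>+\<omega>. ennreal (g k \<omega>) \<partial>M) + ennreal (2 * C * exp (- R))" for k
    proof -
      obtain N where Nm[measurable]: "N \<in> borel_measurable M" and N0: "\<And>\<omega>. 0 \<le> N \<omega>"
        and N1: "\<And>Y. Y \<in> borel_measurable (F s) \<Longrightarrow> (\<integral>\<^sup>+\<omega>. Y \<omega> * ennreal (N \<omega>) \<partial>M) = (\<integral>\<^sup>+\<omega>. Y \<omega> \<partial>M)"
        and N2: "(\<integral>\<^sup>+\<omega>. ennreal ((N \<omega>)\<^sup>2) \<partial>M) \<le> ennreal (exp R)"
        and NV: "\<And>\<omega>. V k \<omega> \<le> R \<Longrightarrow> N \<omega> = exp (S k \<omega> - V k \<omega> / 2)"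
        using ep[of k] R unfolding exponential_pair_def by blast
      have key: "N \<omega> \<le> min (N \<omega>) (exp (2 * R)) + exp (- (2 * R)) * (N \<omega>)\<^sup>2" for \<omega>
      proof (cases "N \<omega> \<le> exp (2 * R)")
        case False
        then have "N \<omega> * exp (2 * R) \<le> N \<omega> * N \<omega>" using N0[of \<omega>] by (intro mult_left_mono) auto
        then have "N \<omega> \<le> exp (- (2 * R)) * (N \<omega>)\<^sup>2"
          by (simp add: exp_minus power2_eq_square field_simps)
        then show ?thesis using False exp_ge_zero[of "2 * R"] by (simp add: min_def add_increasing)
      qed simp
      have pt: "Y \<omega> * N \<omega> \<le> g k \<omega> + 2 * C * exp (- (2 * R)) * (N \<omega>)\<^sup>2" for \<omega>
      proof (cases "V k \<omega> \<le> R")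
        case True
        from key[of \<omega>] have "Y \<omega> * N \<omega> \<le> Y \<omega> * (min (N \<omega>) (exp (2 * R)) + exp (- (2 * R)) * (N \<omega>)\<^sup>2)"
          by (rule mult_left_mono[OF _ Y0])
        also have "\<dots> = Y \<omega> * min (N \<omega>) (exp (2 * R)) + Y \<omega> * (exp (- (2 * R)) * (N \<omega>)\<^sup>2)"
          by (simp add: distrib_left)
        also have "Y \<omega> * (exp (- (2 * R)) * (N \<omega>)\<^sup>2) \<le> C * (exp (- (2 * R)) * (N \<omega>)\<^sup>2)"
          by (rule mult_right_mono[OF YC]) simp
        also have "\<dots> \<le> 2 * C * exp (- (2 * R)) * (N \<omega>)\<^sup>2"
          using C0 by simp
        also have "Y \<omega> * min (N \<omega>) (exp (2 * R)) \<le> g k \<omega>"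
          unfolding g_def NV[OF True] using C0 by simp
        finally show ?thesis by simp
      next
        case False
        have "N \<omega> \<le> exp (- (2 * R)) * (N \<omega>)\<^sup>2 + exp (2 * R)" using key[of \<omega>] by linarith
        then have "Y \<omega> * N \<omega> \<le> C * (exp (- (2 * R)) * (N \<omega>)\<^sup>2 + exp (2 * R))"
          using Y0 YC N0 C0 by (intro mult_mono) auto
        also have "\<dots> = C * exp (2 * R) + C * exp (- (2 * R)) * (N \<omega>)\<^sup>2"
          by (simp add: algebra_simps)
        also have "\<dots> \<le> C * exp (2 * R) + 2 * C * exp (- (2 * R)) * (N \<omega>)\<^sup>2"
          using C0 by simp
        also have "C * exp (2 * R) \<le> g k \<omega>"
          unfolding g_def using False Y0[of \<omega>] by simp
        finally show ?thesis by simp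
      qed
      have "?EY = (\<integral>\<^sup>+\<omega>. ennreal (Y \<omega> * N \<omega>) \<partial>M)"
        using N1[of "\<lambda>\<omega>. ennreal (Y \<omega>)"] Y Y0 N0 by (simp add: ennreal_mult)
      also have "\<dots> \<le> (\<integral>\<^sup>+\<omega>. ennreal (g k \<omega>) + ennreal (2 * C * exp (- (2 * R))) * ennreal ((N \<omega>)\<^sup>2) \<partial>M)"
      proof (rule nn_integral_mono)
        fix \<omega>
        show "ennreal (Y \<omega> * N \<omega>) \<le> ennreal (g k \<omega>) + ennreal (2 * C * exp (- (2 * R))) * ennreal ((N \<omega>)\<^sup>2)"
          using ennreal_leI[OF pt[of \<omega>]] g0[of k \<omega>] C0 by (simp add: ennreal_plus ennreal_mult)
      qed
      also have "\<dots> = (\<integral>\<^sup>+\<omega>. ennreal (g k \<omega>) \<partial>M) + ennreal (2 * C * exp (- (2 * R))) * (\<integral>\<^sup>+\<omega>. ennreal ((N \<omega>)\<^sup>2) \<partial>M)"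
        by (simp add: nn_integral_add nn_integral_cmult)
      also have "\<dots> \<le> (\<integral>\<^sup>+\<omega>. ennreal (g k \<omega>) \<partial>M) + ennreal (2 * C * exp (- (2 * R))) * ennreal (exp R)"
        by (intro add_left_mono mult_left_mono N2) simp
      also have "ennreal (2 * C * exp (- (2 * R))) * ennreal (exp R) = ennreal (2 * C * exp (- R))"
        using C0 by (simp add: mult.assoc flip: ennreal_mult' exp_add)
      finally show ?thesis .
    qed
    have "(\<lambda>k. \<integral>\<^sup>+\<omega>. ennreal (g k \<omega>) \<partial>M) \<longlonglongrightarrow> (\<integral>\<^sup>+\<omega>. ennreal (G \<omega>) \<partial>M)"
    proof (rule nn_integral_dominated_convergence[where w = "\<lambda>_. ennreal (2 * C * exp (2 * R))"])
      show "AE \<omega> in M. ennreal (g k \<omega>) \<le> ennreal (2 * C * exp (2 * R))" for k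
      proof (rule AE_I2, rule ennreal_leI)
        fix \<omega>
        have "Y \<omega> * min (exp (S k \<omega> - V k \<omega> / 2)) (exp (2 * R)) \<le> C * exp (2 * R)"
          using Y0 YC C0 by (intro mult_mono) auto
        moreover have "C * exp (2 * R) * min 1 (exp (3 * (V k \<omega> - R))) \<le> C * exp (2 * R) * 1"
          using C0 by (intro mult_left_mono) auto
        ultimately show "g k \<omega> \<le> 2 * C * exp (2 * R)" unfolding g_def by linarith
      qed
      show "AE \<omega> in M. (\<lambda>k. ennreal (g k \<omega>)) \<longlonglongrightarrow> ennreal (G \<omega>)"
        using lS lV
      proof eventually_elim
        case (elim \<omega>)
        have "(\<lambda>k. g k \<omega>) \<longlonglongrightarrow> Y \<omega> * min (exp (- w * martingale_part s t \<omega> - 4 * w\<^sup>2 * clock s t \<omega> / 2)) (exp (2 * R)) +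
            C * exp (2 * R) * min 1 (exp (3 * (4 * w\<^sup>2 * clock s t \<omega> - R)))"
          unfolding g_def by (intro tendsto_intros elim) simp
        then show ?case by (intro tendsto_ennrealI) (simp only: G_def step_exponential_eq_exp_half)
      qed
    qed (auto simp: emeasure_space_1)
    then have "(\<lambda>k. (\<integral>\<^sup>+\<omega>. ennreal (g k \<omega>) \<partial>M) + ennreal (2 * C * exp (- R))) \<longlonglongrightarrow>
        (\<integral>\<^sup>+\<omega>. ennreal (G \<omega>) \<partial>M) + ennreal (2 * C * exp (- R))"
      by (intro tendsto_add tendsto_const)
    then have "?EY \<le> (\<integral>\<^sup>+\<omega>. ennreal (G \<omega>) \<partial>M) + ennreal (2 * C * exp (- R))"
      by (rule LIMSEQ_le_const) (use step in blast)
    also have "(\<integral>\<^sup>+\<omega>. ennreal (G \<omega>) \<partial>M) \<le> (\<integral>\<^sup>+\<omega>. ennreal (Y \<omega> * step_exponential w s t \<omega>) +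
        ennreal (C * exp (- R)) * ennreal (exp (12 * w\<^sup>2 * clock s t \<omega>)) \<partial>M)"
    proof (rule nn_integral_mono)
      fix \<omega>
      have "Y \<omega> * min (step_exponential w s t \<omega>) (exp (2 * R)) \<le> Y \<omega> * step_exponential w s t \<omega>"
        using Y0 by (intro mult_left_mono) auto
      moreover have "C * exp (2 * R) * min 1 (exp (3 * (4 * w\<^sup>2 * clock s t \<omega> - R))) \<le>
          C * exp (2 * R) * exp (3 * (4 * w\<^sup>2 * clock s t \<omega> - R))"
        using C0 by (intro mult_left_mono) auto
      \<comment> \<open>The constant 12 arises here as 3 times 4. A slope above 2 is needed to beat
        \<open>exp (2 * R)\<close>; the slope 3 leaves the factor \<open>exp (- R)\<close>.\<close>
      moreover have "C * exp (2 * R) * exp (3 * (4 * w\<^sup>2 * clock s t \<omega> - R)) = C * exp (- R) * exp (12 * w\<^sup>2 * clock s t \<omega>)"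
        by (simp add: mult.assoc algebra_simps flip: exp_add)
      ultimately have "G \<omega> \<le> Y \<omega> * step_exponential w s t \<omega> + C * exp (- R) * exp (12 * w\<^sup>2 * clock s t \<omega>)"
        unfolding G_def by linarith
      from ennreal_leI[OF this] show "ennreal (G \<omega>) \<le> ennreal (Y \<omega> * step_exponential w s t \<omega>) +
        ennreal (C * exp (- R)) * ennreal (exp (12 * w\<^sup>2 * clock s t \<omega>))"
        using C0 Y0[of \<omega>] by (simp add: ennreal_plus ennreal_mult step_exponential_def)
    qed
    also have "\<dots> = ?A + ennreal (C * exp (- R)) * ?K"
      by (simp add: nn_integral_add nn_integral_cmult)
    finally show ?thesis by (simp add: add_right_mono)
  qed
  have lim: "(\<lambda>n. exp (- real n)) \<longlonglongrightarrow> 0"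
    using LIMSEQ_power_zero[of "exp (- 1)::real"] by (simp flip: exp_of_nat_mult)
  have "(\<lambda>n. ?A + ennreal (C * exp (- real n)) * ?K + ennreal (2 * C * exp (- real n))) \<longlonglongrightarrow>
      ?A + ennreal (C * 0) * ?K + ennreal (2 * C * 0)"
  proof (intro tendsto_add tendsto_const)
    have "(\<lambda>n. ennreal (C * exp (- real n))) \<longlonglongrightarrow> ennreal (C * 0)"
      by (intro tendsto_ennrealI tendsto_intros lim)
    then show "(\<lambda>n. ennreal (C * exp (- real n)) * ?K) \<longlonglongrightarrow> ennreal (C * 0) * ?K"
      by (rule tendsto_mult_ennreal[OF _ tendsto_const]) (use K in auto)
    show "(\<lambda>n. ennreal (2 * C * exp (- real n))) \<longlonglongrightarrow> ennreal (2 * C * 0)"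
      by (intro tendsto_ennrealI tendsto_intros lim)
  qed
  from LIMSEQ_le_const[OF this, of ?EY] main show ?thesis by auto
qed

text \<open>The bounded case is applied to \<open>min Y n\<close>, and Fatou lets \<open>n\<close>
  grow. Unbounded \<open>Y\<close> must be allowed because, in products over a grid,
  \<open>Y\<close> contains the earlier exponentials.\<close>

lemma step_exponential_eq:
  assumes s: "0 \<le> s" and st: "s \<le> t"
    and Y: "Y \<in> borel_measurable (F s)" and Y0: "\<And>\<omega>. 0 \<le> Y \<omega>"
    and K: "(\<integral>\<^sup>+\<omega>. ennreal (exp (12 * w\<^sup>2 * clock s t \<omega>)) \<partial>M) < \<infinity>"
  shows "(\<integral>\<^sup>+\<omega>. ennreal (Y \<omega> * step_exponential w s t \<omega>) \<partial>M) = (\<integral>\<^sup>+\<omega>. ennreal (Y \<omega>) \<partial>M)"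
proof (rule antisym[OF step_exponential_le[OF s st Y Y0]])
  have Ym[measurable]: "Y \<in> borel_measurable M" using measurable_F_M[OF Y] .
  let ?u = "\<lambda>n \<omega>. ennreal (min (Y \<omega>) (real n))"
  have "(\<integral>\<^sup>+\<omega>. ennreal (Y \<omega>) \<partial>M) = (\<integral>\<^sup>+\<omega>. liminf (\<lambda>n. ?u n \<omega>) \<partial>M)"
  proof (rule nn_integral_cong)
    fix \<omega>
    have "\<forall>\<^sub>F n in sequentially. ?u n \<omega> = ennreal (Y \<omega>)"
      using eventually_ge_at_top[of "nat \<lceil>Y \<omega>\<rceil>"]
      by eventually_elim (simp add: min_absorb1 nat_ceiling_le_eq)
    then have "(\<lambda>n. ?u n \<omega>) \<longlonglongrightarrow> ennreal (Y \<omega>)" by (rule tendsto_eventually)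
    then show "ennreal (Y \<omega>) = liminf (\<lambda>n. ?u n \<omega>)"
      using lim_imp_Liminf[OF sequentially_bot] by fastforce
  qed
  also have "\<dots> \<le> liminf (\<lambda>n. integral\<^sup>N M (?u n))"
    by (rule nn_integral_liminf) measurable
  also have "\<dots> \<le> (\<integral>\<^sup>+\<omega>. ennreal (Y \<omega> * step_exponential w s t \<omega>) \<partial>M)"
  proof (rule Liminf_le[OF sequentially_bot always_eventually], rule allI)
    fix n
    have m: "(\<lambda>\<omega>. min (Y \<omega>) (real n)) \<in> borel_measurable (F s)" using Y by simp
    have "integral\<^sup>N M (?u n) \<le> (\<integral>\<^sup>+\<omega>. ennreal (min (Y \<omega>) (real n) * step_exponential w s t \<omega>) \<partial>M)"
      by (rule step_exponential_ge_bounded[OF s st m _ _ K, where C = "real n"]) (use Y0 in auto)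
    also have "\<dots> \<le> (\<integral>\<^sup>+\<omega>. ennreal (Y \<omega> * step_exponential w s t \<omega>) \<partial>M)"
      by (intro nn_integral_mono ennreal_leI mult_right_mono) (auto simp: step_exponential_def)
    finally show "integral\<^sup>N M (?u n) \<le> (\<integral>\<^sup>+\<omega>. ennreal (Y \<omega> * step_exponential w s t \<omega>) \<partial>M)" .
  qed
  finally show "(\<integral>\<^sup>+\<omega>. ennreal (Y \<omega>) \<partial>M) \<le> (\<integral>\<^sup>+\<omega>. ennreal (Y \<omega> * step_exponential w s t \<omega>) \<partial>M)" .
qed


text \<open>The product over earlier grid intervals is measurable at \<open>r j\<close>, so it can
  play the role of \<open>Y\<close> for the next factor.\<close>

lemma grid_product:
  fixes r v :: "nat \<Rightarrow> real"
  assumes r: "0 \<le> r 0" "\<And>i. i < n \<Longrightarrow> r i \<le> r (Suc i)"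
    and Y: "Y \<in> borel_measurable (F (r 0))" and Y0: "\<And>\<omega>. 0 \<le> Y \<omega>"
  defines "P \<equiv> \<lambda>j \<omega>. Y \<omega> * (\<Prod>i<j. step_exponential (v i) (r i) (r (Suc i)) \<omega>)"
  shows "j \<le> n \<Longrightarrow> P j \<in> borel_measurable (F (r j))"
    and "j \<le> n \<Longrightarrow> (\<integral>\<^sup>+\<omega>. ennreal (P j \<omega>) \<partial>M) \<le> (\<integral>\<^sup>+\<omega>. ennreal (Y \<omega>) \<partial>M)"
    and "j \<le> n \<Longrightarrow> (\<And>i. i < n \<Longrightarrow> (\<integral>\<^sup>+\<omega>. ennreal (exp (12 * (v i)\<^sup>2 * clock (r i) (r (Suc i)) \<omega>)) \<partial>M) < \<infinity>) \<Longrightarrow>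
      (\<integral>\<^sup>+\<omega>. ennreal (P j \<omega>) \<partial>M) = (\<integral>\<^sup>+\<omega>. ennreal (Y \<omega>) \<partial>M)"
proof -
  have r0: "0 \<le> r j" if "j \<le> n" for j
    using that
  proof (induction j)
    case (Suc j)
    then show ?case using r(2)[of j] by simp
  qed (use r in simp)
  have pos: "0 \<le> P j \<omega>" for j \<omega>
    unfolding P_def using Y0 by (intro mult_nonneg_nonneg prod_nonneg) (auto simp: step_exponential_def)
  have Suc_eq: "P (Suc j) \<omega> = P j \<omega> * step_exponential (v j) (r j) (r (Suc j)) \<omega>" for j \<omega>
    by (simp add: P_def)
  have meas: "P j \<in> borel_measurable (F (r j))" if "j \<le> n" for j
    using that
  proof (induction j)
    case (Suc j)
    have "P j \<in> borel_measurable (F (r (Suc j)))"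
      by (rule measurable_F_mono[OF Suc.IH]) (use Suc.prems r in auto)
    then show ?case
      unfolding Suc_eq[abs_def]
      by (rule borel_measurable_times) (rule step_exponential_measurable, use Suc.prems r r0[of j] in auto)
  qed (use Y in \<open>simp add: P_def\<close>)
  then show "j \<le> n \<Longrightarrow> P j \<in> borel_measurable (F (r j))" .
  show "j \<le> n \<Longrightarrow> (\<integral>\<^sup>+\<omega>. ennreal (P j \<omega>) \<partial>M) \<le> (\<integral>\<^sup>+\<omega>. ennreal (Y \<omega>) \<partial>M)"
  proof (induction j)
    case (Suc j)
    have "(\<integral>\<^sup>+\<omega>. ennreal (P (Suc j) \<omega>) \<partial>M) \<le> (\<integral>\<^sup>+\<omega>. ennreal (P j \<omega>) \<partial>M)"
      unfolding Suc_eq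
      by (rule step_exponential_le[OF _ _ meas pos]) (use Suc.prems r r0[of j] in auto)
    then show ?case using Suc by simp
  qed (simp add: P_def)
  show "j \<le> n \<Longrightarrow> (\<And>i. i < n \<Longrightarrow> (\<integral>\<^sup>+\<omega>. ennreal (exp (12 * (v i)\<^sup>2 * clock (r i) (r (Suc i)) \<omega>)) \<partial>M) < \<infinity>) \<Longrightarrow>
      (\<integral>\<^sup>+\<omega>. ennreal (P j \<omega>) \<partial>M) = (\<integral>\<^sup>+\<omega>. ennreal (Y \<omega>) \<partial>M)"
  proof (induction j)
    case (Suc j)
    have "(\<integral>\<^sup>+\<omega>. ennreal (P (Suc j) \<omega>) \<partial>M) = (\<integral>\<^sup>+\<omega>. ennreal (P j \<omega>) \<partial>M)"
      unfolding Suc_eq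
      by (rule step_exponential_eq[OF _ _ meas pos]) (use Suc.prems r r0[of j] in auto)
    then show ?case using Suc by simp
  qed (simp add: P_def)
qed

section \<open>Exponentials with a continuously differentiable weight\<close>

lemma clock_combine:
  assumes "\<omega> \<in> space M" "0 \<le> a" "a \<le> b" "b \<le> c"
  shows "clock a c \<omega> = clock a b \<omega> + clock b c \<omega>"
  unfolding clock_def
  by (rule Henstock_Kurzweil_Integration.integral_combine[symmetric])
    (use assms in \<open>auto intro!: integrable_continuous_real X_continuous\<close>)

text \<open>This is \<open>- int w dm - 2 * int w^2 X du\<close> for
  \<open>dm = dX - (\<Delta> + 2 * \<theta> * X) du\<close>, after integration by parts in
  \<open>int w dX\<close>. In this form it makes sense path by path, without a stochastic
  integral.\<close>

definition log_weighted :: "(real \<Rightarrow> real) \<Rightarrow> (real \<Rightarrow> real) \<Rightarrow> real \<Rightarrow> real \<Rightarrow> 'a \<Rightarrow> real" where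
  "log_weighted w w' a b \<omega> = w a * X a \<omega> - w b * X b \<omega> +
    integral {a..b} (\<lambda>u. (w' u + 2 * w u * \<theta> u - 2 * (w u)\<^sup>2) * X u \<omega>) + integral {a..b} (\<lambda>u. w u * \<Delta> u)"

context
  fixes w w' :: "real \<Rightarrow> real" and s t :: real
  assumes s: "0 \<le> s" and st: "s \<le> t"
    and dw: "\<And>u. u \<in> {s..t} \<Longrightarrow> (w has_real_derivative w' u) (at u within {s..t})"
    and w'_cont: "continuous_on {s..t} w'"
begin

lemma w_cont: "continuous_on {s..t} w"
  by (rule DERIV_continuous_on[OF dw])

lemma cont_sub:
  assumes "s \<le> a" "b \<le> t"
  shows "continuous_on {a..b} w" "continuous_on {a..b} w'" "continuous_on {a..b} \<theta>" "continuous_on {a..b} \<Delta>"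
    "\<omega> \<in> space M \<Longrightarrow> continuous_on {a..b} (\<lambda>u. X u \<omega>)"
  using assms s
  by (auto intro: continuous_on_subset[OF w_cont] continuous_on_subset[OF w'_cont] \<theta>_cont' \<Delta>_cont' X_continuous)

lemma log_weighted_measurable: "log_weighted w w' s t \<in> borel_measurable (F t)"
  unfolding log_weighted_def[abs_def]
  by (intro borel_measurable_add borel_measurable_diff borel_measurable_times borel_measurable_const
      X_measurable integral_X_measurable continuous_intros cont_sub) (use s st in auto)

lemma log_weighted_combine:
  assumes \<omega>: "\<omega> \<in> space M" and abc: "s \<le> a" "a \<le> b" "b \<le> c" "c \<le> t"
  shows "log_weighted w w' a c \<omega> = log_weighted w w' a b \<omega> + log_weighted w w' b c \<omega>"
proof -
  let ?f = "\<lambda>u. (w' u + 2 * w u * \<theta> u - 2 * (w u)\<^sup>2) * X u \<omega>"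
  have "integral {a..b} ?f + integral {b..c} ?f = integral {a..c} ?f"
    by (rule Henstock_Kurzweil_Integration.integral_combine[OF abc(2,3)], rule integrable_continuous_real,
        intro continuous_intros cont_sub) (use abc \<omega> in auto)
  moreover have "integral {a..b} (\<lambda>u. w u * \<Delta> u) + integral {b..c} (\<lambda>u. w u * \<Delta> u) = integral {a..c} (\<lambda>u. w u * \<Delta> u)"
    by (rule Henstock_Kurzweil_Integration.integral_combine[OF abc(2,3)], rule integrable_continuous_real,
        intro continuous_intros cont_sub) (use abc in auto)
  ultimately show ?thesis unfolding log_weighted_def by linarith
qed

text \<open>The error of freezing the weight at the left end \<open>a\<close>, written as one
  integral. Since \<open>X b * (w b - w a)\<close> is the integral of \<open>X b * w'\<close>, every
  summand of the integrand contains a difference that is small on a short interval.\<close>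

lemma log_step_error:
  assumes \<omega>: "\<omega> \<in> space M" and ab: "s \<le> a" "a \<le> b" "b \<le> t"
  shows "((\<lambda>u. w' u * (X b \<omega> - X u \<omega>) + (w a - w u) * (\<Delta> u + 2 * \<theta> u * X u \<omega>) -
      2 * ((w a)\<^sup>2 - (w u)\<^sup>2) * X u \<omega>) has_integral
    (- w a * martingale_part a b \<omega> - 2 * (w a)\<^sup>2 * clock a b \<omega> - log_weighted w w' a b \<omega>)) {a..b}"
proof -
  note sub = cont_sub[OF ab(1,3)]
  have 1: "(w' has_integral (w b - w a)) {a..b}"
  proof (rule fundamental_theorem_of_calculus[OF ab(2)])
    fix u assume "u \<in> {a..b}"
    then show "(w has_vector_derivative w' u) (at u within {a..b})"
      unfolding has_real_derivative_iff_has_vector_derivative[symmetric]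
      by (intro has_field_derivative_subset[OF dw]) (use ab in auto)
  qed
  have 2: "((\<lambda>u. \<Delta> u + 2 * \<theta> u * X u \<omega>) has_integral integral {a..b} (\<lambda>u. \<Delta> u + 2 * \<theta> u * X u \<omega>)) {a..b}"
    by (intro integrable_integral integrable_continuous_real continuous_intros sub \<omega>)
  have 3: "((\<lambda>u. X u \<omega>) has_integral clock a b \<omega>) {a..b}"
    unfolding clock_def by (intro integrable_integral integrable_continuous_real continuous_intros sub \<omega>)
  have 4: "((\<lambda>u. (w' u + 2 * w u * \<theta> u - 2 * (w u)\<^sup>2) * X u \<omega>) has_integral
      integral {a..b} (\<lambda>u. (w' u + 2 * w u * \<theta> u - 2 * (w u)\<^sup>2) * X u \<omega>)) {a..b}"
    by (intro integrable_integral integrable_continuous_real continuous_intros sub \<omega>)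
  have 5: "((\<lambda>u. w u * \<Delta> u) has_integral integral {a..b} (\<lambda>u. w u * \<Delta> u)) {a..b}"
    by (intro integrable_integral integrable_continuous_real continuous_intros sub)
  have "((\<lambda>u. X b \<omega> * w' u + w a * (\<Delta> u + 2 * \<theta> u * X u \<omega>) - 2 * (w a)\<^sup>2 * X u \<omega>
      - (w' u + 2 * w u * \<theta> u - 2 * (w u)\<^sup>2) * X u \<omega> - w u * \<Delta> u) has_integral
    (X b \<omega> * (w b - w a) + w a * integral {a..b} (\<lambda>u. \<Delta> u + 2 * \<theta> u * X u \<omega>) - 2 * (w a)\<^sup>2 * clock a b \<omega>
      - integral {a..b} (\<lambda>u. (w' u + 2 * w u * \<theta> u - 2 * (w u)\<^sup>2) * X u \<omega>) - integral {a..b} (\<lambda>u. w u * \<Delta> u))) {a..b}"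
    by (intro has_integral_diff has_integral_add has_integral_mult_right 1 2 3 4 5)
  moreover have "X b \<omega> * (w b - w a) + w a * integral {a..b} (\<lambda>u. \<Delta> u + 2 * \<theta> u * X u \<omega>) - 2 * (w a)\<^sup>2 * clock a b \<omega>
      - integral {a..b} (\<lambda>u. (w' u + 2 * w u * \<theta> u - 2 * (w u)\<^sup>2) * X u \<omega>) - integral {a..b} (\<lambda>u. w u * \<Delta> u)
      = - w a * martingale_part a b \<omega> - 2 * (w a)\<^sup>2 * clock a b \<omega> - log_weighted w w' a b \<omega>"
    by (simp add: martingale_part_def log_weighted_def algebra_simps)
  moreover have "(\<lambda>u. X b \<omega> * w' u + w a * (\<Delta> u + 2 * \<theta> u * X u \<omega>) - 2 * (w a)\<^sup>2 * X u \<omega>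
      - (w' u + 2 * w u * \<theta> u - 2 * (w u)\<^sup>2) * X u \<omega> - w u * \<Delta> u) =
    (\<lambda>u. w' u * (X b \<omega> - X u \<omega>) + (w a - w u) * (\<Delta> u + 2 * \<theta> u * X u \<omega>) - 2 * ((w a)\<^sup>2 - (w u)\<^sup>2) * X u \<omega>)"
    by (simp add: fun_eq_iff algebra_simps)
  ultimately show ?thesis by simp
qed

lemma compact_bound:
  assumes "continuous_on {s..t} (f :: real \<Rightarrow> real)"
  obtains C where "0 \<le> C" "\<And>u. u \<in> {s..t} \<Longrightarrow> \<bar>f u\<bar> \<le> C"
proof -
  have "compact (f ` {s..t})" by (rule compact_continuous_image[OF assms]) auto
  then obtain Q where "\<And>u. u \<in> {s..t} \<Longrightarrow> \<bar>f u\<bar> \<le> Q"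
    using compact_imp_bounded bounded_iff by (metis imageI real_norm_def)
  then show thesis by (intro that[of "\<bar>Q\<bar>"]) force+
qed

text \<open>The bound is proportional to \<open>b - a\<close>, so that over any fine enough grid the
  errors add up to at most \<open>e * (t - s)\<close>.\<close>

lemma log_step_error_small:
  assumes \<omega>: "\<omega> \<in> space M" and e: "0 < e"
  obtains d where "0 < d" "\<And>a b. s \<le> a \<Longrightarrow> a \<le> b \<Longrightarrow> b \<le> t \<Longrightarrow> b - a < d \<Longrightarrow>
    \<bar>- w a * martingale_part a b \<omega> - 2 * (w a)\<^sup>2 * clock a b \<omega> - log_weighted w w' a b \<omega>\<bar> \<le> e * (b - a)"
proof -
  note sub = cont_sub[OF order_refl order_refl]
  obtain C1 where C1: "0 \<le> C1" "\<And>u. u \<in> {s..t} \<Longrightarrow> \<bar>w' u\<bar> \<le> C1" using compact_bound[OF w'_cont] by blast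
  obtain C2 where C2: "0 \<le> C2" "\<And>u. u \<in> {s..t} \<Longrightarrow> \<bar>w u\<bar> \<le> C2" using compact_bound[OF w_cont] by blast
  have "continuous_on {s..t} (\<lambda>u. \<Delta> u + 2 * \<theta> u * X u \<omega>)" by (intro continuous_intros sub \<omega>)
  then obtain C3 where C3: "0 \<le> C3" "\<And>u. u \<in> {s..t} \<Longrightarrow> \<bar>\<Delta> u + 2 * \<theta> u * X u \<omega>\<bar> \<le> C3" using compact_bound by blast
  obtain C4 where C4: "0 \<le> C4" "\<And>u. u \<in> {s..t} \<Longrightarrow> \<bar>X u \<omega>\<bar> \<le> C4" using compact_bound[OF sub(5)[OF \<omega>]] by blast
  \<comment> \<open>The sum of the bounds that multiply the modulus \<open>e / c\<close> in the
    three summands; the added 1 keeps \<open>c\<close> positive.\<close>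
  define c where "c = C1 + C3 + 4 * C2 * C4 + 1"
  have c: "0 < c" unfolding c_def using C1 C2 C3 C4 by (simp add: add_nonneg_pos)
  have "uniformly_continuous_on {s..t} w" "uniformly_continuous_on {s..t} (\<lambda>u. X u \<omega>)"
    using w_cont sub(5)[OF \<omega>] by (auto intro: compact_uniformly_continuous)
  then obtain d1 d2 where d1: "0 < d1" "\<And>u v. u \<in> {s..t} \<Longrightarrow> v \<in> {s..t} \<Longrightarrow> \<bar>v - u\<bar> < d1 \<Longrightarrow> \<bar>w v - w u\<bar> < e / c"
    and d2: "0 < d2" "\<And>u v. u \<in> {s..t} \<Longrightarrow> v \<in> {s..t} \<Longrightarrow> \<bar>v - u\<bar> < d2 \<Longrightarrow> \<bar>X v \<omega> - X u \<omega>\<bar> < e / c"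
    unfolding uniformly_continuous_on_def dist_real_def using e c by (metis divide_pos_pos)
  show thesis
  proof (rule that)
    show "0 < min d1 d2" using d1 d2 by simp
    fix a b assume ab: "s \<le> a" "a \<le> b" "b \<le> t" "b - a < min d1 d2"
    have bd: "\<bar>w' u * (X b \<omega> - X u \<omega>) + (w a - w u) * (\<Delta> u + 2 * \<theta> u * X u \<omega>) - 2 * ((w a)\<^sup>2 - (w u)\<^sup>2) * X u \<omega>\<bar> \<le> e"
      if u: "u \<in> {a..b}" for u
    proof -
      have us: "u \<in> {s..t}" "a \<in> {s..t}" "b \<in> {s..t}" using u ab by auto
      have x: "\<bar>X b \<omega> - X u \<omega>\<bar> \<le> e / c" using d2(2)[of u b] us u ab by (simp add: less_imp_le)
      have y: "\<bar>w a - w u\<bar> \<le> e / c" using d1(2)[of u a] us u ab by (simp add: less_imp_le)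
      have "\<bar>w' u * (X b \<omega> - X u \<omega>)\<bar> \<le> C1 * (e / c)"
        unfolding abs_mult using C1 us x by (intro mult_mono) auto
      moreover have "\<bar>(w a - w u) * (\<Delta> u + 2 * \<theta> u * X u \<omega>)\<bar> \<le> (e / c) * C3"
        unfolding abs_mult using C3 us y e c by (intro mult_mono) auto
      moreover have "\<bar>2 * ((w a)\<^sup>2 - (w u)\<^sup>2) * X u \<omega>\<bar> \<le> 2 * ((e / c) * (2 * C2)) * C4"
      proof -
        have "(w a)\<^sup>2 - (w u)\<^sup>2 = (w a - w u) * (w a + w u)" by (simp add: power2_eq_square algebra_simps)
        moreover have "\<bar>w a + w u\<bar> \<le> 2 * C2" using C2(2)[OF us(1)] C2(2)[OF us(2)] by linarith
        ultimately have "\<bar>(w a)\<^sup>2 - (w u)\<^sup>2\<bar> \<le> (e / c) * (2 * C2)"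
          using y e c by (simp only: abs_mult) (intro mult_mono, auto)
        then show ?thesis
          unfolding abs_mult using C4 us e c C2 by (intro mult_mono) auto
      qed
      ultimately have "\<bar>w' u * (X b \<omega> - X u \<omega>) + (w a - w u) * (\<Delta> u + 2 * \<theta> u * X u \<omega>) - 2 * ((w a)\<^sup>2 - (w u)\<^sup>2) * X u \<omega>\<bar>
          \<le> C1 * (e / c) + (e / c) * C3 + 2 * ((e / c) * (2 * C2)) * C4" by linarith
      also have "\<dots> = (c - 1) * (e / c)"
      proof -
        have "C1 * k + k * C3 + 2 * (k * (2 * C2)) * C4 = (C1 + C3 + 4 * C2 * C4) * k" for k
          by (simp add: algebra_simps)
        then show ?thesis by (simp only: c_def) simp
      qed
      also have "\<dots> \<le> c * (e / c)" using e c by (intro mult_right_mono) auto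
      finally show ?thesis using c by simp
    qed
    have "norm (- w a * martingale_part a b \<omega> - 2 * (w a)\<^sup>2 * clock a b \<omega> - log_weighted w w' a b \<omega>) \<le>
        e * Henstock_Kurzweil_Integration.content (cbox a b)"
      by (rule has_integral_bound[OF less_imp_le[OF e]], unfold cbox_interval, rule log_step_error[OF \<omega> ab(1-3)])
        (use bd in simp)
    then show "\<bar>- w a * martingale_part a b \<omega> - 2 * (w a)\<^sup>2 * clock a b \<omega> - log_weighted w w' a b \<omega>\<bar> \<le> e * (b - a)"
      using ab by simp
  qed
qed

text \<open>There are \<open>Suc m\<close> intervals rather than \<open>m\<close>, so that the mesh
  is meaningful for every \<open>m\<close>.\<close>

definition grid :: "nat \<Rightarrow> nat \<Rightarrow> real" where
  "grid m i = s + real i * ((t - s) / real (Suc m))"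

lemma grid_0: "grid m 0 = s"
  by (simp add: grid_def)

lemma grid_end: "grid m (Suc m) = t"
proof -
  have "real (Suc m) * ((t - s) / real (Suc m)) = t - s" by (simp del: of_nat_Suc)
  then show ?thesis by (simp only: grid_def)
qed

lemma grid_Suc: "grid m (Suc i) - grid m i = (t - s) / real (Suc m)"
proof -
  have "real (Suc i) * h = h + real i * h" for h :: real by (simp add: algebra_simps)
  then show ?thesis by (simp only: grid_def)
qed

lemma grid_le_Suc: "grid m i \<le> grid m (Suc i)"
proof -
  have "0 \<le> (t - s) / real (Suc m)" using st by simp
  then show ?thesis using grid_Suc[of m i] by linarith
qed

lemma grid_le: "i \<le> j \<Longrightarrow> grid m i \<le> grid m j"
  by (rule lift_Suc_mono_le[of "grid m"]) (rule grid_le_Suc)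

lemma grid_bounds: "i \<le> Suc m \<Longrightarrow> s \<le> grid m i" "i \<le> Suc m \<Longrightarrow> grid m i \<le> t"
  using grid_le[of 0 i m] grid_le[of i "Suc m" m] by (auto simp: grid_0 grid_end)

text \<open>The scale \<open>c\<close> is 1 for the approximation itself and 4 for the bound on its
  second moment.\<close>

definition grid_exponential_product :: "real \<Rightarrow> nat \<Rightarrow> 'a \<Rightarrow> real" where
  "grid_exponential_product c m \<omega> = (\<Prod>i<Suc m. step_exponential (c * w (grid m i)) (grid m i) (grid m (Suc i)) \<omega>)"

text \<open>The logarithm of the product differs from \<open>log_weighted\<close>, which is additive
  over the grid, by the accumulated freezing errors. The convergence holds for every path and needs
  no subsequence.\<close>

lemma grid_exponential_product_tendsto:
  assumes \<omega>: "\<omega> \<in> space M"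
  shows "(\<lambda>m. grid_exponential_product 1 m \<omega>) \<longlonglongrightarrow> exp (log_weighted w w' s t \<omega>)"
proof -
  let ?q = "\<lambda>a b. - w a * martingale_part a b \<omega> - 2 * (w a)\<^sup>2 * clock a b \<omega>"
  let ?S = "\<lambda>m. \<Sum>i<Suc m. ?q (grid m i) (grid m (Suc i))"
  have tele: "j \<le> Suc m \<Longrightarrow> (\<Sum>i<j. log_weighted w w' (grid m i) (grid m (Suc i)) \<omega>) = log_weighted w w' s (grid m j) \<omega>" for j m
  proof (induction j)
    case 0
    show ?case by (simp add: grid_0 log_weighted_def)
  next
    case (Suc j)
    then show ?case
      using log_weighted_combine[OF \<omega> order_refl, of "grid m j" "grid m (Suc j)"]
        grid_bounds[of j m] grid_bounds[of "Suc j" m] grid_le_Suc[of m j] by simp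
  qed
  have "?S \<longlonglongrightarrow> log_weighted w w' s t \<omega>"
  proof (rule LIMSEQ_I)
    fix e :: real assume e: "0 < e"
    define e' where "e' = e / (t - s + 1)"
    have e': "0 < e'" using e st by (simp add: e'_def)
    obtain d where d: "0 < d" "\<And>a b. s \<le> a \<Longrightarrow> a \<le> b \<Longrightarrow> b \<le> t \<Longrightarrow> b - a < d \<Longrightarrow>
        \<bar>?q a b - log_weighted w w' a b \<omega>\<bar> \<le> e' * (b - a)"
      using log_step_error_small[OF \<omega> e'] by blast
    have "(\<lambda>m. (t - s) / real (Suc m)) \<longlonglongrightarrow> 0"
      using LIMSEQ_Suc[OF lim_const_over_n[of "t - s"]] by simp
    from order_tendstoD(2)[OF this d(1)] obtain m0 where m0: "\<And>m. m0 \<le> m \<Longrightarrow> (t - s) / real (Suc m) < d"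
      by (auto simp: eventually_sequentially)
    show "\<exists>m0. \<forall>m\<ge>m0. norm (?S m - log_weighted w w' s t \<omega>) < e"
    proof (intro exI[of _ m0] allI impI)
      fix m assume m: "m0 \<le> m"
      have eq: "?S m - log_weighted w w' s t \<omega> =
          (\<Sum>i<Suc m. ?q (grid m i) (grid m (Suc i)) - log_weighted w w' (grid m i) (grid m (Suc i)) \<omega>)"
        using tele[of "Suc m" m] by (simp only: sum_subtractf grid_end order_refl)
      have "\<bar>?S m - log_weighted w w' s t \<omega>\<bar> \<le> (\<Sum>i<Suc m. e' * (grid m (Suc i) - grid m i))"
        unfolding eq
      proof (rule order_trans[OF sum_abs sum_mono])
        fix i assume "i \<in> {..<Suc m}"
        then show "\<bar>?q (grid m i) (grid m (Suc i)) - log_weighted w w' (grid m i) (grid m (Suc i)) \<omega>\<bar>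
            \<le> e' * (grid m (Suc i) - grid m i)"
          using d(2)[of "grid m i" "grid m (Suc i)"] grid_bounds[of i m] grid_bounds[of "Suc i" m]
            grid_le_Suc[of m i] m0[OF m] grid_Suc[of m i] by simp
      qed
      also have "\<dots> = e' * (\<Sum>i<Suc m. grid m (Suc i) - grid m i)" by (rule sum_distrib_left[symmetric])
      also have "\<dots> = e' * (t - s)" by (simp only: sum_lessThan_telescope grid_0 grid_end)
      also have "\<dots> < e" using e st by (simp add: e'_def field_simps)
      finally show "norm (?S m - log_weighted w w' s t \<omega>) < e" by simp
    qed
  qed
  then have "(\<lambda>m. exp (?S m)) \<longlonglongrightarrow> exp (log_weighted w w' s t \<omega>)" by (rule tendsto_exp)
  moreover have "exp (?S m) = grid_exponential_product 1 m \<omega>" for m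
    by (simp only: exp_sum[OF finite_lessThan] grid_exponential_product_def step_exponential_def mult_1)
  ultimately show ?thesis by simp
qed

lemma grid_exponential_product_nonneg: "0 \<le> grid_exponential_product c m \<omega>"
  unfolding grid_exponential_product_def step_exponential_def by (intro prod_nonneg) simp

lemma grid_exponential_product_measurable: "grid_exponential_product c m \<in> borel_measurable M"
  using measurable_F_M[OF grid_product(1)[of "grid m" "Suc m" "\<lambda>_. 1" "Suc m"]] grid_0[of m] grid_le_Suc s
  by (simp add: grid_exponential_product_def[abs_def])

lemma weighted_exponential_le:
  assumes Y: "Y \<in> borel_measurable (F s)" and Y0: "\<And>\<omega>. 0 \<le> Y \<omega>"
  shows "(\<integral>\<^sup>+\<omega>. ennreal (Y \<omega> * exp (log_weighted w w' s t \<omega>)) \<partial>M) \<le> (\<integral>\<^sup>+\<omega>. ennreal (Y \<omega>) \<partial>M)"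
proof -
  let ?u = "\<lambda>m \<omega>. ennreal (Y \<omega> * grid_exponential_product 1 m \<omega>)"
  have "(\<integral>\<^sup>+\<omega>. ennreal (Y \<omega> * exp (log_weighted w w' s t \<omega>)) \<partial>M) = (\<integral>\<^sup>+\<omega>. liminf (\<lambda>m. ?u m \<omega>) \<partial>M)"
  proof (rule nn_integral_cong)
    fix \<omega> assume \<omega>: "\<omega> \<in> space M"
    have "(\<lambda>m. ?u m \<omega>) \<longlonglongrightarrow> ennreal (Y \<omega> * exp (log_weighted w w' s t \<omega>))"
      by (intro tendsto_ennrealI tendsto_mult tendsto_const grid_exponential_product_tendsto \<omega>)
    from lim_imp_Liminf[OF sequentially_bot this]
    show "ennreal (Y \<omega> * exp (log_weighted w w' s t \<omega>)) = liminf (\<lambda>m. ?u m \<omega>)" ..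
  qed
  also have "\<dots> \<le> liminf (\<lambda>m. integral\<^sup>N M (?u m))"
    by (rule nn_integral_liminf)
      (use measurable_F_M[OF Y] grid_exponential_product_measurable in measurable)
  also have "\<dots> \<le> (\<integral>\<^sup>+\<omega>. ennreal (Y \<omega>) \<partial>M)"
  proof (rule Liminf_le[OF sequentially_bot always_eventually], rule allI)
    fix m
    show "integral\<^sup>N M (?u m) \<le> (\<integral>\<^sup>+\<omega>. ennreal (Y \<omega>) \<partial>M)"
      unfolding grid_exponential_product_def
      by (rule grid_product(2)[OF _ _ _ Y0 order_refl]) (use grid_0[of m] grid_le_Suc s Y in auto)
  qed
  finally show ?thesis .
qed

text \<open>Each grid product preserves the expectation of \<open>Y\<close>. A bound on the second
  moments that does not depend on \<open>m\<close> gives uniform integrability, so the equality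
  survives the refinement of the grid.\<close>

lemma weighted_exponential_eq:
  assumes Y: "Y \<in> borel_measurable (F s)" and Y0: "\<And>\<omega>. 0 \<le> Y \<omega>" and YC: "\<And>\<omega>. \<omega> \<in> space M \<Longrightarrow> Y \<omega> \<le> C"
    and W: "\<And>u. u \<in> {s..t} \<Longrightarrow> \<bar>w u\<bar> \<le> W"
    and K: "(\<integral>\<^sup>+\<omega>. ennreal (exp (24 * W\<^sup>2 * clock s t \<omega>)) \<partial>M) < \<infinity>"
  shows "(\<integral>\<^sup>+\<omega>. ennreal (Y \<omega> * exp (log_weighted w w' s t \<omega>)) \<partial>M) = (\<integral>\<^sup>+\<omega>. ennreal (Y \<omega>) \<partial>M)"
proof (rule antisym[OF weighted_exponential_le[OF Y Y0]])
  let ?P = "\<lambda>m \<omega>. grid_exponential_product 1 m \<omega>"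
  let ?K = "\<integral>\<^sup>+\<omega>. ennreal (exp (24 * W\<^sup>2 * clock s t \<omega>)) \<partial>M"
  let ?EY = "\<integral>\<^sup>+\<omega>. ennreal (Y \<omega>) \<partial>M"
  let ?A = "\<integral>\<^sup>+\<omega>. ennreal (Y \<omega> * exp (log_weighted w w' s t \<omega>)) \<partial>M"
  have [measurable]: "Y \<in> borel_measurable M" "log_weighted w w' s t \<in> borel_measurable M"
    "clock s t \<in> borel_measurable M"
    using measurable_F_M[OF Y] measurable_F_M[OF log_weighted_measurable] measurable_F_M[OF clock_measurable[OF s st]] by auto
  have Pm[measurable]: "grid_exponential_product c m \<in> borel_measurable M" for c m
    by (rule grid_exponential_product_measurable)
  obtain \<omega>0 where "\<omega>0 \<in> space M" using not_empty by blast
  then have C0: "0 \<le> C" using Y0 YC order_trans by blast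
  have w2: "(w u)\<^sup>2 \<le> W\<^sup>2" if "u \<in> {s..t}" for u
    using power_mono[OF W[OF that] abs_ge_zero, of 2] by simp
  have clock_part: "(\<Sum>i<Suc m. (w (grid m i))\<^sup>2 * clock (grid m i) (grid m (Suc i)) \<omega>) \<le> W\<^sup>2 * clock s t \<omega>"
    if \<omega>: "\<omega> \<in> space M" for m \<omega>
  proof -
    have tele: "j \<le> Suc m \<Longrightarrow> (\<Sum>i<j. clock (grid m i) (grid m (Suc i)) \<omega>) = clock s (grid m j) \<omega>" for j
    proof (induction j)
      case 0
      show ?case by (simp add: grid_0 clock_def)
    next
      case (Suc j)
      then show ?case
        using clock_combine[OF \<omega> s, of "grid m j" "grid m (Suc j)"] grid_bounds[of j m] grid_le_Suc[of m j] by simp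
    qed
    have "(\<Sum>i<Suc m. (w (grid m i))\<^sup>2 * clock (grid m i) (grid m (Suc i)) \<omega>) \<le>
        (\<Sum>i<Suc m. W\<^sup>2 * clock (grid m i) (grid m (Suc i)) \<omega>)"
      by (intro sum_mono mult_right_mono w2 clock_nonneg \<omega>)
        (use grid_bounds[of _ m] s in \<open>auto intro: order_trans[OF s]\<close>)
    also have "\<dots> = W\<^sup>2 * (\<Sum>i<Suc m. clock (grid m i) (grid m (Suc i)) \<omega>)" by (rule sum_distrib_left[symmetric])
    also have "\<dots> = W\<^sup>2 * clock s t \<omega>" using tele[of "Suc m"] by (simp only: grid_end order_refl)
    finally show ?thesis .
  qed
  have PY: "(\<integral>\<^sup>+\<omega>. ennreal (Y \<omega> * ?P m \<omega>) \<partial>M) = ?EY" for m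
    unfolding grid_exponential_product_def
  proof (rule grid_product(3)[OF _ _ _ Y0 order_refl])
    fix i assume i: "i < Suc m"
    \<comment> \<open>The condition with 12 on a single grid interval follows from the one with 24
      on \<open>{s..t}\<close>, as one nonnegative summand is at most the whole sum.\<close>
    have "(\<integral>\<^sup>+\<omega>. ennreal (exp (12 * (1 * w (grid m i))\<^sup>2 * clock (grid m i) (grid m (Suc i)) \<omega>)) \<partial>M) \<le> ?K"
    proof (rule nn_integral_mono, rule ennreal_leI)
      fix \<omega> assume \<omega>: "\<omega> \<in> space M"
      have "(w (grid m i))\<^sup>2 * clock (grid m i) (grid m (Suc i)) \<omega> \<le>
          (\<Sum>i<Suc m. (w (grid m i))\<^sup>2 * clock (grid m i) (grid m (Suc i)) \<omega>)"
      proof (rule member_le_sum)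
        fix j assume "j \<in> {..<Suc m} - {i}"
        then show "0 \<le> (w (grid m j))\<^sup>2 * clock (grid m j) (grid m (Suc j)) \<omega>"
          using clock_nonneg[OF \<omega>, of "grid m j"] grid_bounds(1)[of j m] s by simp
      qed (use i in auto)
      also have "\<dots> \<le> W\<^sup>2 * clock s t \<omega>" by (rule clock_part[OF \<omega>])
      finally have le: "(w (grid m i))\<^sup>2 * clock (grid m i) (grid m (Suc i)) \<omega> \<le> W\<^sup>2 * clock s t \<omega>" .
      have "0 \<le> W\<^sup>2 * clock s t \<omega>" using clock_nonneg[OF \<omega> s] by simp
      with le have "12 * ((w (grid m i))\<^sup>2 * clock (grid m i) (grid m (Suc i)) \<omega>) \<le> 24 * (W\<^sup>2 * clock s t \<omega>)"
        by linarith
      then show "exp (12 * (1 * w (grid m i))\<^sup>2 * clock (grid m i) (grid m (Suc i)) \<omega>) \<le> exp (24 * W\<^sup>2 * clock s t \<omega>)"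
        by (simp add: mult.assoc)
    qed
    then show "(\<integral>\<^sup>+\<omega>. ennreal (exp (12 * (1 * w (grid m i))\<^sup>2 * clock (grid m i) (grid m (Suc i)) \<omega>)) \<partial>M) < \<infinity>"
      using K by (rule le_less_trans)
  qed (use grid_0[of m] grid_le_Suc s Y in auto)
  have P2: "(\<integral>\<^sup>+\<omega>. ennreal ((?P m \<omega>)\<^sup>2) \<partial>M) \<le> 1 + ?K" for m
  proof -
    have "(\<integral>\<^sup>+\<omega>. ennreal ((?P m \<omega>)\<^sup>2) \<partial>M) \<le>
        (\<integral>\<^sup>+\<omega>. ennreal (grid_exponential_product 4 m \<omega>) + ennreal (exp (24 * W\<^sup>2 * clock s t \<omega>)) \<partial>M)"
    proof (rule nn_integral_mono)
      fix \<omega> assume \<omega>: "\<omega> \<in> space M"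
      define L where "L = (\<Sum>i<Suc m. - w (grid m i) * martingale_part (grid m i) (grid m (Suc i)) \<omega>)"
      define Q where "Q = (\<Sum>i<Suc m. (w (grid m i))\<^sup>2 * clock (grid m i) (grid m (Suc i)) \<omega>)"
      have Pc: "grid_exponential_product c m \<omega> = exp (c * L - 2 * c\<^sup>2 * Q)" for c
        unfolding grid_exponential_product_def step_exponential_def L_def Q_def exp_sum[OF finite_lessThan, symmetric]
          sum_distrib_left sum_subtractf[symmetric]
        by (rule arg_cong[of _ _ exp], rule sum.cong) (auto simp: power_mult_distrib algebra_simps)
      \<comment> \<open>The product is \<open>exp (L - 2 * Q)\<close>. Splitting
        \<open>2 * L - 4 * Q\<close> into \<open>2 * L - 16 * Q\<close> and \<open>12 * Q\<close>
        makes the first factor squared \<open>exp (4 * L - 32 * Q)\<close>, the product of scale 4,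
        with expectation at most 1. The second factor squared is \<open>exp (24 * Q)\<close>, the
        origin of the 24.\<close>
      have "(?P m \<omega>)\<^sup>2 = exp ((2 * L - 16 * Q)) * exp (12 * Q)"
        by (simp add: Pc flip: exp_double exp_add)
      also have "\<dots> \<le> (exp (2 * L - 16 * Q))\<^sup>2 + (exp (12 * Q))\<^sup>2"
      proof -
        have "0 \<le> exp (2 * L - 16 * Q) * exp (12 * Q)" by simp
        then show ?thesis using sum_squares_bound[of "exp (2 * L - 16 * Q)" "exp (12 * Q)"] by linarith
      qed
      also have "\<dots> = grid_exponential_product 4 m \<omega> + exp (24 * Q)"
        by (simp add: Pc flip: exp_double)
      also have "\<dots> \<le> grid_exponential_product 4 m \<omega> + exp (24 * W\<^sup>2 * clock s t \<omega>)"
        using clock_part[OF \<omega>, of m] by (simp add: Q_def)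
      finally show "ennreal ((?P m \<omega>)\<^sup>2) \<le> ennreal (grid_exponential_product 4 m \<omega>) + ennreal (exp (24 * W\<^sup>2 * clock s t \<omega>))"
        using ennreal_leI grid_exponential_product_nonneg[of 4 m \<omega>] by (simp flip: ennreal_plus)
    qed
    also have "\<dots> = (\<integral>\<^sup>+\<omega>. ennreal (1 * grid_exponential_product 4 m \<omega>) \<partial>M) + ?K"
      by (simp add: nn_integral_add)
    also have "(\<integral>\<^sup>+\<omega>. ennreal (1 * grid_exponential_product 4 m \<omega>) \<partial>M) \<le> (\<integral>\<^sup>+\<omega>. ennreal 1 \<partial>M)"
      unfolding grid_exponential_product_def
      by (rule grid_product(2)[OF _ _ _ _ order_refl]) (use grid_0[of m] grid_le_Suc s in auto)
    finally show ?thesis by (simp add: emeasure_space_1 add_right_mono)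
  qed
  have main: "?EY \<le> ?A + ennreal (C * (1 / real (Suc n))) * (1 + ?K)" for n
  proof -
    define N where "N = real (Suc n)"
    have N: "0 < N" by (simp add: N_def)
    let ?I = "\<lambda>m. \<integral>\<^sup>+\<omega>. ennreal (Y \<omega> * min (?P m \<omega>) N) \<partial>M"
    have step: "?EY \<le> ?I m + ennreal (C * (1 / N)) * (1 + ?K)" for m
    proof -
      have "?EY \<le> (\<integral>\<^sup>+\<omega>. ennreal (Y \<omega> * min (?P m \<omega>) N) + ennreal (C * (1 / N)) * ennreal ((?P m \<omega>)\<^sup>2) \<partial>M)"
        unfolding PY[of m, symmetric]
      proof (rule nn_integral_mono)
        fix \<omega> assume \<omega>: "\<omega> \<in> space M"
        let ?p = "?P m \<omega>"
        have p0: "0 \<le> ?p" by (rule grid_exponential_product_nonneg)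
        \<comment> \<open>Where \<open>?p > N\<close>, the quadratic term alone exceeds
          \<open>?p\<close>, so the second moment pays for the truncation, with a factor
          \<open>1 / N\<close>.\<close>
        have "?p \<le> min ?p N + 1 / N * ?p\<^sup>2"
        proof (cases "?p \<le> N")
          case False
          then have "?p * N \<le> ?p * ?p" using p0 by (intro mult_left_mono) auto
          then have "?p \<le> 1 / N * ?p\<^sup>2" using N by (simp add: power2_eq_square field_simps)
          then show ?thesis using False N by (simp add: min_def)
        qed (use N in simp)
        then have "Y \<omega> * ?p \<le> Y \<omega> * (min ?p N + 1 / N * ?p\<^sup>2)" by (rule mult_left_mono[OF _ Y0])
        also have "\<dots> = Y \<omega> * min ?p N + Y \<omega> * (1 / N * ?p\<^sup>2)" by (simp add: distrib_left)
        also have "Y \<omega> * (1 / N * ?p\<^sup>2) \<le> C * (1 / N * ?p\<^sup>2)"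
          by (rule mult_right_mono[OF YC[OF \<omega>]]) (use N in simp)
        finally have "Y \<omega> * ?p \<le> Y \<omega> * min ?p N + (C * (1 / N)) * ?p\<^sup>2" by (simp add: mult.assoc)
        then have "ennreal (Y \<omega> * ?p) \<le> ennreal (Y \<omega> * min ?p N + (C * (1 / N)) * ?p\<^sup>2)" by (rule ennreal_leI)
        also have "\<dots> = ennreal (Y \<omega> * min ?p N) + ennreal ((C * (1 / N)) * ?p\<^sup>2)"
          using C0 N Y0[of \<omega>] p0 by (intro ennreal_plus) auto
        also have "ennreal ((C * (1 / N)) * ?p\<^sup>2) = ennreal (C * (1 / N)) * ennreal (?p\<^sup>2)"
          using C0 N by (intro ennreal_mult) auto
        finally show "ennreal (Y \<omega> * ?p) \<le> ennreal (Y \<omega> * min ?p N) + ennreal (C * (1 / N)) * ennreal (?p\<^sup>2)" .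
      qed
      also have "\<dots> = ?I m + ennreal (C * (1 / N)) * (\<integral>\<^sup>+\<omega>. ennreal ((?P m \<omega>)\<^sup>2) \<partial>M)"
        by (simp add: nn_integral_add nn_integral_cmult)
      also have "\<dots> \<le> ?I m + ennreal (C * (1 / N)) * (1 + ?K)"
        by (intro add_left_mono mult_left_mono P2) simp
      finally show ?thesis .
    qed
    have "?I \<longlonglongrightarrow>
        (\<integral>\<^sup>+\<omega>. ennreal (Y \<omega> * min (exp (log_weighted w w' s t \<omega>)) N) \<partial>M)"
    proof (rule nn_integral_dominated_convergence[where w = "\<lambda>_. ennreal (C * N)"])
      show "AE \<omega> in M. ennreal (Y \<omega> * min (?P m \<omega>) N) \<le> ennreal (C * N)" for m
        by (rule AE_I2, rule ennreal_leI, rule mult_mono)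
          (use YC C0 N grid_exponential_product_nonneg[of 1 m] in auto)
      show "AE \<omega> in M. (\<lambda>m. ennreal (Y \<omega> * min (?P m \<omega>) N)) \<longlonglongrightarrow> ennreal (Y \<omega> * min (exp (log_weighted w w' s t \<omega>)) N)"
        by (rule AE_I2) (intro tendsto_ennrealI tendsto_intros grid_exponential_product_tendsto)
    qed (auto simp: emeasure_space_1 ennreal_mult_less_top)
    then have "(\<lambda>m. ?I m + ennreal (C * (1 / N)) * (1 + ?K)) \<longlonglongrightarrow>
        (\<integral>\<^sup>+\<omega>. ennreal (Y \<omega> * min (exp (log_weighted w w' s t \<omega>)) N) \<partial>M) + ennreal (C * (1 / N)) * (1 + ?K)"
      by (intro tendsto_add tendsto_const)
    then have "?EY \<le> (\<integral>\<^sup>+\<omega>. ennreal (Y \<omega> * min (exp (log_weighted w w' s t \<omega>)) N) \<partial>M) + ennreal (C * (1 / N)) * (1 + ?K)"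
      by (rule LIMSEQ_le_const) (use step in blast)
    also have "\<dots> \<le> ?A + ennreal (C * (1 / N)) * (1 + ?K)"
      by (intro add_right_mono nn_integral_mono ennreal_leI mult_left_mono Y0) auto
    finally show ?thesis by (simp add: N_def)
  qed
  have "(\<lambda>n. ?A + ennreal (C * (1 / real (Suc n))) * (1 + ?K)) \<longlonglongrightarrow> ?A + ennreal (C * 0) * (1 + ?K)"
  proof (intro tendsto_add tendsto_const)
    have "(\<lambda>n. ennreal (C * (1 / real (Suc n)))) \<longlonglongrightarrow> ennreal (C * 0)"
      by (intro tendsto_ennrealI tendsto_intros LIMSEQ_Suc[OF lim_1_over_n])
    then show "(\<lambda>n. ennreal (C * (1 / real (Suc n))) * (1 + ?K)) \<longlonglongrightarrow> ennreal (C * 0) * (1 + ?K)"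
      by (rule tendsto_mult_ennreal[OF _ tendsto_const]) (use K in auto)
  qed
  from LIMSEQ_le_const[OF this, of ?EY] main show "?EY \<le> ?A" by auto
qed

end

section \<open>The initial value and exponential moments of the integrated process\<close>

lemma X_0: "AE \<omega> in M. X 0 \<omega> = x"
proof -
  obtain I where ito: "is_ito_integral M F B (\<lambda>u \<omega>. sqrt (X u \<omega>)) I"
    and sde: "AE \<omega> in M. \<forall>t\<ge>0. X t \<omega> = x + 2 * I t \<omega> + integral {0..t} (\<lambda>u. \<Delta> u + 2 * \<theta> u * X u \<omega>)"
    using bessel by (auto simp: gen_sq_bessel2_def)
  have Im[measurable]: "I 0 \<in> borel_measurable M" using ito by (auto simp: is_ito_integral_def)
  obtain n \<tau> \<xi> where simple': "\<forall>k. simple_integrand M F (n k) (\<tau> k) (\<xi> k)"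
    and lim: "\<forall>u\<ge>0. \<forall>\<epsilon>>0. (\<lambda>k. measure M {\<omega>\<in>space M.
      \<epsilon> < \<bar>simple_integral B (n k) (\<tau> k) (\<xi> k) u \<omega> - I u \<omega>\<bar>}) \<longlonglongrightarrow> 0"
    using ito unfolding is_ito_integral_def by (elim conjE exE) (rule that, assumption+)
  note simple = simple'[rule_format]
  \<comment> \<open>\<open>is_ito_integral\<close> does not state that \<open>I\<close> starts at 0.
    It follows because all \<open>\<tau>\<close> are nonnegative, so every simple integral vanishes
    at time 0, and \<open>I 0\<close> is their limit in probability.\<close>
  have "simple_integral B (n k) (\<tau> k) (\<xi> k) 0 \<omega> = 0" for k \<omega>
    unfolding simple_integral_def
  proof (intro sum.neutral ballI)
    have \<tau>0: "i \<le> n k \<Longrightarrow> 0 \<le> \<tau> k i" for i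
    proof (induction i)
      case (Suc i)
      then have "0 \<le> \<tau> k i" "\<tau> k i \<le> \<tau> k (Suc i)"
        using simple[of k] by (auto simp: simple_integrand_def)
      then show ?case by simp
    qed (use simple[of k] in \<open>auto simp: simple_integrand_def\<close>)
    fix i assume "i \<in> {..<n k}"
    then show "\<xi> k i \<omega> * (B (min (\<tau> k (Suc i)) 0) \<omega> - B (min (\<tau> k i) 0) \<omega>) = 0"
      using \<tau>0[of i] \<tau>0[of "Suc i"] by simp
  qed
  then have zero: "measure M {\<omega>\<in>space M. e < \<bar>I 0 \<omega>\<bar>} = 0" if "0 < e" for e
    using lim[rule_format, OF order_refl that] by (simp add: LIMSEQ_const_iff)
  have "AE \<omega> in M. \<bar>I 0 \<omega>\<bar> \<le> 1 / real (Suc k)" for k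
  proof -
    have "{\<omega>\<in>space M. 1 / real (Suc k) < \<bar>I 0 \<omega>\<bar>} \<in> null_sets M"
      using zero[of "1 / real (Suc k)"] by (intro null_setsI) (auto simp: emeasure_eq_measure)
    then have "AE \<omega> in M. \<not> 1 / real (Suc k) < \<bar>I 0 \<omega>\<bar>" by (rule AE_not_in[THEN AE_mp]) auto
    then show ?thesis by (simp add: not_less)
  qed
  then have "AE \<omega> in M. \<forall>k. \<bar>I 0 \<omega>\<bar> \<le> 1 / real (Suc k)" by (simp add: AE_all_countable)
  then show ?thesis
    using sde
  proof eventually_elim
    case (elim \<omega>)
    have "\<bar>I 0 \<omega>\<bar> \<le> 0"
      by (rule LIMSEQ_le_const[OF LIMSEQ_Suc[OF lim_1_over_n]]) (use elim(1) in blast)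
    then show ?case using elim(2) by simp
  qed
qed

lemma initial_expectation:
  "(\<integral>\<^sup>+\<omega>. ennreal (exp (c * X 0 \<omega>)) \<partial>M) = ennreal (exp (c * x))"
proof -
  have "(\<integral>\<^sup>+\<omega>. ennreal (exp (c * X 0 \<omega>)) \<partial>M) = (\<integral>\<^sup>+\<omega>. ennreal (exp (c * x)) \<partial>M)"
    by (rule nn_integral_cong_AE) (use X_0 in eventually_elim, simp)
  then show ?thesis by (simp add: emeasure_space_1)
qed

text \<open>A negative increasing weight \<open>w\<close> with \<open>w' - 2 w\<^sup>2 \<ge> 0\<close> turns the supermartingale bound into
  an exponential moment, because \<open>w \<theta> \<ge> 0\<close>.\<close>

lemma negative_weight_bound:
  assumes \<omega>: "\<omega> \<in> space M" and s: "0 \<le> s" and st: "s \<le> t" and a: "0 \<le> a" and tT: "t \<le> T"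
    and k: "k + 2 * (a * (T - s))\<^sup>2 \<le> a"
  defines "w \<equiv> \<lambda>u. - a * (T - u)"
  shows "w s * X s \<omega> - w t * X t \<omega> + k * clock s t \<omega> + integral {s..t} (\<lambda>u. w u * \<Delta> u) \<le>
    log_weighted w (\<lambda>_. a) s t \<omega>"
proof -
  have "k * clock s t \<omega> = integral {s..t} (\<lambda>u. k * X u \<omega>)" by (simp add: clock_def)
  also have "\<dots> \<le> integral {s..t} (\<lambda>u. (a + 2 * w u * \<theta> u - 2 * (w u)\<^sup>2) * X u \<omega>)"
  proof (rule integral_le)
    show "(\<lambda>u. k * X u \<omega>) integrable_on {s..t}"
      by (intro integrable_continuous_real continuous_intros X_continuous \<omega> s)
    show "(\<lambda>u. (a + 2 * w u * \<theta> u - 2 * (w u)\<^sup>2) * X u \<omega>) integrable_on {s..t}"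
      unfolding w_def by (intro integrable_continuous_real continuous_intros X_continuous \<theta>_cont' \<omega> s)
    fix u assume u: "u \<in> {s..t}"
    have wu: "w u \<le> 0" using u a tT by (simp add: w_def)
    have "0 \<le> w u * \<theta> u" using wu \<theta>_nonpos[of u] u s by (simp add: mult_nonpos_nonpos)
    moreover have "(w u)\<^sup>2 \<le> (a * (T - s))\<^sup>2"
    proof -
      have "\<bar>w u\<bar> \<le> a * (T - s)"
        using u a tT unfolding w_def by (simp add: abs_mult mult_left_mono)
      from power_mono[OF this abs_ge_zero, of 2] show ?thesis by simp
    qed
    ultimately have "k \<le> a + 2 * w u * \<theta> u - 2 * (w u)\<^sup>2" using k by linarith
    then show "k * X u \<omega> \<le> (a + 2 * w u * \<theta> u - 2 * (w u)\<^sup>2) * X u \<omega>"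
      using X_nonneg[OF \<omega>, of u] u s by (intro mult_right_mono) auto
  qed
  finally show ?thesis unfolding log_weighted_def by linarith
qed

text \<open>Two negative linear weights are used in succession. On \<open>{s..t}\<close>,
  \<open>w2\<close> has slope \<open>2 * A\<close> and vanishes at \<open>t\<close>; it yields
  \<open>A * clock s t\<close> at the price of \<open>exp (2 * A * (t - s) * X s)\<close>. On
  \<open>{0..s}\<close>, \<open>w1\<close> controls this moment of \<open>X s\<close>, and the
  remaining cost is \<open>exp (- w1 0 * X 0)\<close>, a constant. The length \<open>h\<close>
  depends only on \<open>A\<close> and \<open>T\<close>, as a uniform subdivision requires.\<close>

lemma clock_exponential_moment:
  assumes A: "0 < A" and T: "0 \<le> T"
  shows "\<exists>h>0. \<forall>s t. 0 \<le> s \<longrightarrow> s \<le> t \<longrightarrow> t \<le> T \<longrightarrow> t - s \<le> h \<longrightarrow>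
    (\<integral>\<^sup>+\<omega>. ennreal (exp (A * clock s t \<omega>)) \<partial>M) < \<infinity>"
proof -
  \<comment> \<open>The largest \<open>e\<close> with \<open>2 * (e * (1 + T))^2 \<le> e\<close>,
    the slope condition of \<open>negative_weight_bound\<close> for \<open>k = 0\<close>. Using
    \<open>1 + T\<close> in place of \<open>T\<close> keeps \<open>e * (1 + T - u)\<close> at least
    \<open>e\<close> up to time \<open>T\<close>.\<close>
  define e where "e = 1 / (2 * (1 + T)\<^sup>2)"
  have e: "0 < e" using T by (simp add: e_def)
  have eD: "e * (1 + T)\<^sup>2 = 1 / 2" using T by (simp add: e_def)
  have "2 * (e * (1 + T))\<^sup>2 = 2 * (e * (e * (1 + T)\<^sup>2))" by (simp add: power2_eq_square)
  then have e2: "2 * (e * (1 + T))\<^sup>2 = e" unfolding eD by simp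
  have e_half: "e \<le> 1 / 2"
    using mult_left_mono[OF one_le_power[of "1 + T" 2], of e] T e eD by simp
  \<comment> \<open>The bound \<open>2 * A * h \<le> e / 4\<close> keeps \<open>- w2 s\<close> below
    \<open>- w1 s\<close>. Together with \<open>h \<le> 1\<close> and \<open>e \<le> 1 / 2\<close>
    it also gives the slope condition \<open>A + 2 * (2 * A * (t - s))^2 \<le> 2 * A\<close> for
    \<open>w2\<close>.\<close>
  define h where "h = min 1 (e / (8 * A))"
  have h: "0 < h" "h \<le> 1" "2 * A * h \<le> e / 4"
    using A e by (auto simp: h_def min_def field_simps)
  show ?thesis
  proof (intro exI[of _ h] conjI h(1) allI impI)
    fix s t assume s: "0 \<le> s" and st: "s \<le> t" and tT: "t \<le> T" and th: "t - s \<le> h"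
    define w1 where "w1 u = - e * (1 + T - u)" for u
    define w2 where "w2 u = - (2 * A) * (t - u)" for u
    have d1: "(w1 has_real_derivative e) (at u within S)" for u S
      unfolding w1_def[abs_def] by (auto intro!: derivative_eq_intros)
    have d2: "(w2 has_real_derivative 2 * A) (at u within S)" for u S
      unfolding w2_def[abs_def] by (auto intro!: derivative_eq_intros)
    let ?Y0 = "\<lambda>\<omega>. exp (- w1 0 * X 0 \<omega>)"
    let ?Y1 = "\<lambda>\<omega>. ?Y0 \<omega> * exp (log_weighted w1 (\<lambda>_. e) 0 s \<omega>)"
    have Y0m: "?Y0 \<in> borel_measurable (F 0)"
      by (intro measurable_compose[OF _ borel_measurable_exp] borel_measurable_times borel_measurable_const X_measurable) auto
    have Y1m: "?Y1 \<in> borel_measurable (F s)"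
      by (intro borel_measurable_times measurable_F_mono[OF Y0m s] measurable_compose[OF _ borel_measurable_exp]
          log_weighted_measurable[OF order_refl s d1 continuous_on_const])
    have "(\<integral>\<^sup>+\<omega>. ennreal (?Y1 \<omega> * exp (log_weighted w2 (\<lambda>_. 2 * A) s t \<omega>)) \<partial>M) \<le> (\<integral>\<^sup>+\<omega>. ennreal (?Y1 \<omega>) \<partial>M)"
      by (rule weighted_exponential_le[OF s st d2 continuous_on_const Y1m]) simp
    also have "\<dots> \<le> (\<integral>\<^sup>+\<omega>. ennreal (?Y0 \<omega>) \<partial>M)"
      by (rule weighted_exponential_le[OF order_refl s d1 continuous_on_const Y0m]) simp
    also have "\<dots> < \<infinity>" by (simp only: initial_expectation) simp
    finally have fin: "(\<integral>\<^sup>+\<omega>. ennreal (?Y1 \<omega> * exp (log_weighted w2 (\<lambda>_. 2 * A) s t \<omega>)) \<partial>M) < \<infinity>" .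
    define c where "c = integral {0..s} (\<lambda>u. w1 u * \<Delta> u) + integral {s..t} (\<lambda>u. w2 u * \<Delta> u)"
    have "(\<integral>\<^sup>+\<omega>. ennreal (exp (A * clock s t \<omega>)) \<partial>M) \<le>
        (\<integral>\<^sup>+\<omega>. ennreal (exp (- c)) * ennreal (?Y1 \<omega> * exp (log_weighted w2 (\<lambda>_. 2 * A) s t \<omega>)) \<partial>M)"
    proof (rule nn_integral_mono)
      fix \<omega> assume \<omega>: "\<omega> \<in> space M"
      have b1: "w1 0 * X 0 \<omega> - w1 s * X s \<omega> + 0 * clock 0 s \<omega> + integral {0..s} (\<lambda>u. w1 u * \<Delta> u) \<le>
          log_weighted w1 (\<lambda>_. e) 0 s \<omega>"
        unfolding w1_def
        by (rule negative_weight_bound[OF \<omega> order_refl s]) (use e e2 s st tT in auto)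
      have b2: "w2 s * X s \<omega> - w2 t * X t \<omega> + A * clock s t \<omega> + integral {s..t} (\<lambda>u. w2 u * \<Delta> u) \<le>
          log_weighted w2 (\<lambda>_. 2 * A) s t \<omega>"
        unfolding w2_def
      proof (rule negative_weight_bound[OF \<omega> s st])
        have 1: "0 \<le> 2 * A * (t - s)" using A st by simp
        have 2: "2 * A * (t - s) \<le> e / 4"
          using mult_left_mono[OF th, of "2 * A"] A h(3) by linarith
        have "(2 * A * (t - s))\<^sup>2 = (2 * A) * ((t - s) * (2 * A * (t - s)))" by (simp add: power2_eq_square)
        also have "\<dots> \<le> (2 * A) * (1 * (1 / 4))"
          using A st th h(2) 1 2 e_half by (intro mult_left_mono mult_mono) auto
        finally show "A + 2 * (2 * A * (t - s))\<^sup>2 \<le> 2 * A" by simp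
      qed (use A in auto)
      have "- w1 s * X s \<omega> + w2 s * X s \<omega> = (e * (1 + T - s) - 2 * A * (t - s)) * X s \<omega>"
        by (simp add: w1_def w2_def algebra_simps)
      moreover have "0 \<le> (e * (1 + T - s) - 2 * A * (t - s)) * X s \<omega>"
      proof (rule mult_nonneg_nonneg[OF _ X_nonneg[OF \<omega> s]])
        have "2 * A * (t - s) \<le> e / 4"
          using mult_left_mono[OF th, of "2 * A"] A h(3) by linarith
        also have "\<dots> \<le> e * 1" using e by simp
        also have "\<dots> \<le> e * (1 + T - s)" using e s st tT by (intro mult_left_mono) auto
        finally show "0 \<le> e * (1 + T - s) - 2 * A * (t - s)" by simp
      qed
      moreover have "w2 t = 0" by (simp add: w2_def)
      ultimately have "A * clock s t \<omega> \<le> - c + (- w1 0 * X 0 \<omega> + log_weighted w1 (\<lambda>_. e) 0 s \<omega> + log_weighted w2 (\<lambda>_. 2 * A) s t \<omega>)"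
        using b1 b2 by (simp add: c_def)
      then have "exp (A * clock s t \<omega>) \<le> exp (- c) * (?Y1 \<omega> * exp (log_weighted w2 (\<lambda>_. 2 * A) s t \<omega>))"
        by (simp add: algebra_simps flip: exp_add)
      from ennreal_leI[OF this]
      show "ennreal (exp (A * clock s t \<omega>)) \<le>
          ennreal (exp (- c)) * ennreal (?Y1 \<omega> * exp (log_weighted w2 (\<lambda>_. 2 * A) s t \<omega>))"
        by (subst ennreal_mult[symmetric]) auto
    qed
    also have "\<dots> = ennreal (exp (- c)) * (\<integral>\<^sup>+\<omega>. ennreal (?Y1 \<omega> * exp (log_weighted w2 (\<lambda>_. 2 * A) s t \<omega>)) \<partial>M)"
      by (intro nn_integral_cmult measurable_compose[OF _ measurable_ennreal] borel_measurable_times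
          measurable_F_M[OF Y1m] measurable_compose[OF _ borel_measurable_exp]
          measurable_F_M[OF log_weighted_measurable[OF s st d2 continuous_on_const]])
    also have "\<dots> < \<infinity>" using fin by (simp add: ennreal_mult_less_top)
    finally show "(\<integral>\<^sup>+\<omega>. ennreal (exp (A * clock s t \<omega>)) \<partial>M) < \<infinity>" .
  qed
qed

text \<open>Along a Riccati solution \<open>z' + 2 * z * \<theta> - 2 * z^2 = - \<gamma>\<close>, so
  \<open>log_weighted\<close> becomes the exponent of the Laplace transform up to the deterministic
  integral of \<open>\<Delta> * z\<close>. The equality on a short interval is applied with
  \<open>Y = N b\<close>, which is bounded by 1 because \<open>z\<close> and \<open>X\<close> are
  nonnegative.\<close>

lemma joint_laplace_riccati:
  assumes z: "riccati_solution \<theta> \<gamma> a T z" and T: "0 \<le> T" and \<gamma>: "0 < \<gamma>" and zT: "0 \<le> z T"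
  shows "joint_laplace M X \<gamma> T (z T) = exp (- x * a - integral {0..T} (\<lambda>u. \<Delta> u * z u))"
proof -
  have z0: "0 \<le> z u" if "0 \<le> u" "u \<le> T" for u
    by (rule riccati_nonneg[OF \<theta>_cont'[OF order_refl] z \<gamma> zT that])
  have zc: "continuous_on {0..T} z" by (rule riccati_solution_continuous[OF z])
  define z' where "z' u = 2 * (z u)\<^sup>2 - 2 * z u * \<theta> u - \<gamma>" for u
  have z'c: "continuous_on {0..T} z'"
    unfolding z'_def[abs_def] by (intro continuous_intros zc \<theta>_cont') simp
  have dz: "(z has_real_derivative z' u) (at u within {0..T})" if "u \<in> {0..T}" for u
    using z that by (auto simp: riccati_solution_def z'_def)
  have "compact (z ` {0..T})" by (rule compact_continuous_image[OF zc]) auto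
  then obtain W0 where W0: "\<And>u. u \<in> {0..T} \<Longrightarrow> \<bar>z u\<bar> \<le> W0"
    using compact_imp_bounded bounded_iff by (metis imageI real_norm_def)
  \<comment> \<open>The added 1 makes \<open>24 * W^2\<close> positive, as the moment lemma
    requires.\<close>
  define W where "W = \<bar>W0\<bar> + 1"
  have W: "0 < W" "\<And>u. u \<in> {0..T} \<Longrightarrow> \<bar>z u\<bar> \<le> W" using W0 by (force simp: W_def)+
  obtain h where h: "0 < h" and moment: "\<forall>s t. 0 \<le> s \<longrightarrow> s \<le> t \<longrightarrow> t \<le> T \<longrightarrow> t - s \<le> h \<longrightarrow>
      (\<integral>\<^sup>+\<omega>. ennreal (exp (24 * W\<^sup>2 * clock s t \<omega>)) \<partial>M) < \<infinity>"
    using clock_exponential_moment[of "24 * W\<^sup>2", OF _ T] W by auto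
  define N where "N b \<omega> = exp (- z b * X b \<omega> - \<gamma> * clock 0 b \<omega>)" for b \<omega>
  have Nm: "N b \<in> borel_measurable (F b)" if "0 \<le> b" for b
    unfolding N_def[abs_def]
    by (intro measurable_compose[OF _ borel_measurable_exp] borel_measurable_diff borel_measurable_times
        borel_measurable_const X_measurable clock_measurable that order_refl)
  let ?J = "\<lambda>a b. integral {a..b} (\<lambda>u. \<Delta> u * z u)"
  have step: "(\<integral>\<^sup>+\<omega>. ennreal (N c \<omega>) \<partial>M) = ennreal (exp (- ?J b c)) * (\<integral>\<^sup>+\<omega>. ennreal (N b \<omega>) \<partial>M)"
    if b: "0 \<le> b" "b \<le> c" "c \<le> T" "c - b \<le> h" for b c
  proof -
    have sub: "{b..c} \<subseteq> {0..T}" using b by auto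
    have d: "(z has_real_derivative z' u) (at u within {b..c})" if "u \<in> {b..c}" for u
      using has_field_derivative_subset[OF dz sub] that sub by auto
    have eq: "(\<integral>\<^sup>+\<omega>. ennreal (N b \<omega> * exp (log_weighted z z' b c \<omega>)) \<partial>M) = (\<integral>\<^sup>+\<omega>. ennreal (N b \<omega>) \<partial>M)"
    proof (rule weighted_exponential_eq[OF b(1,2) d continuous_on_subset[OF z'c sub] Nm[OF b(1)]])
      show "0 \<le> N b \<omega>" for \<omega> by (simp add: N_def)
      show "N b \<omega> \<le> 1" if "\<omega> \<in> space M" for \<omega>
      proof -
        have "0 \<le> z b * X b \<omega>" using X_nonneg[OF that b(1)] z0[of b] b by simp
        moreover have "0 \<le> \<gamma> * clock 0 b \<omega>" using clock_nonneg[OF that order_refl, of b] \<gamma> by simp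
        ultimately show ?thesis by (simp add: N_def)
      qed
      show "\<bar>z u\<bar> \<le> W" if "u \<in> {b..c}" for u using W(2) sub that by auto
      show "(\<integral>\<^sup>+\<omega>. ennreal (exp (24 * W\<^sup>2 * clock b c \<omega>)) \<partial>M) < \<infinity>" using moment b by blast
    qed
    have "N c \<omega> = exp (- ?J b c) * (N b \<omega> * exp (log_weighted z z' b c \<omega>))" if \<omega>: "\<omega> \<in> space M" for \<omega>
    proof -
      have "integral {b..c} (\<lambda>u. (z' u + 2 * z u * \<theta> u - 2 * (z u)\<^sup>2) * X u \<omega>) = - \<gamma> * clock b c \<omega>"
        by (simp add: z'_def clock_def)
      moreover have "clock 0 c \<omega> = clock 0 b \<omega> + clock b c \<omega>"
        by (rule clock_combine[OF \<omega> order_refl b(1,2)])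
      ultimately show ?thesis
        by (simp add: N_def log_weighted_def algebra_simps flip: exp_add)
    qed
    then have "(\<integral>\<^sup>+\<omega>. ennreal (N c \<omega>) \<partial>M) =
        (\<integral>\<^sup>+\<omega>. ennreal (exp (- ?J b c)) * ennreal (N b \<omega> * exp (log_weighted z z' b c \<omega>)) \<partial>M)"
      by (intro nn_integral_cong) (simp add: ennreal_mult N_def)
    also have "\<dots> = ennreal (exp (- ?J b c)) * (\<integral>\<^sup>+\<omega>. ennreal (N b \<omega> * exp (log_weighted z z' b c \<omega>)) \<partial>M)"
      by (intro nn_integral_cmult measurable_compose[OF _ measurable_ennreal] borel_measurable_times
          measurable_F_M[OF Nm[OF b(1)]] measurable_compose[OF _ borel_measurable_exp]
          measurable_F_M[OF log_weighted_measurable[OF b(1,2) d continuous_on_subset[OF z'c sub]]])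
    finally show ?thesis using eq by simp
  qed
  \<comment> \<open>The number of subintervals, each of length \<open>T / n \<le> h\<close>. The
    strict inequality gives \<open>n > 0\<close> even when \<open>T = 0\<close>.\<close>
  obtain n where n: "T / h < real n" using reals_Archimedean2 by blast
  have n0: "0 < real n" using n T h by (meson divide_nonneg_pos le_less_trans)
  define r where "r i = real i * (T / real n)" for i
  have r_Suc: "r (Suc i) = r i + T / real n" for i by (simp add: r_def algebra_simps add_divide_distrib)
  have r_step: "0 \<le> T / real n" "T / real n \<le> h" using n n0 h T by (auto simp: field_simps)
  have rn: "r n = T" using n0 by (simp add: r_def)
  have r0: "0 \<le> r i" for i using T n0 by (simp add: r_def)
  have rT: "r i \<le> T" if "i \<le> n" for i
  proof -
    have "r i \<le> r n" unfolding r_def using that r_step by (intro mult_right_mono) auto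
    then show ?thesis using rn by simp
  qed
  have "i \<le> n \<Longrightarrow> (\<integral>\<^sup>+\<omega>. ennreal (N (r i) \<omega>) \<partial>M) = ennreal (exp (- ?J 0 (r i))) * (\<integral>\<^sup>+\<omega>. ennreal (N 0 \<omega>) \<partial>M)" for i
  proof (induction i)
    case 0
    show ?case by (simp add: r_def)
  next
    case (Suc i)
    have "?J 0 (r i) + ?J (r i) (r (Suc i)) = ?J 0 (r (Suc i))"
      by (rule Henstock_Kurzweil_Integration.integral_combine, simp_all add: r0 r_Suc r_step, rule integrable_continuous_real,
          intro continuous_intros \<Delta>_cont' continuous_on_subset[OF zc])
        (use rT[of "Suc i"] Suc.prems r_Suc in auto)
    moreover have "(\<integral>\<^sup>+\<omega>. ennreal (N (r (Suc i)) \<omega>) \<partial>M) = ennreal (exp (- ?J (r i) (r (Suc i)))) * (\<integral>\<^sup>+\<omega>. ennreal (N (r i) \<omega>) \<partial>M)"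
      by (rule step) (use r0 r_Suc r_step rT[of "Suc i"] Suc.prems in auto)
    moreover have "ennreal (exp (- p)) * ennreal (exp (- q)) = ennreal (exp (- (q + p)))" for p q
      by (subst ennreal_mult[symmetric]) (simp_all add: algebra_simps flip: exp_add)
    ultimately show ?case using Suc.IH Suc.prems by (simp only: mult.assoc[symmetric])
  qed
  from this[of n] have "(\<integral>\<^sup>+\<omega>. ennreal (N T \<omega>) \<partial>M) = ennreal (exp (- ?J 0 T)) * (\<integral>\<^sup>+\<omega>. ennreal (N 0 \<omega>) \<partial>M)"
    by (simp add: rn)
  also have "(\<integral>\<^sup>+\<omega>. ennreal (N 0 \<omega>) \<partial>M) = ennreal (exp (- a * x))"
    using initial_expectation[of "- a"] z by (simp add: N_def clock_def riccati_solution_def)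
  finally have "(\<integral>\<^sup>+\<omega>. ennreal (N T \<omega>) \<partial>M) = ennreal (exp (- x * a - ?J 0 T))"
    by (simp add: mult.commute flip: ennreal_mult' exp_add)
  moreover have "joint_laplace M X \<gamma> T (z T) = enn2real (\<integral>\<^sup>+\<omega>. ennreal (N T \<omega>) \<partial>M)"
    unfolding joint_laplace_def N_def clock_def
    by (rule integral_eq_nn_integral)
      (use measurable_F_M[OF Nm[OF T]] in \<open>auto simp: N_def[abs_def] clock_def\<close>)
  ultimately show ?thesis by simp
qed

end

theorem proposition3p15:
  fixes M :: "'a measure" and F :: "real \<Rightarrow> 'a measure"
    and B X :: "real \<Rightarrow> 'a \<Rightarrow> real"
    and \<Delta> \<theta> :: "real \<Rightarrow> real" and x \<gamma> :: real
    and y :: "real \<Rightarrow> real \<Rightarrow> real"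
    and x0 x0_t x0_l :: "real \<Rightarrow> real \<Rightarrow> real"
  assumes "filtered_prob_space M F" and "brownian_motion M F B"
    and "continuous_on {0..} \<Delta>" and "\<forall>t\<ge>0. 0 \<le> \<Delta> t"
    and "continuous_on {0..} \<theta>" and "\<forall>t\<ge>0. \<theta> t \<le> 0"
    and "0 \<le> x" and "gen_sq_bessel2 M F B \<Delta> \<theta> x X"
    and "0 < \<gamma>"
    and "riccati_flow \<theta> \<gamma> y"
    and "C1_quadrant x0 x0_t x0_l"
    and "\<forall>t\<ge>0. \<forall>l\<ge>0. x0 t l \<in> riccati_domain \<theta> \<gamma> t \<and> y (x0 t l) t = l"
    and "\<forall>t\<ge>0. \<forall>l\<ge>0. 0 < \<bar>x0_l t l\<bar>"
    and "\<forall>t\<ge>0. (\<lambda>a. y a t) C1_differentiable_on riccati_domain \<theta> \<gamma> t"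
  shows "laplace_pde_solution \<Delta> \<theta> x \<gamma> (joint_laplace M X \<gamma>)
    \<and> (\<forall>q. laplace_pde_solution \<Delta> \<theta> x \<gamma> q \<longrightarrow>
          (\<forall>t\<ge>0. \<forall>l\<ge>0. q t l = joint_laplace M X \<gamma> t l))
    \<and> (\<forall>t\<ge>0. \<forall>l\<ge>0. joint_laplace M X \<gamma> t l =
          exp (- x * x0 t l - integral {0..t} (\<lambda>u. \<Delta> u * y (x0 t l) u)))"
proof -
  interpret riccati: bessel_characteristics \<theta> \<gamma> y x0 x0_t x0_l \<Delta> x
    by unfold_locales (use assms in auto)
  interpret bessel: squared_bessel M F B \<Delta> \<theta> x X
    by unfold_locales (use assms in auto)
  have formula: "joint_laplace M X \<gamma> t l =
      exp (- x * x0 t l - integral {0..t} (\<lambda>u. \<Delta> u * y (x0 t l) u))" if "0 \<le> t" "0 \<le> l" for t l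
    using bessel.joint_laplace_riccati[OF riccati.w_solution[OF that] that(1) assms(9)] riccati.w_end[OF that] that
    by (simp add: riccati.w_def)
  \<comment> \<open>The differential equation and uniqueness were obtained for
    \<open>exp (- h)\<close> alone; the probabilistic formula identifies it with the transform, and
    both properties carry over.\<close>
  then have eq: "exp (- riccati.h t l) = joint_laplace M X \<gamma> t l" if "0 \<le> t" "0 \<le> l" for t l
    using that by (simp add: riccati.h_def riccati.w_def)
  have "laplace_pde_solution \<Delta> \<theta> x \<gamma> (joint_laplace M X \<gamma>)"
    by (rule laplace_pde_solution_cong[OF riccati.exp_h_pde eq])
  moreover have "q t l = joint_laplace M X \<gamma> t l"
    if "laplace_pde_solution \<Delta> \<theta> x \<gamma> q" "0 \<le> t" "0 \<le> l" for q t l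
    using riccati.pde_unique[OF that] eq[OF that(2,3)] by simp
  ultimately show ?thesis using formula by blast
qed

end
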